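(* Let $r_0>1$ and let $X$ be an $r_0$-convex Banach function space over $\mathbf{R}^d$ with the Fatou property. Then the following are equivalent: (i) $M:X\to X$ and $M:X'\to X'$ are bounded; (ii) $\mathcal{M}:X[\ell^r]\to X[\ell^r]$ is bounded for some $1<r\le r_0$.
   Context: A Banach function space over $\mathbf{R}^d$ is a Banach space $X\subseteq L^0(\mathbf{R}^d)$ with the ideal property (if $f\in X$, $|g|\le|f|$ then $g\in X$, $\|g\|_X\le\|f\|_X$) and the saturation property (every set of positive measure contains a subset $F$ of positive measure with $\mathbf{1}_F\in X$). Köthe dual: $\|g\|_{X'}=\sup_{\|f\|_X=1}\int|fg|$. Fatou property: $0\le f_n\uparrow f$ a.e., $\sup\|f_n\|_X<\infty$ imply $f\in X$, $\|f\|_X=\sup\|f_n\|_X$. $X$ is $r$-convex if there is $C$ with $\|(\sum_{f\in\mathcal{F}}|f|^r)^{1/r}\|_X\le C(\sum_{f\in\mathcal{F}}\|f\|_X^r)^{1/r}$ for all finite $\mathcal{F}\subseteq X$. $M$ is the Hardy–Littlewood maximal operator over axis-parallel cubes. $\mathcal{Q}$ denotes the countable collection of cubes with rational corners; for $1\le r\le\infty$, $X[\ell^r]$ is the space of families $(f_Q)_{Q\in\mathcal{Q}}$ of measurable functions with $\|(f_Q)\|_{X[\ell^r]}=\|x\mapsto\|(f_Q(x))_{Q\in\mathcal{Q}}\|_{\ell^r}\|_X<\infty$; $\mathcal{M}((f_Q)_{Q\in\mathcal{Q}})=(\langle f_Q\rangle_Q\mathbf{1}_Q)_{Q\in\mathcal{Q}}$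 with $\langle f\rangle_Q=\frac1{|Q|}\int_Qf$. *)

theory Defs
  imports "HOL-Analysis.Analysis"
begin

text \<open>Functions live on a Euclidean space 'a (playing the role of R^d, d = DIM('a)),
  equipped with Lebesgue measure. A Banach function space X is encoded by its
  function norm N :: ('a => real) => ennreal, with X = {f measurable. N f < infinity}.\<close>

definition meas :: "('a::euclidean_space \<Rightarrow> real) \<Rightarrow> bool" where
  "meas f \<longleftrightarrow> f \<in> borel_measurable lebesgue"

definition banach_function_norm :: "(('a::euclidean_space \<Rightarrow> real) \<Rightarrow> ennreal) \<Rightarrow> bool" where
  "banach_function_norm N \<longleftrightarrow>
     \<comment> \<open>norm axioms on X\<close>
     (\<forall>f. meas f \<longrightarrow> (N f = 0 \<longleftrightarrow> (AE x in lebesgue. f x = 0))) \<and>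
     (\<forall>f c. meas f \<longrightarrow> N (\<lambda>x. c * f x) = ennreal \<bar>c\<bar> * N f) \<and>
     (\<forall>f g. meas f \<longrightarrow> meas g \<longrightarrow> N (\<lambda>x. f x + g x) \<le> N f + N g) \<and>
     \<comment> \<open>ideal property\<close>
     (\<forall>f g. meas f \<longrightarrow> meas g \<longrightarrow> (AE x in lebesgue. \<bar>g x\<bar> \<le> \<bar>f x\<bar>) \<longrightarrow> N g \<le> N f) \<and>
     \<comment> \<open>completeness (Banach space)\<close>
     (\<forall>f :: nat \<Rightarrow> 'a \<Rightarrow> real.
        (\<forall>n. meas (f n) \<and> N (f n) < \<infinity>) \<longrightarrow>
        (\<forall>e>0. \<exists>K. \<forall>m\<ge>K. \<forall>n\<ge>K. N (\<lambda>x. f m x - f n x) < ennreal e) \<longrightarrow>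
        (\<exists>g. meas g \<and> N g < \<infinity> \<and> (\<lambda>n. N (\<lambda>x. f n x - g x)) \<longlonglongrightarrow> 0)) \<and>
     \<comment> \<open>saturation property\<close>
     (\<forall>E\<in>sets lebesgue. emeasure lebesgue E > 0 \<longrightarrow>
        (\<exists>F\<in>sets lebesgue. F \<subseteq> E \<and> emeasure lebesgue F > 0 \<and> N (indicator F) < \<infinity>))"

definition koethe_dual :: "(('a::euclidean_space \<Rightarrow> real) \<Rightarrow> ennreal) \<Rightarrow> ('a \<Rightarrow> real) \<Rightarrow> ennreal" where
  "koethe_dual N g = (SUP f\<in>{f. meas f \<and> N f = 1}. \<integral>\<^sup>+ x. ennreal \<bar>f x * g x\<bar> \<partial>lebesgue)"

definition fatou_property :: "(('a::euclidean_space \<Rightarrow> real) \<Rightarrow> ennreal) \<Rightarrow> bool" where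
  "fatou_property N \<longleftrightarrow>
     (\<forall>(fs :: nat \<Rightarrow> 'a \<Rightarrow> real) f.
        (\<forall>n. meas (fs n)) \<longrightarrow> meas f \<longrightarrow>
        (AE x in lebesgue. (\<forall>n. 0 \<le> fs n x \<and> fs n x \<le> fs (Suc n) x) \<and> (\<lambda>n. fs n x) \<longlonglongrightarrow> f x) \<longrightarrow>
        (SUP n. N (fs n)) < \<infinity> \<longrightarrow> N f = (SUP n. N (fs n)))"

definition r_convex :: "(('a::euclidean_space \<Rightarrow> real) \<Rightarrow> ennreal) \<Rightarrow> real \<Rightarrow> bool" where
  "r_convex N r \<longleftrightarrow>
     (\<exists>C::real. \<forall>(n::nat) (f :: nat \<Rightarrow> 'a \<Rightarrow> real).
        (\<forall>i<n. meas (f i) \<and> N (f i) < \<infinity>) \<longrightarrow>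
        N (\<lambda>x. (\<Sum>i<n. \<bar>f i x\<bar> powr r) powr (1 / r))
          \<le> ennreal (C * (\<Sum>i<n. enn2real (N (f i)) powr r) powr (1 / r)))"

definition cube :: "'a::euclidean_space set \<Rightarrow> bool" where
  "cube Q \<longleftrightarrow> (\<exists>a t. t > 0 \<and> Q = cbox a (a + t *\<^sub>R One))"

definition rat_cubes :: "'a::euclidean_space set set" where
  "rat_cubes = {Q. \<exists>a b t. t > 0 \<and> b = a + t *\<^sub>R One \<and> Q = cbox a b \<and>
                       (\<forall>i\<in>Basis. a \<bullet> i \<in> \<rat> \<and> b \<bullet> i \<in> \<rat>)}"

definition maximal :: "('a::euclidean_space \<Rightarrow> real) \<Rightarrow> 'a \<Rightarrow> ennreal" where
  "maximal f x = (SUP Q\<in>{Q. cube Q \<and> x \<in> Q}.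
      (\<integral>\<^sup>+ y\<in>Q. ennreal \<bar>f y\<bar> \<partial>lebesgue) / emeasure lebesgue Q)"

definition maximal_bounded :: "(('a::euclidean_space \<Rightarrow> real) \<Rightarrow> ennreal) \<Rightarrow> bool" where
  "maximal_bounded N \<longleftrightarrow>
     (\<exists>C::real. \<forall>f. meas f \<and> N f < \<infinity> \<longrightarrow>
        (AE x in lebesgue. maximal f x < \<infinity>) \<and>
        meas (\<lambda>x. enn2real (maximal f x)) \<and>
        N (\<lambda>x. enn2real (maximal f x)) \<le> ennreal C * N f)"

definition lr_norm :: "real \<Rightarrow> ('a::euclidean_space set \<Rightarrow> 'a \<Rightarrow> real) \<Rightarrow> 'a \<Rightarrow> ennreal" where
  "lr_norm r F x =
     (let S = (\<Sum>\<^sub>\<infinity>Q\<in>rat_cubes. ennreal (\<bar>F Q x\<bar> powr r))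
      in if S = \<infinity> then \<infinity> else ennreal (enn2real S powr (1 / r)))"

definition Xlr_norm :: "(('a::euclidean_space \<Rightarrow> real) \<Rightarrow> ennreal) \<Rightarrow> real \<Rightarrow>
    ('a set \<Rightarrow> 'a \<Rightarrow> real) \<Rightarrow> ennreal" where
  "Xlr_norm N r F =
     (if (\<forall>Q\<in>rat_cubes. meas (F Q)) \<and> (AE x in lebesgue. lr_norm r F x < \<infinity>)
      then N (\<lambda>x. enn2real (lr_norm r F x)) else \<infinity>)"

definition cube_avg :: "('a::euclidean_space \<Rightarrow> real) \<Rightarrow> 'a set \<Rightarrow> real" where
  "cube_avg f Q = (set_lebesgue_integral lebesgue Q f) / measure lebesgue Q"

definition Mfam :: "('a::euclidean_space set \<Rightarrow> 'a \<Rightarrow> real) \<Rightarrow> 'a set \<Rightarrow> 'a \<Rightarrow> real" where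
  "Mfam F Q x = cube_avg (F Q) Q * indicator Q x"

text \<open>Boundedness of the averaging operator on X[l^r] (including that it is well defined,
  i.e. each component is integrable over its cube).\<close>
definition Mfam_bounded :: "(('a::euclidean_space \<Rightarrow> real) \<Rightarrow> ennreal) \<Rightarrow> real \<Rightarrow> bool" where
  "Mfam_bounded N r \<longleftrightarrow>
     (\<exists>C::real. \<forall>F. Xlr_norm N r F < \<infinity> \<longrightarrow>
        (\<forall>Q\<in>rat_cubes. set_integrable lebesgue Q (F Q)) \<and>
        Xlr_norm N r (Mfam F) \<le> ennreal C * Xlr_norm N r F)"

end

theory Submission
  imports Defs
begin

text \<open>For (i) implies (ii), positivity reduces the \<open>\<ell>\<^sup>r\<close> bound to the endpoints: with
  \<open>S = (\<Sum>\<bar>F\<^sub>Q\<bar>\<^sup>r)\<^bsup>1/r\<^esup>\<close> and \<open>G\<^sub>Q = S\<^bsup>1-r\<^esup> \<bar>F\<^sub>Q\<bar>\<^sup>r\<close>, Jensen gives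
  \<open>\<bar>\<langle>F\<^sub>Q\<rangle>\<bar>\<^sup>r \<le> \<langle>S\<rangle>\<^bsup>r-1\<^esup> \<langle>G\<^sub>Q\<rangle>\<close>, where \<open>\<langle>S\<rangle>\<close> is controlled by the maximal function on \<open>X\<close> and
  \<open>\<Sum> \<langle>G\<^sub>Q\<rangle> 1\<^sub>Q\<close> by the maximal function on \<open>X'\<close>, through \<open>X'' = X\<close>.

  For (ii) implies (i), the maximal function is dominated by finitely many operators
  \<open>T f = \<Sum>\<^sub>i 1\<^bsub>E i\<^esub> A\<^sub>i f\<close>, where \<open>A\<^sub>i\<close> averages over the \<open>i\<close>-th layer of a nested sparse family of dyadic
  cubes and \<open>E i\<close> is the part of that layer not covered by the next one. Sparseness makes
  \<open>A\<^sub>k f\<close> comparable to \<open>A\<^sub>k (1\<^bsub>E i\<^esub> A\<^sub>i f)\<close> when \<open>f\<close> lives on deeper layers than \<open>i \<ge> k\<close>, so an average can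
  be routed through any of \<open>n\<close> intermediate layers with disjoint supports. As \<open>1 < r < \<infinity>\<close>, the
  \<open>\<ell>\<^sup>r\<close> bound applied to the mean of these routes gains a negative power of \<open>n\<close>, whence geometric decay in the depth and
  the boundedness of \<open>T\<close> on \<open>X\<close>. The same argument bounds the adjoint of \<open>T\<close> on \<open>X\<close>, hence \<open>T\<close> on \<open>X'\<close>.\<close>

section \<open>Averages and finite power sums\<close>

text \<open>The \<open>\<ell>\<^sup>r\<close> bound with \<open>r < \<infinity>\<close> does not
  directly control a supremum of averages, and the maximal function has no adjoint; the linear
  operators \<open>T\<close> meet both obstacles. They depend on the function from which they are
  built, so every bound has to be uniform over all finite sparse families: only \<open>C\<close>,
  \<open>r\<close> and the block width \<open>n\<close> enter the constants, never the number of
  layers. This uniformity lets \<open>T\<close> built from \<open>g\<close> be tested against an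
  unrelated \<open>f\<close>, and then its adjoint acts on \<open>f\<close> in \<open>X\<close>. The
  gain is of order \<open>n powr (1 / r - 1)\<close> for \<open>T\<close> and
  \<open>n powr (- 1 / r)\<close> for the adjoint: the first disappears at \<open>r = 1\<close>, the
  second at \<open>r = \<infinity>\<close>. The sparse construction uses bounded functions and
  finitely many cubes; monotone limits remove these restrictions, in \<open>X\<close> by the Fatou
  property. The grid boxes are open, so that two boxes of one grid are nested or disjoint, whereas
  the cubes indexing the vector-valued space are closed; passing between the two costs a null
  set.\<close>

definition nonneg_bdd :: "('a::euclidean_space \<Rightarrow> real) \<Rightarrow> bool" where
  "nonneg_bdd f \<longleftrightarrow> f \<in> borel_measurable lebesgue \<and> (\<forall>x. 0 \<le> f x) \<and> (\<exists>B. \<forall>x. f x \<le> B)"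

lemma nonneg_bdd_measurable [measurable_dest]: "nonneg_bdd f \<Longrightarrow> f \<in> borel_measurable lebesgue"
  and nonneg_bdd_nonneg: "nonneg_bdd f \<Longrightarrow> 0 \<le> f x"
  by (auto simp: nonneg_bdd_def)

lemma nonneg_bddI:
  "f \<in> borel_measurable lebesgue \<Longrightarrow> (\<And>x. 0 \<le> f x) \<Longrightarrow> (\<And>x. f x \<le> B) \<Longrightarrow> nonneg_bdd f"
  by (auto simp: nonneg_bdd_def)

lemma nonneg_bdd_indicator: "S \<in> sets lebesgue \<Longrightarrow> nonneg_bdd (indicator S)"
  by (rule nonneg_bddI[where B = 1]) (auto simp: indicator_def)

lemma nonneg_bdd_const: "0 \<le> c \<Longrightarrow> nonneg_bdd (\<lambda>x. c)"
  by (rule nonneg_bddI[where B = c]) auto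

lemma nonneg_bdd_mult:
  assumes "nonneg_bdd f" "nonneg_bdd g"
  shows "nonneg_bdd (\<lambda>x. f x * g x)"
proof -
  obtain B B' where B: "\<And>x. f x \<le> B" "\<And>x. g x \<le> B'"
    using assms by (auto simp: nonneg_bdd_def)
  have "f x * g x \<le> B * B'" for x
    using B[of x] nonneg_bdd_nonneg[OF assms(1), of x] nonneg_bdd_nonneg[OF assms(2), of x]
    by (intro mult_mono) auto
  then show ?thesis
    using assms by (intro nonneg_bddI[where B = "B * B'"]) (auto simp: nonneg_bdd_def)
qed

lemma nonneg_bdd_sum:
  assumes "\<And>i. i \<in> I \<Longrightarrow> nonneg_bdd (f i)"
  shows "nonneg_bdd (\<lambda>x. \<Sum>i\<in>I. f i x)"
proof -
  have "\<forall>i\<in>I. \<exists>B. \<forall>x. f i x \<le> B"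
    using assms by (auto simp: nonneg_bdd_def)
  then obtain B where B: "\<And>i x. i \<in> I \<Longrightarrow> f i x \<le> B i"
    by metis
  show ?thesis
    using assms B by (intro nonneg_bddI[where B = "\<Sum>i\<in>I. B i"] borel_measurable_sum)
      (auto simp: nonneg_bdd_def intro!: sum_nonneg sum_mono)
qed

lemma set_integrable_nonneg_bdd:
  assumes "nonneg_bdd f" "Q \<in> lmeasurable"
  shows "set_integrable lebesgue Q f"
proof -
  obtain B where B: "\<And>x. f x \<le> B" using assms(1) by (auto simp: nonneg_bdd_def)
  have Q: "Q \<in> sets lebesgue" "emeasure lebesgue Q < \<infinity>"
    using assms(2) by (auto simp: fmeasurable_def)
  show ?thesis unfolding set_integrable_def
  proof (rule integrableI_bounded_set[where A = Q and B = B])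
    show "(\<lambda>x. indicat_real Q x *\<^sub>R f x) \<in> borel_measurable lebesgue"
      using assms(1) Q by (auto simp: nonneg_bdd_def intro!: borel_measurable_times)
    show "AE x\<in>Q in lebesgue. norm (indicat_real Q x *\<^sub>R f x) \<le> B"
      using B nonneg_bdd_nonneg[OF assms(1)] by (auto simp: indicator_def)
  qed (use Q in auto)
qed

lemma cube_avg_mono:
  assumes "nonneg_bdd f" "nonneg_bdd g" "Q \<in> lmeasurable" "\<And>x. x \<in> Q \<Longrightarrow> f x \<le> g x"
  shows "cube_avg f Q \<le> cube_avg g Q"
  unfolding cube_avg_def
  using assms by (intro divide_right_mono set_integral_mono set_integrable_nonneg_bdd) auto

lemma cube_avg_nonneg: "(\<And>x. 0 \<le> f x) \<Longrightarrow> 0 \<le> cube_avg f Q"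
  unfolding cube_avg_def set_lebesgue_integral_def
  by (intro divide_nonneg_nonneg integral_nonneg) auto

lemma cube_avg_sum:
  assumes "\<And>i. i \<in> I \<Longrightarrow> nonneg_bdd (f i)" "Q \<in> lmeasurable"
  shows "cube_avg (\<lambda>x. \<Sum>i\<in>I. f i x) Q = (\<Sum>i\<in>I. cube_avg (f i) Q)"
proof -
  have "set_lebesgue_integral lebesgue Q (\<lambda>x. \<Sum>i\<in>I. f i x) = (\<Sum>i\<in>I. set_lebesgue_integral lebesgue Q (f i))"
    unfolding set_lebesgue_integral_def scaleR_sum_right
    using set_integrable_nonneg_bdd[OF assms(1) assms(2)]
    by (intro Bochner_Integration.integral_sum) (auto simp: set_integrable_def)
  then show ?thesis
    by (simp add: cube_avg_def sum_divide_distrib)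
qed

lemma cube_avg_cmult: "cube_avg (\<lambda>x. c * f x) Q = c * cube_avg f Q"
  by (simp add: cube_avg_def)

lemma cube_avg_cong: "(\<And>x. x \<in> Q \<Longrightarrow> f x = g x) \<Longrightarrow> cube_avg f Q = cube_avg g Q"
  unfolding cube_avg_def set_lebesgue_integral_def
  by (intro arg_cong2[where f = "(/)"] Bochner_Integration.integral_cong) (auto simp: indicator_def)

lemma powr_inverse_self:
  fixes a r :: real
  assumes "0 \<le> a" "0 < r" shows "(a powr r) powr (1 / r) = a"
  using assms by (cases "a = 0") (auto simp: powr_powr)

section \<open>Comparison of finite sums with r-th power sums\<close>

lemma le_lr_sum:
  fixes a :: "'i \<Rightarrow> real"
  assumes "finite I" "i \<in> I" "0 < r" "0 \<le> a i"
  shows "a i \<le> (\<Sum>i\<in>I. a i powr r) powr (1 / r)"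
proof -
  have "a i = (a i powr r) powr (1 / r)" using assms by (simp add: powr_inverse_self)
  also have "\<dots> \<le> (\<Sum>i\<in>I. a i powr r) powr (1 / r)"
    using assms by (intro powr_mono2 member_le_sum) auto
  finally show ?thesis .
qed

text \<open>Applied with \<open>J\<close> a window of layers: overlap of multiplicity
  \<open>m\<close> costs only \<open>m powr (1 / r)\<close> instead of \<open>m\<close>, which is
  the source of the gain for the principal operator.\<close>

lemma lr_sum_le:
  fixes a :: "'i \<Rightarrow> real"
  assumes "finite I" "finite J" "card J \<le> m" "0 < r" "0 \<le> b"
    and "\<And>i. i \<in> I \<Longrightarrow> 0 \<le> a i" "\<And>i. i \<in> I \<Longrightarrow> a i \<le> b" "\<And>i. i \<in> I \<Longrightarrow> i \<notin> J \<Longrightarrow> a i = 0"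
  shows "(\<Sum>i\<in>I. a i powr r) powr (1 / r) \<le> real m powr (1 / r) * b"
proof -
  have "(\<Sum>i\<in>I. a i powr r) = (\<Sum>i\<in>I \<inter> J. a i powr r)"
    using assms by (intro sum.mono_neutral_right) auto
  also have "\<dots> \<le> (\<Sum>i\<in>I \<inter> J. b powr r)"
    using assms by (intro sum_mono powr_mono2) auto
  also have "\<dots> \<le> real m * b powr r"
  proof -
    have "card (I \<inter> J) \<le> m" using card_mono[OF assms(2), of "I \<inter> J"] assms(3) by auto
    then show ?thesis by (auto intro!: mult_right_mono)
  qed
  finally have "(\<Sum>i\<in>I. a i powr r) powr (1 / r) \<le> (real m * b powr r) powr (1 / r)"
    using assms by (intro powr_mono2 sum_nonneg) auto
  also have "\<dots> = real m powr (1 / r) * b"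
    using assms by (simp add: powr_mult powr_inverse_self)
  finally show ?thesis .
qed

text \<open>Hoelder's inequality against \<open>m\<close> ones, in the form of the power mean
  inequality; the exponent \<open>1 - 1 / r\<close> is the source of the gain for the
  adjoint.\<close>

lemma sum_le_lr_sum:
  fixes a :: "'i \<Rightarrow> real"
  assumes "finite I" "J \<subseteq> I" "card J \<le> m" "1 < r" "\<And>i. i \<in> I \<Longrightarrow> 0 \<le> a i"
  shows "(\<Sum>i\<in>J. a i) \<le> real m powr (1 - 1 / r) * (\<Sum>i\<in>I. a i powr r) powr (1 / r)"
proof -
  \<comment> \<open>Convexity of \<open>powr\<close> is used on the positive half-line, so vanishing
    terms are dropped before Jensen's inequality is applied.\<close>
  define J' where "J' = {i \<in> J. a i \<noteq> 0}"
  have finJ: "finite J" using assms finite_subset by blast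
  have J': "finite J'" "J' \<subseteq> I" "\<And>i. i \<in> J' \<Longrightarrow> 0 < a i"
    using finJ assms(2,5) by (force simp: J'_def less_le)+
  have card: "card J' \<le> m" using card_mono[OF finJ, of J'] assms(3) by (auto simp: J'_def)
  have "(\<Sum>i\<in>J. a i) = (\<Sum>i\<in>J'. a i)"
    using finJ by (intro sum.mono_neutral_right) (auto simp: J'_def)
  also have "\<dots> \<le> real m powr (1 - 1 / r) * (\<Sum>i\<in>I. a i powr r) powr (1 / r)"
  proof (cases "J' = {}")
    case False
    define k where "k = real (card J')"
    have k: "0 < k" using False J'(1) by (simp add: k_def card_gt_0_iff)
    have "(\<Sum>i\<in>J'. (1 / k) *\<^sub>R a i) powr r \<le> (\<Sum>i\<in>J'. (1 / k) * a i powr r)"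
      using J' False k assms
      by (intro convex_on_sum[where C = "{0<..}" and f = "\<lambda>x::real. x powr r"] powr_convex)
        (auto simp: k_def)
    then have "((\<Sum>i\<in>J'. a i) / k) powr r \<le> (\<Sum>i\<in>J'. a i powr r) / k"
      by (simp add: sum_divide_distrib[symmetric])
    then have "(((\<Sum>i\<in>J'. a i) / k) powr r) powr (1 / r) \<le> ((\<Sum>i\<in>J'. a i powr r) / k) powr (1 / r)"
      using assms by (intro powr_mono2) auto
    moreover have "0 \<le> (\<Sum>i\<in>J'. a i) / k"
      using J'(3) k by (intro divide_nonneg_nonneg sum_nonneg) (auto intro: less_imp_le)
    moreover have "((\<Sum>i\<in>J'. a i powr r) / k) powr (1 / r) = (\<Sum>i\<in>J'. a i powr r) powr (1 / r) / k powr (1 / r)"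
      by (intro powr_divide)
    ultimately have "(\<Sum>i\<in>J'. a i) / k \<le> (\<Sum>i\<in>J'. a i powr r) powr (1 / r) / k powr (1 / r)"
      using assms(4) powr_inverse_self[of "(\<Sum>i\<in>J'. a i) / k" r] by linarith
    then have "(\<Sum>i\<in>J'. a i) \<le> k powr (1 - 1 / r) * (\<Sum>i\<in>J'. a i powr r) powr (1 / r)"
      using k by (simp add: powr_diff field_simps)
    also have "\<dots> \<le> real m powr (1 - 1 / r) * (\<Sum>i\<in>I. a i powr r) powr (1 / r)"
      using assms k J' card by (intro mult_mono powr_mono2 sum_mono2 sum_nonneg) (auto simp: k_def)
    finally show ?thesis .
  qed auto
  finally show ?thesis .
qed

section \<open>Sparse layers\<close>

text \<open>Only measure and inclusion enter, so the layers may come from any laminar family.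
  \<open>sparse_L\<close> says that at least half of each cube of layer \<open>i\<close> lies in
  \<open>E i\<close>; every factor 2 in the routing estimates comes from it.\<close>

locale sparse_layers =
  fixes L :: "nat \<Rightarrow> 'a::euclidean_space set set" and K :: nat
  assumes finite_L: "finite (L i)"
    and L_eventually_empty: "K \<le> i \<Longrightarrow> L i = {}"
    and lmeasurable_L: "Q \<in> L i \<Longrightarrow> Q \<in> lmeasurable"
    and measure_L_pos: "Q \<in> L i \<Longrightarrow> 0 < measure lebesgue Q"
    and disjoint_L: "Q \<in> L i \<Longrightarrow> R \<in> L i \<Longrightarrow> Q \<noteq> R \<Longrightarrow> Q \<inter> R = {}"
    and nested_L: "Q \<in> L (Suc i) \<Longrightarrow> \<exists>R\<in>L i. Q \<subseteq> R"
    and sparse_L: "Q \<in> L i \<Longrightarrow> 2 * measure lebesgue (Q \<inter> \<Union>(L (Suc i))) \<le> measure lebesgue Q"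
begin

definition \<Omega> :: "nat \<Rightarrow> 'a set" where "\<Omega> i = \<Union>(L i)"

definition E :: "nat \<Rightarrow> 'a set" where "E i = \<Omega> i - \<Omega> (Suc i)"

definition e :: "nat \<Rightarrow> 'a \<Rightarrow> real" where "e i = indicator (E i)"

definition A :: "nat \<Rightarrow> ('a \<Rightarrow> real) \<Rightarrow> 'a \<Rightarrow> real" where
  "A i f x = (\<Sum>Q\<in>L i. cube_avg f Q * indicator Q x)"

lemma \<Omega>_antimono: "i \<le> j \<Longrightarrow> \<Omega> j \<subseteq> \<Omega> i"
  using nested_L by (rule_tac lift_Suc_antimono_le) (fastforce simp: \<Omega>_def)+

lemma nested_L_le: "i \<le> j \<Longrightarrow> Q \<in> L j \<Longrightarrow> \<exists>R\<in>L i. Q \<subseteq> R"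
proof (induction j arbitrary: Q rule: dec_induct)
  case base then show ?case by auto
next
  case (step j)
  then obtain R where "R \<in> L j" "Q \<subseteq> R" using nested_L by blast
  then show ?case using step.IH by (meson order_trans)
qed

lemma sets_L: "Q \<in> L i \<Longrightarrow> Q \<in> sets lebesgue"
  using lmeasurable_L by (auto simp: fmeasurable_def)

lemma sets_\<Omega> [measurable]: "\<Omega> i \<in> sets lebesgue"
  unfolding \<Omega>_def using finite_L sets_L by (intro sets.finite_Union) auto

lemma sets_E [measurable]: "E i \<in> sets lebesgue"
  unfolding E_def by auto

lemma nonneg_bdd_e: "nonneg_bdd (e i)"
  unfolding e_def by (intro nonneg_bdd_indicator sets_E)

lemma e_nonneg [simp]: "0 \<le> e i x" and e_le_1 [simp]: "e i x \<le> 1"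
  by (auto simp: e_def indicator_def)

lemma e_eq_0_iff: "e i x = 0 \<longleftrightarrow> x \<notin> E i" and e_eq_1: "x \<in> E i \<Longrightarrow> e i x = 1"
  by (auto simp: e_def indicator_def)

lemma e_ge_K: "K \<le> i \<Longrightarrow> e i x = 0"
  using L_eventually_empty by (auto simp: e_def E_def \<Omega>_def)

lemma E_unique: "x \<in> E i \<Longrightarrow> x \<in> E j \<Longrightarrow> i = j"
proof (induction i j rule: linorder_wlog)
  case (le i j)
  then show ?case using \<Omega>_antimono[of "Suc i" j] by (cases "i = j") (auto simp: E_def)
qed auto

lemma E_less_K: "x \<in> E i \<Longrightarrow> i < K"
  using L_eventually_empty[of i] by (force simp: E_def \<Omega>_def)

lemma ex_E:
  assumes "x \<in> \<Omega> i" obtains p where "i \<le> p" "p < K" "x \<in> E p"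
proof -
  \<comment> \<open>The least index from \<open>i\<close> on at which the next layer misses
    \<open>x\<close>; minimality puts \<open>x\<close> into layer \<open>p\<close> itself.\<close>
  define p where "p = (LEAST p. i \<le> p \<and> x \<notin> \<Omega> (Suc p))"
  have "i \<le> K + i \<and> x \<notin> \<Omega> (Suc (K + i))"
    using L_eventually_empty by (auto simp: \<Omega>_def)
  then have p: "i \<le> p \<and> x \<notin> \<Omega> (Suc p)"
    unfolding p_def by (rule LeastI)
  have "x \<in> \<Omega> p"
  proof (cases "p = i")
    case False
    then have "i \<le> p - 1" "p - 1 < p" using p by auto
    then have "x \<in> \<Omega> (Suc (p - 1))"
      using not_less_Least[of "p - 1" "\<lambda>p. i \<le> p \<and> x \<notin> \<Omega> (Suc p)"] by (auto simp: p_def)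
    then show ?thesis using \<open>p - 1 < p\<close> by simp
  qed (use assms in auto)
  then show thesis using p that E_less_K by (auto simp: E_def)
qed

lemma A_eq_0: "x \<notin> \<Omega> i \<Longrightarrow> A i f x = 0"
  by (auto simp: A_def \<Omega>_def indicator_def intro!: sum.neutral)

lemma sum_L_indicator:
  fixes c :: "'a set \<Rightarrow> real"
  assumes "Q \<in> L i" "x \<in> Q"
  shows "(\<Sum>R\<in>L i. c R * indicator R x) = c Q"
proof -
  have "x \<notin> R" if "R \<in> L i" "R \<noteq> Q" for R
    using disjoint_L[of Q i R] assms that by auto
  then have "(\<Sum>R\<in>L i. c R * indicator R x) = (\<Sum>R\<in>{Q}. c R * indicator R x)"
    using assms finite_L by (intro sum.mono_neutral_right) auto
  then show ?thesis using assms by simp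
qed

lemma A_eq: "Q \<in> L i \<Longrightarrow> x \<in> Q \<Longrightarrow> A i f x = cube_avg f Q"
  unfolding A_def by (rule sum_L_indicator)

lemma nonneg_bdd_A: "nonneg_bdd f \<Longrightarrow> nonneg_bdd (A i f)"
  unfolding A_def
  by (intro nonneg_bdd_sum nonneg_bdd_mult nonneg_bdd_const nonneg_bdd_indicator sets_L)
    (auto intro: cube_avg_nonneg nonneg_bdd_nonneg)

lemma A_mono:
  assumes "nonneg_bdd f" "nonneg_bdd g" "\<And>x. f x \<le> g x"
  shows "A i f x \<le> A i g x"
  unfolding A_def using assms
  by (intro sum_mono mult_right_mono cube_avg_mono lmeasurable_L) (auto simp: indicator_def)

lemma A_sum:
  assumes "\<And>j. j \<in> I \<Longrightarrow> nonneg_bdd (f j)"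
  shows "A i (\<lambda>x. \<Sum>j\<in>I. f j x) x = (\<Sum>j\<in>I. A i (f j) x)"
proof -
  have "A i (\<lambda>x. \<Sum>j\<in>I. f j x) x = (\<Sum>Q\<in>L i. \<Sum>j\<in>I. cube_avg (f j) Q * indicator Q x)"
    unfolding A_def using cube_avg_sum[of I f, OF assms lmeasurable_L]
    by (intro sum.cong) (auto simp: sum_distrib_right)
  also have "\<dots> = (\<Sum>j\<in>I. A i (f j) x)"
    unfolding A_def by (rule sum.swap)
  finally show ?thesis .
qed

lemma A_cmult: "A i (\<lambda>x. c * f x) x = c * A i f x"
  by (simp add: A_def cube_avg_cmult sum_distrib_left mult.assoc)

lemma measure_minus_\<Omega>:
  assumes "Q \<in> L i"
  shows "measure lebesgue Q \<le> 2 * measure lebesgue (Q - \<Omega> (Suc i))"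
proof -
  have "measure lebesgue (Q - (Q \<inter> \<Omega> (Suc i))) = measure lebesgue Q - measure lebesgue (Q \<inter> \<Omega> (Suc i))"
    using lmeasurable_L[OF assms] sets_\<Omega>[of "Suc i"] by (intro measurable_measure_Diff) auto
  moreover have "Q - (Q \<inter> \<Omega> (Suc i)) = Q - \<Omega> (Suc i)" by auto
  ultimately show ?thesis using sparse_L[OF assms] by (simp add: \<Omega>_def)
qed

lemma cube_avg_mult_measure: "Q \<in> L i \<Longrightarrow> cube_avg f Q * measure lebesgue Q = set_lebesgue_integral lebesgue Q f"
  using measure_L_pos[of Q i] by (simp add: cube_avg_def)

text \<open>On a cube \<open>R\<close> of layer \<open>i\<close> the mass of \<open>f\<close> is its
  average times the measure of \<open>R\<close>, and spreading that average over the part of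
  \<open>R\<close> in \<open>E i\<close> alone loses at most a factor 2. Since
  \<open>k \<le> i\<close>, each such \<open>R\<close> lies inside the cube of layer
  \<open>k\<close> around \<open>x\<close> or misses it, so the masses add up.\<close>

lemma A_\<Omega>_le:
  assumes "nonneg_bdd f" "k \<le> i"
  shows "A k (\<lambda>y. indicator (\<Omega> i) y * f y) x \<le> 2 * A k (\<lambda>y. e i y * A i f y) x"
proof (cases "x \<in> \<Omega> k")
  case True
  then obtain Q where Q: "Q \<in> L k" "x \<in> Q" by (auto simp: \<Omega>_def)
  have avgs: "0 \<le> cube_avg f R" for R
    using assms by (intro cube_avg_nonneg nonneg_bdd_nonneg)
  have 1: "indicator (\<Omega> i) y * f y = (\<Sum>R\<in>L i. f y * indicator R y)" for y
  proof (cases "y \<in> \<Omega> i")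
    case True
    then obtain R where "R \<in> L i" "y \<in> R" by (auto simp: \<Omega>_def)
    then show ?thesis using sum_L_indicator[of R i y "\<lambda>_. f y"] True by simp
  next
    case False
    then have "(\<Sum>R\<in>L i. f y * indicator R y) = 0"
      by (intro sum.neutral) (auto simp: \<Omega>_def)
    then show ?thesis using False by simp
  qed
  have 2: "e i y * A i f y = (\<Sum>R\<in>L i. cube_avg f R * indicator (R - \<Omega> (Suc i)) y)" for y
    unfolding A_def sum_distrib_left
    by (intro sum.cong) (auto simp: e_def E_def \<Omega>_def indicator_def)
  have 3: "cube_avg (\<lambda>y. f y * indicator R y) Q
      \<le> 2 * cube_avg (\<lambda>y. cube_avg f R * indicator (R - \<Omega> (Suc i)) y) Q" if R: "R \<in> L i" for R
  proof (cases "R \<subseteq> Q")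
    case True
    have "set_lebesgue_integral lebesgue Q (\<lambda>y. f y * indicator R y) = set_lebesgue_integral lebesgue R f"
      unfolding set_lebesgue_integral_def
      using True by (intro Bochner_Integration.integral_cong) (auto simp: indicator_def)
    also have "\<dots> = cube_avg f R * measure lebesgue R"
      using R by (simp add: cube_avg_mult_measure)
    also have "\<dots> \<le> cube_avg f R * (2 * measure lebesgue (R - \<Omega> (Suc i)))"
      using measure_minus_\<Omega>[OF R] avgs by (intro mult_left_mono) auto
    also have "\<dots> = 2 * set_lebesgue_integral lebesgue Q (\<lambda>y. cube_avg f R * indicator (R - \<Omega> (Suc i)) y)"
    proof -
      have "set_lebesgue_integral lebesgue Q (\<lambda>y. cube_avg f R * indicator (R - \<Omega> (Suc i)) y)
        = (\<integral>y. cube_avg f R * indicator (R - \<Omega> (Suc i)) y \<partial>lebesgue)"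
        unfolding set_lebesgue_integral_def
        using True by (intro Bochner_Integration.integral_cong) (auto simp: indicator_def)
      also have "\<dots> = cube_avg f R * measure lebesgue (R - \<Omega> (Suc i))"
        using lmeasurable_L[OF R] by simp
      finally show ?thesis by (metis mult.left_commute)
    qed
    finally show ?thesis
      unfolding cube_avg_def using divide_right_mono by fastforce
  next
    case False
    have "R \<inter> Q = {}"
    proof -
      obtain R' where "R' \<in> L k" "R \<subseteq> R'" using nested_L_le[OF assms(2) R] by blast
      then show ?thesis using disjoint_L[of R' k Q] Q False by blast
    qed
    then have "cube_avg (\<lambda>y. f y * indicator R y) Q = cube_avg (\<lambda>y. 0 * 0) Q"
      by (intro cube_avg_cong) (auto simp: indicator_def)
    then show ?thesis
      using avgs cube_avg_cmult[of 0 "\<lambda>_. 0" Q] by (auto intro!: cube_avg_nonneg)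
  qed
  have "A k (\<lambda>y. indicator (\<Omega> i) y * f y) x = (\<Sum>R\<in>L i. cube_avg (\<lambda>y. f y * indicator R y) Q)"
    unfolding A_eq[OF Q] 1
    using assms sets_L lmeasurable_L[OF Q(1)]
    by (intro cube_avg_sum) (auto intro!: nonneg_bdd_mult nonneg_bdd_indicator)
  also have "\<dots> \<le> (\<Sum>R\<in>L i. 2 * cube_avg (\<lambda>y. cube_avg f R * indicator (R - \<Omega> (Suc i)) y) Q)"
    by (intro sum_mono 3)
  also have "\<dots> = 2 * A k (\<lambda>y. e i y * A i f y) x"
    unfolding A_eq[OF Q] 2 sum_distrib_left[symmetric]
    using assms sets_L lmeasurable_L[OF Q(1)] avgs
    by (subst cube_avg_sum) (auto intro!: nonneg_bdd_mult nonneg_bdd_indicator nonneg_bdd_const)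
  finally show ?thesis .
qed (simp add: A_eq_0)

text \<open>\<open>A i f\<close> is constant on each cube of the deeper layer \<open>l\<close>, so
  only the density of \<open>E l\<close> in that cube matters, and by sparseness it is at least one
  half.\<close>

lemma A_le_A_A:
  assumes "nonneg_bdd f" "i \<le> l" "x \<in> \<Omega> l"
  shows "A i f x \<le> 2 * A l (\<lambda>y. e l y * A i f y) x"
proof -
  obtain Q where Q: "Q \<in> L l" "x \<in> Q" using assms(3) by (auto simp: \<Omega>_def)
  obtain R where R: "R \<in> L i" "Q \<subseteq> R" using nested_L_le[OF assms(2) Q(1)] by blast
  have eq: "A i f y = cube_avg f R" if "y \<in> Q" for y
    using R that by (auto intro: A_eq)
  have avgs: "0 \<le> cube_avg f R"
    using assms by (intro cube_avg_nonneg nonneg_bdd_nonneg)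
  have "A l (\<lambda>y. e l y * A i f y) x = cube_avg (\<lambda>y. cube_avg f R * e l y) Q"
    unfolding A_eq[OF Q] by (intro cube_avg_cong) (simp add: eq)
  also have "\<dots> = cube_avg f R * cube_avg (e l) Q"
    by (rule cube_avg_cmult)
  also have "cube_avg (e l) Q = measure lebesgue (Q - \<Omega> (Suc l)) / measure lebesgue Q"
  proof -
    have "set_lebesgue_integral lebesgue Q (e l) = (\<integral>y. indicator (Q - \<Omega> (Suc l)) y \<partial>lebesgue)"
      unfolding set_lebesgue_integral_def using Q
      by (intro Bochner_Integration.integral_cong) (auto simp: indicator_def e_def E_def \<Omega>_def)
    also have "\<dots> = measure lebesgue (Q - \<Omega> (Suc l))"
      using lmeasurable_L[OF Q(1)] by simp
    finally show ?thesis by (simp add: cube_avg_def)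
  qed
  finally have "2 * A l (\<lambda>y. e l y * A i f y) x = cube_avg f R * (2 * measure lebesgue (Q - \<Omega> (Suc l)) / measure lebesgue Q)"
    by simp
  moreover have "1 \<le> 2 * measure lebesgue (Q - \<Omega> (Suc l)) / measure lebesgue Q"
    using measure_minus_\<Omega>[OF Q(1)] measure_L_pos[OF Q(1)] by simp
  ultimately show ?thesis
    using avgs mult_left_mono[of 1 _ "cube_avg f R"] eq[OF Q(2)] by fastforce
qed

end

section \<open>Bounds for the principal operator and its adjoint\<close>

locale function_norm =
  fixes N :: "('a::euclidean_space \<Rightarrow> real) \<Rightarrow> ennreal"
  assumes bfn: "banach_function_norm N"
begin

lemma N_eq_0_iff: "f \<in> borel_measurable lebesgue \<Longrightarrow> N f = 0 \<longleftrightarrow> (AE x in lebesgue. f x = 0)"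
  using bfn unfolding banach_function_norm_def meas_def by blast

lemma N_cmult: "f \<in> borel_measurable lebesgue \<Longrightarrow> N (\<lambda>x. c * f x) = ennreal \<bar>c\<bar> * N f"
  using bfn unfolding banach_function_norm_def meas_def by blast

lemma N_add: "f \<in> borel_measurable lebesgue \<Longrightarrow> g \<in> borel_measurable lebesgue \<Longrightarrow> N (\<lambda>x. f x + g x) \<le> N f + N g"
  using bfn unfolding banach_function_norm_def meas_def by blast

lemma N_mono_AE: "f \<in> borel_measurable lebesgue \<Longrightarrow> g \<in> borel_measurable lebesgue \<Longrightarrow>
    (AE x in lebesgue. \<bar>g x\<bar> \<le> \<bar>f x\<bar>) \<Longrightarrow> N g \<le> N f"
  using bfn unfolding banach_function_norm_def meas_def by blast

lemma N_mono: "f \<in> borel_measurable lebesgue \<Longrightarrow> g \<in> borel_measurable lebesgue \<Longrightarrow>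
    (\<And>x. 0 \<le> g x) \<Longrightarrow> (\<And>x. g x \<le> f x) \<Longrightarrow> N g \<le> N f"
  by (rule N_mono_AE) (auto simp: abs_of_nonneg intro!: AE_I2 order_trans[OF _ abs_ge_self])

lemma N_zero: "N (\<lambda>x. 0) = 0"
  by (subst N_eq_0_iff) auto

lemma N_saturated: "S \<in> sets lebesgue \<Longrightarrow> 0 < emeasure lebesgue S \<Longrightarrow>
    \<exists>F\<in>sets lebesgue. F \<subseteq> S \<and> 0 < emeasure lebesgue F \<and> N (indicator F) < \<infinity>"
  using bfn unfolding banach_function_norm_def by blast

lemma N_sum:
  assumes "\<And>i. i \<in> I \<Longrightarrow> f i \<in> borel_measurable lebesgue"
  shows "N (\<lambda>x. \<Sum>i\<in>I. f i x) \<le> (\<Sum>i\<in>I. N (f i))"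
  using assms
proof (induction I rule: infinite_finite_induct)
  case (insert i I)
  have "N (\<lambda>x. \<Sum>i\<in>insert i I. f i x) = N (\<lambda>x. f i x + (\<Sum>i\<in>I. f i x))"
    using insert by simp
  also have "\<dots> \<le> N (f i) + N (\<lambda>x. \<Sum>i\<in>I. f i x)"
    using insert by (intro N_add borel_measurable_sum) auto
  also have "\<dots> \<le> (\<Sum>i\<in>insert i I. N (f i))"
    using insert by (auto intro: add_left_mono)
  finally show ?case .
qed (auto simp: N_zero)

text \<open>The bound is independent of the number of terms, which keeps the depth of the layers out
  of the final constants.\<close>

lemma N_geometric_sum:
  assumes f: "\<And>i. f i \<in> borel_measurable lebesgue"
    and half: "\<And>i. N (f (Suc i)) \<le> ennreal (1/2) * N (f i)"
  shows "N (\<lambda>x. \<Sum>i<k. f i x) \<le> 2 * N (f 0)"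
proof -
  have *: "N (f i) \<le> ennreal ((1/2)^i) * N (f 0)" for i
  proof (induction i)
    case (Suc i)
    have "N (f (Suc i)) \<le> ennreal (1/2) * (ennreal ((1/2)^i) * N (f 0))"
      using half[of i] Suc by (meson mult_left_mono order_trans zero_le)
    also have "\<dots> = ennreal ((1/2) * (1/2)^i) * N (f 0)"
      by (subst ennreal_mult) (auto simp: mult.assoc)
    finally show ?case by simp
  qed auto
  have "N (\<lambda>x. \<Sum>i<k. f i x) \<le> (\<Sum>i<k. N (f i))"
    by (intro N_sum f)
  also have "\<dots> \<le> (\<Sum>i<k. ennreal ((1/2)^i) * N (f 0))"
    by (intro sum_mono *)
  also have "\<dots> = ennreal (\<Sum>i<k. (1/2)^i) * N (f 0)"
    by (simp add: sum_distrib_right[symmetric])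
  also have "\<dots> \<le> ennreal 2 * N (f 0)"
    by (intro mult_right_mono ennreal_leI) (auto simp: geometric_sum)
  finally show ?thesis by simp
qed

end

lemma borel_measurable_lr_sum:
  assumes "\<And>i. i \<in> I \<Longrightarrow> h i \<in> borel_measurable M"
  shows "(\<lambda>x. (\<Sum>i\<in>I. h i x powr r) powr (1 / r :: real)) \<in> borel_measurable M"
  using assms by (intro powr_real_measurable borel_measurable_sum) auto

text \<open>\<open>n\<close> is the number of intermediate layers over which routes are averaged.
  \<open>n_large\<close> makes the principal blocks decay and \<open>n_large'\<close> those of the
  adjoint, both with ratio one half. In \<open>vector_bound\<close> all cubes of one layer are
  merged into the single operator \<open>A i\<close>, which is legitimate because they are
  disjoint.\<close>

locale sparse_layers_norm = sparse_layers L K + function_norm N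
  for L :: "nat \<Rightarrow> 'a::euclidean_space set set" and K and N +
  fixes C r :: real and n :: nat
  assumes C_pos: "0 < C" and r_gt_1: "1 < r" and n_pos: "0 < n"
    and n_large: "C * (2 / n) * (2 * n) powr (1 / r) \<le> 1 / 2"
    and n_large': "C * (2 / n) * (2 * n) powr (1 - 1 / r) \<le> 1 / 2"
    and vector_bound: "\<And>h. (\<And>i. nonneg_bdd (h i)) \<Longrightarrow>
        N (\<lambda>x. (\<Sum>i<K. A i (h i) x powr r) powr (1 / r)) \<le> ennreal C * N (\<lambda>x. (\<Sum>i<K. h i x powr r) powr (1 / r))"
begin

lemma e_mult_sum: "q < K \<Longrightarrow> e q x * (\<Sum>p<K. e p x * c p) = e q x * c q"
proof (cases "x \<in> E q")
  case True
  assume "q < K"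
  then have "(\<Sum>p<K. e p x * c p) = (\<Sum>p\<in>{q}. e p x * c p)"
    using True E_unique by (intro sum.mono_neutral_right) (auto simp: e_eq_0_iff)
  then show ?thesis using True by (simp add: e_eq_1)
qed (simp add: e_eq_0_iff[THEN iffD2])

lemma sum_e_eq: "x \<in> E p \<Longrightarrow> (\<Sum>q<K. e q x * c q) = c p"
  using e_mult_sum[of p x c] E_less_K[of x p] by (simp add: e_eq_1)

lemma sum_e_eq_0: "x \<notin> \<Omega> 0 \<Longrightarrow> (\<Sum>q<K. e q x * c q) = 0"
  using \<Omega>_antimono by (intro sum.neutral) (auto simp: e_eq_0_iff E_def)

lemma sum_e_le_1: "finite I \<Longrightarrow> (\<Sum>q\<in>I. e q x) \<le> 1"
proof (cases "\<exists>p\<in>I. x \<in> E p")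
  case True
  assume fin: "finite I"
  from True obtain p where p: "p \<in> I" "x \<in> E p" by auto
  then have "(\<Sum>q\<in>I. e q x) = (\<Sum>q\<in>{p}. e q x)"
    using E_unique fin by (intro sum.mono_neutral_right) (auto simp: e_eq_0_iff)
  then show ?thesis by simp
next
  case False
  then have "(\<Sum>q\<in>I. e q x) = 0" by (intro sum.neutral) (auto simp: e_eq_0_iff)
  then show ?thesis by simp
qed

lemma card_window: "card {p. p \<le> q \<and> q < p + 2 * n} \<le> 2 * n" "finite {p. p \<le> q \<and> q < p + 2 * n}"
proof -
  have "{p. p \<le> q \<and> q < p + 2 * n} \<subseteq> {q + 1 - 2 * n..q}" by auto
  from card_mono[OF _ this] show "card {p. p \<le> q \<and> q < p + 2 * n} \<le> 2 * n" by auto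
qed auto

text \<open>Common frame of the four block estimates: \<open>a\<close> is the cost of recovering the
  target from the averaged family, \<open>b\<close> the cost of overlap in the family that is fed
  in. One of the two is always 1.\<close>

lemma norm_step:
  assumes h: "\<And>i. nonneg_bdd (h i)" and G: "nonneg_bdd G" and G': "nonneg_bdd G'"
    and "0 \<le> a" "0 \<le> b"
    and 1: "\<And>x. G' x \<le> a * (\<Sum>i<K. A i (h i) x powr r) powr (1 / r)"
    and 2: "\<And>x. (\<Sum>i<K. h i x powr r) powr (1 / r) \<le> b * G x"
  shows "N G' \<le> ennreal (C * a * b) * N G"
proof -
  have m: "(\<lambda>x. (\<Sum>i<K. A i (h i) x powr r) powr (1 / r)) \<in> borel_measurable lebesgue"
      "(\<lambda>x. (\<Sum>i<K. h i x powr r) powr (1 / r)) \<in> borel_measurable lebesgue"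
    using h nonneg_bdd_A by (intro borel_measurable_lr_sum; auto simp: nonneg_bdd_def)+
  have mG: "G \<in> borel_measurable lebesgue" "G' \<in> borel_measurable lebesgue"
    using G G' by (auto simp: nonneg_bdd_def)
  have "N G' \<le> N (\<lambda>x. a * (\<Sum>i<K. A i (h i) x powr r) powr (1 / r))"
    using 1 m mG nonneg_bdd_nonneg[OF G'] by (intro N_mono) auto
  also have "\<dots> = ennreal a * N (\<lambda>x. (\<Sum>i<K. A i (h i) x powr r) powr (1 / r))"
    using m \<open>0 \<le> a\<close> by (simp add: N_cmult)
  also have "\<dots> \<le> ennreal a * (ennreal C * N (\<lambda>x. (\<Sum>i<K. h i x powr r) powr (1 / r)))"
    by (intro mult_left_mono vector_bound h) auto
  also have "\<dots> \<le> ennreal a * (ennreal C * N (\<lambda>x. b * G x))"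
    using 2 m mG by (intro mult_left_mono N_mono) auto
  also have "\<dots> = ennreal (C * a * b) * N G"
    using mG \<open>0 \<le> a\<close> \<open>0 \<le> b\<close> C_pos by (simp add: N_cmult ennreal_mult' ac_simps)
  finally show ?thesis .
qed

context
  fixes f :: "'a \<Rightarrow> real"
  assumes f: "nonneg_bdd f"
begin

text \<open>Let \<open>\<Gamma> s\<close> collect, at points of the sets \<open>E p\<close>, the averages over the \<open>p\<close>-th layer of the part
  of \<open>f\<close> living \<open>s n, \<dots>, (s + 1) n - 1\<close> layers below. The parts in \<open>\<Gamma> (Suc s)\<close> may first be averaged over any
  of the \<open>n\<close> layers lying \<open>s n, \<dots>, (s + 1) n - 1\<close> steps above it; averaging over these choices and applying the vector
  bound gains a factor of order \<open>n powr (1 / r - 1)\<close>, which makes the norms of \<open>\<Gamma> s\<close> decay geometrically.\<close>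

definition blk :: "nat \<Rightarrow> nat \<Rightarrow> 'a \<Rightarrow> real" where
  "blk s p y = f y * (\<Sum>j\<in>{p + s * n..<p + Suc s * n}. e j y)"

definition \<Gamma> :: "nat \<Rightarrow> 'a \<Rightarrow> real" where
  "\<Gamma> s x = (\<Sum>p<K. e p x * A p (blk s p) x)"

lemma nonneg_bdd_blk: "nonneg_bdd (blk s p)"
  unfolding blk_def by (intro nonneg_bdd_mult nonneg_bdd_sum nonneg_bdd_e f)

lemma nonneg_bdd_\<Gamma>: "nonneg_bdd (\<Gamma> s)"
  unfolding \<Gamma>_def by (intro nonneg_bdd_mult nonneg_bdd_sum nonneg_bdd_e nonneg_bdd_A nonneg_bdd_blk)

text \<open>Double counting by the offset \<open>l = j - q\<close>: each \<open>j\<close> on the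
  left is met once for every \<open>l\<close> with \<open>s * n \<le> l < Suc s * n\<close>, and
  then \<open>q = j - l\<close> lies in the window of \<open>2 * n\<close> layers below
  \<open>p\<close>.\<close>

lemma window_count:
  "real n * (\<Sum>j\<in>{p + Suc s * n..<p + Suc (Suc s) * n}. e j y)
    \<le> (\<Sum>q\<in>{p..<p + 2 * n}. \<Sum>j\<in>{q + s * n..<q + Suc s * n}. e j y)"
proof -
  have "real n * (\<Sum>j\<in>{p + Suc s * n..<p + Suc (Suc s) * n}. e j y)
    = (\<Sum>l\<in>{s * n..<Suc s * n}. \<Sum>j\<in>{p + Suc s * n..<p + Suc (Suc s) * n}. e j y)"
    by simp
  also have "\<dots> \<le> (\<Sum>l\<in>{s * n..<Suc s * n}. \<Sum>j\<in>{p + l..<(p + 2 * n) + l}. e j y)"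
    by (intro sum_mono sum_mono2) (auto simp: algebra_simps)
  also have "\<dots> = (\<Sum>l\<in>{s * n..<Suc s * n}. \<Sum>q\<in>{p..<p + 2 * n}. e (q + l) y)"
    by (simp only: sum.shift_bounds_nat_ivl)
  also have "\<dots> = (\<Sum>q\<in>{p..<p + 2 * n}. \<Sum>l\<in>{s * n..<Suc s * n}. e (q + l) y)"
    by (rule sum.swap)
  also have "\<dots> = (\<Sum>q\<in>{p..<p + 2 * n}. \<Sum>j\<in>{q + s * n..<q + Suc s * n}. e j y)"
  proof -
    have "(\<Sum>l\<in>{s * n..<Suc s * n}. e (q + l) y) = (\<Sum>j\<in>{q + s * n..<q + Suc s * n}. e j y)" for q
      using sum.shift_bounds_nat_ivl[of "\<lambda>j. e j y" "s * n" q "Suc s * n"]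
      by (simp add: add.commute)
    then show ?thesis by simp
  qed
  finally show ?thesis .
qed

text \<open>By \<open>window_count\<close>, \<open>n\<close> copies of a block of depth
  \<open>Suc s\<close> below \<open>p\<close> split into blocks of depth \<open>s\<close> below the
  layers \<open>q\<close> of the window. Each of these is routed through layer \<open>q\<close> by
  \<open>A_\<Omega>_le\<close>, where it becomes the restriction of \<open>\<Gamma> s\<close> to
  \<open>E q\<close>.\<close>

lemma \<Gamma>_step:
  assumes "x \<in> E p"
  shows "real n * \<Gamma> (Suc s) x \<le> 2 * A p (\<lambda>y. (\<Sum>q\<in>{p..<p + 2 * n}. e q y) * \<Gamma> s y) x"
proof -
  have "real n * \<Gamma> (Suc s) x = A p (\<lambda>y. real n * blk (Suc s) p y) x"
    unfolding \<Gamma>_def sum_e_eq[OF assms] by (simp add: A_cmult)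
  also have "\<dots> \<le> A p (\<lambda>y. \<Sum>q\<in>{p..<p + 2 * n}. blk s q y) x"
  proof (rule A_mono)
    fix y
    show "real n * blk (Suc s) p y \<le> (\<Sum>q\<in>{p..<p + 2 * n}. blk s q y)"
      using mult_left_mono[OF window_count[of y p s] nonneg_bdd_nonneg[OF f, of y]]
      by (simp add: blk_def sum_distrib_left mult.left_commute)
  qed (intro nonneg_bdd_mult nonneg_bdd_const nonneg_bdd_sum nonneg_bdd_blk; simp)+
  also have "\<dots> = (\<Sum>q\<in>{p..<p + 2 * n}. A p (\<lambda>y. indicator (\<Omega> q) y * blk s q y) x)"
  proof -
    \<comment> \<open>\<open>blk s q\<close> lives on the sets \<open>E j\<close> with
      \<open>j \<ge> q\<close>, so the indicator demanded by \<open>A_\<Omega>_le\<close> can be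
      inserted freely.\<close>
    have "indicator (\<Omega> q) y * blk s q y = blk s q y" for q y
    proof (cases "y \<in> \<Omega> q")
      case False
      have "e j y = 0" if "j \<in> {q + s * n..<q + Suc s * n}" for j
        using \<Omega>_antimono[of q j] that False by (auto simp: e_eq_0_iff E_def)
      then have "(\<Sum>j\<in>{q + s * n..<q + Suc s * n}. e j y) = 0" by (intro sum.neutral) auto
      then show ?thesis by (simp add: blk_def)
    qed simp
    then have "(\<lambda>y. indicator (\<Omega> q) y * blk s q y) = blk s q" for q by auto
    then show ?thesis by (simp only:) (rule A_sum, rule nonneg_bdd_blk)
  qed
  also have "\<dots> \<le> (\<Sum>q\<in>{p..<p + 2 * n}. 2 * A p (\<lambda>y. e q y * A q (blk s q) y) x)"
    by (intro sum_mono A_\<Omega>_le nonneg_bdd_blk) auto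
  also have "\<dots> = 2 * A p (\<lambda>y. \<Sum>q\<in>{p..<p + 2 * n}. e q y * A q (blk s q) y) x"
    unfolding sum_distrib_left[symmetric]
    by (subst A_sum) (auto intro!: nonneg_bdd_mult nonneg_bdd_e nonneg_bdd_A nonneg_bdd_blk)
  also have "(\<lambda>y. \<Sum>q\<in>{p..<p + 2 * n}. e q y * A q (blk s q) y) = (\<lambda>y. (\<Sum>q\<in>{p..<p + 2 * n}. e q y) * \<Gamma> s y)"
  proof
    fix y
    have "e q y * A q (blk s q) y = e q y * \<Gamma> s y" for q
      unfolding \<Gamma>_def by (cases "q < K") (simp_all add: e_mult_sum e_ge_K)
    then show "(\<Sum>q\<in>{p..<p + 2 * n}. e q y * A q (blk s q) y) = (\<Sum>q\<in>{p..<p + 2 * n}. e q y) * \<Gamma> s y"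
      by (simp only: sum_distrib_right)
  qed
  finally show ?thesis .
qed

lemma N_\<Gamma>_Suc: "N (\<Gamma> (Suc s)) \<le> ennreal (1 / 2) * N (\<Gamma> s)"
proof -
  \<comment> \<open>The factor \<open>2 / n\<close> is the one of \<open>\<Gamma>_step\<close>. A
    point of \<open>E q\<close> lies in the support of \<open>h p\<close> only for
    \<open>p \<le> q < p + 2 * n\<close>, so the overlap costs \<open>(2 * n) powr (1 / r)\<close>,
    and \<open>r > 1\<close> makes the product with \<open>2 / n\<close> small.\<close>
  define h where "h p y = (2 / n) * ((\<Sum>q\<in>{p..<p + 2 * n}. e q y) * \<Gamma> s y)" for p y
  have h: "nonneg_bdd (h p)" for p
    unfolding h_def by (intro nonneg_bdd_mult nonneg_bdd_const nonneg_bdd_sum nonneg_bdd_e nonneg_bdd_\<Gamma>) auto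
  note h0 = nonneg_bdd_nonneg[OF h]
  have "N (\<Gamma> (Suc s)) \<le> ennreal (C * 1 * ((2 * n) powr (1 / r) * (2 / n))) * N (\<Gamma> s)"
  proof (rule norm_step[OF h nonneg_bdd_\<Gamma> nonneg_bdd_\<Gamma>])
    fix x
    show "\<Gamma> (Suc s) x \<le> 1 * (\<Sum>p<K. A p (h p) x powr r) powr (1 / r)"
    proof (cases "x \<in> \<Omega> 0")
      case True
      then obtain p where p: "p < K" "x \<in> E p" using ex_E by blast
      have "\<Gamma> (Suc s) x \<le> A p (h p) x"
        using \<Gamma>_step[OF p(2), of s] n_pos unfolding h_def A_cmult by (simp add: field_simps)
      also have "\<dots> \<le> (\<Sum>p<K. A p (h p) x powr r) powr (1 / r)"
        using p r_gt_1 nonneg_bdd_nonneg[OF nonneg_bdd_A[OF h]]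
        by (intro le_lr_sum[where a = "\<lambda>p. A p (h p) x"]) auto
      finally show ?thesis by simp
    qed (simp add: \<Gamma>_def sum_e_eq_0)
    show "(\<Sum>p<K. h p x powr r) powr (1 / r) \<le> (2 * n) powr (1 / r) * (2 / n) * \<Gamma> s x"
    proof (cases "x \<in> \<Omega> 0")
      case True
      then obtain q where q: "q < K" "x \<in> E q" using ex_E by blast
      have "(\<Sum>p<K. h p x powr r) powr (1 / r) \<le> real (2 * n) powr (1 / r) * ((2 / n) * \<Gamma> s x)"
      proof (rule lr_sum_le[OF _ card_window(2) card_window(1)])
        show "h p x \<le> 2 / n * \<Gamma> s x" for p
          unfolding h_def using sum_e_le_1[of "{p..<p + 2 * n}" x] nonneg_bdd_nonneg[OF nonneg_bdd_\<Gamma>, of s x]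
          by (intro mult_left_mono mult_left_le_one_le sum_nonneg) auto
        show "h p x = 0" if "p \<notin> {p. p \<le> q \<and> q < p + 2 * n}" for p
        proof -
          have "e j x = 0" if "j \<in> {p..<p + 2 * n}" for j
            using E_unique[OF q(2), of j] that \<open>p \<notin> _\<close> by (auto simp: e_eq_0_iff)
          then show ?thesis by (simp add: h_def)
        qed
      qed (use r_gt_1 h0 nonneg_bdd_nonneg[OF nonneg_bdd_\<Gamma>] in auto)
      then show ?thesis by (simp add: mult.assoc)
    qed (simp add: \<Gamma>_def sum_e_eq_0 h_def)
  qed (use n_pos in auto)
  also have "\<dots> \<le> ennreal (1 / 2) * N (\<Gamma> s)"
    using n_large by (intro mult_right_mono ennreal_leI) (auto simp: ac_simps)
  finally show ?thesis .
qed

lemma N_\<Gamma>_0: "N (\<Gamma> 0) \<le> ennreal (C * (2 * n) powr (1 / r)) * N f"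
proof -
  have "N (\<Gamma> 0) \<le> ennreal (C * 1 * (2 * n) powr (1 / r)) * N f"
  proof (rule norm_step[OF nonneg_bdd_blk f nonneg_bdd_\<Gamma>])
    fix x
    show "\<Gamma> 0 x \<le> 1 * (\<Sum>p<K. A p (blk 0 p) x powr r) powr (1 / r)"
    proof (cases "x \<in> \<Omega> 0")
      case True
      then obtain p where p: "p < K" "x \<in> E p" using ex_E by blast
      have "\<Gamma> 0 x = A p (blk 0 p) x" unfolding \<Gamma>_def sum_e_eq[OF p(2)] ..
      also have "\<dots> \<le> (\<Sum>p<K. A p (blk 0 p) x powr r) powr (1 / r)"
        using p r_gt_1 nonneg_bdd_nonneg[OF nonneg_bdd_A[OF nonneg_bdd_blk]]
        by (intro le_lr_sum[where a = "\<lambda>p. A p (blk 0 p) x"]) auto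
      finally show ?thesis by simp
    qed (simp add: \<Gamma>_def sum_e_eq_0)
    have blk_le: "blk 0 p x \<le> f x" for p
      unfolding blk_def using sum_e_le_1[of "{p + 0 * n..<p + Suc 0 * n}" x] nonneg_bdd_nonneg[OF f, of x]
      by (intro mult_right_le_one_le sum_nonneg) auto
    show "(\<Sum>p<K. blk 0 p x powr r) powr (1 / r) \<le> (2 * n) powr (1 / r) * f x"
    proof (cases "x \<in> \<Omega> 0")
      case True
      then obtain q where q: "q < K" "x \<in> E q" using ex_E by blast
      \<comment> \<open>Only the \<open>p\<close> with \<open>p \<le> q < p + n\<close> contribute;
        the window of double width is used in order to share \<open>card_window\<close>.\<close>
      have "(\<Sum>p<K. blk 0 p x powr r) powr (1 / r) \<le> real (2 * n) powr (1 / r) * f x"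
      proof (rule lr_sum_le[OF _ card_window(2) card_window(1)])
        show "blk 0 p x = 0" if "p \<notin> {p. p \<le> q \<and> q < p + 2 * n}" for p
        proof -
          have "e j x = 0" if "j \<in> {p + 0 * n..<p + Suc 0 * n}" for j
            using E_unique[OF q(2), of j] that \<open>p \<notin> _\<close> by (auto simp: e_eq_0_iff)
          then show ?thesis by (simp add: blk_def)
        qed
      qed (use r_gt_1 blk_le nonneg_bdd_nonneg[OF nonneg_bdd_blk] nonneg_bdd_nonneg[OF f] in auto)
      then show ?thesis by simp
    next
      case False
      then have "e j x = 0" for j
        using \<Omega>_antimono[of 0 j] by (auto simp: e_eq_0_iff E_def)
      then show ?thesis using nonneg_bdd_nonneg[OF f, of x] by (simp add: blk_def)
    qed
  qed auto
  then show ?thesis by simp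
qed

lemma sum_blocks: "(\<Sum>s<k. \<Sum>j\<in>{p + s * n..<p + Suc s * n}. e j y) = (\<Sum>j\<in>{p..<p + k * n}. e j y)"
proof (induction k)
  case (Suc k)
  have "(\<Sum>j\<in>{p..<p + k * n}. e j y) + (\<Sum>j\<in>{p + k * n..<p + Suc k * n}. e j y) = (\<Sum>j\<in>{p..<p + Suc k * n}. e j y)"
    by (intro sum.atLeastLessThan_concat) auto
  then show ?case using Suc by simp
qed simp

lemma principal_bound:
  "N (\<lambda>x. \<Sum>p<K. e p x * A p f x) \<le> ennreal (2 * C * (2 * n) powr (1 / r)) * N f"
proof -
  have m: "\<Gamma> s \<in> borel_measurable lebesgue" for s
    using nonneg_bdd_\<Gamma> by (auto simp: nonneg_bdd_def)
  \<comment> \<open>The blocks below \<open>p\<close> partition the depths, and on a cube of layer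
    \<open>p\<close> the functions \<open>e j\<close> with \<open>j \<ge> p\<close> sum to
    1.\<close>
  have "(\<Sum>p<K. e p x * A p f x) = (\<Sum>s<K. \<Gamma> s x)" for x
  proof (cases "x \<in> \<Omega> 0")
    case True
    then obtain p where p: "p < K" "x \<in> E p" using ex_E by blast
    then obtain Q where Q: "Q \<in> L p" "x \<in> Q" by (auto simp: E_def \<Omega>_def)
    have "A p f x = A p (\<lambda>y. \<Sum>s<K. blk s p y) x"
      unfolding A_eq[OF Q]
    proof (rule cube_avg_cong)
      fix y assume "y \<in> Q"
      then have "y \<in> \<Omega> p" using Q by (auto simp: \<Omega>_def)
      then obtain q where q: "p \<le> q" "q < K" "y \<in> E q" using ex_E by blast
      \<comment> \<open>\<open>K\<close> blocks of width \<open>n \<ge> 1\<close> reach beyond the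
        last layer, so no part of \<open>f\<close> is lost.\<close>
      have "K * 1 \<le> K * n" using n_pos by (intro mult_le_mono2) simp
      then have "q < p + K * n" using q(2) by linarith
      then have "q \<in> {p..<p + K * n}" using q by auto
      then have "1 \<le> (\<Sum>j\<in>{p..<p + K * n}. e j y)"
        using member_le_sum[of q "{p..<p + K * n}" "\<lambda>j. e j y"] e_eq_1[OF q(3)] by simp
      then have "(\<Sum>j\<in>{p..<p + K * n}. e j y) = 1"
        using sum_e_le_1[of "{p..<p + K * n}" y] by simp
      then show "f y = (\<Sum>s<K. blk s p y)"
        unfolding blk_def sum_distrib_left[symmetric] sum_blocks by simp
    qed
    also have "\<dots> = (\<Sum>s<K. A p (blk s p) x)"
      by (rule A_sum) (rule nonneg_bdd_blk)
    finally show ?thesis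
      unfolding \<Gamma>_def sum_e_eq[OF p(2)] .
  qed (simp add: \<Gamma>_def sum_e_eq_0)
  then have "N (\<lambda>x. \<Sum>p<K. e p x * A p f x) = N (\<lambda>x. \<Sum>s<K. \<Gamma> s x)" by simp
  also have "\<dots> \<le> 2 * N (\<Gamma> 0)"
    by (intro N_geometric_sum m N_\<Gamma>_Suc)
  also have "\<dots> \<le> 2 * (ennreal (C * (2 * n) powr (1 / r)) * N f)"
    by (intro mult_left_mono N_\<Gamma>_0) auto
  also have "\<dots> = ennreal (2 * C * (2 * n) powr (1 / r)) * N f"
    using C_pos by (simp add: ennreal_mult' ac_simps)
  finally show ?thesis .
qed

text \<open>The adjoint operator is treated in the same way, with gain \<open>n powr (- 1 / r)\<close>.\<close>

definition u :: "nat \<Rightarrow> 'a \<Rightarrow> real" where "u i = A i (\<lambda>y. e i y * f y)"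

definition J :: "nat \<Rightarrow> nat \<Rightarrow> nat set" where "J s p = {i. i + s * n \<le> p \<and> p < i + Suc s * n}"

definition \<Delta> :: "nat \<Rightarrow> 'a \<Rightarrow> real" where
  "\<Delta> s x = (\<Sum>p<K. e p x * (\<Sum>i\<in>J s p. u i x))"

lemma nonneg_bdd_u: "nonneg_bdd (u i)"
  unfolding u_def by (intro nonneg_bdd_A nonneg_bdd_mult nonneg_bdd_e f)

lemma nonneg_bdd_\<Delta>: "nonneg_bdd (\<Delta> s)"
  unfolding \<Delta>_def by (intro nonneg_bdd_mult nonneg_bdd_sum nonneg_bdd_e nonneg_bdd_u)

lemma finite_J: "finite (J s p)"
  by (rule finite_subset[of _ "{..p}"]) (auto simp: J_def)

text \<open>Routes now pass through layers \<open>q\<close> between \<open>i\<close> and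
  \<open>p\<close>: there \<open>u i\<close> may be replaced by twice the average of its restriction
  to \<open>E q\<close>, by \<open>A_le_A_A\<close>. For \<open>i\<close> in
  \<open>J (Suc s) p\<close> there are \<open>n\<close> layers \<open>q\<close> with
  \<open>i\<close> in \<open>J s q\<close>, and all of them satisfy
  \<open>q \<le> p < q + 2 * n\<close>.\<close>

lemma \<Delta>_step:
  assumes "x \<in> E p"
  shows "real n * \<Delta> (Suc s) x \<le> 2 * (\<Sum>q\<in>{q. q \<le> p \<and> p < q + 2 * n}. A q (\<lambda>y. e q y * \<Delta> s y) x)"
proof -
  let ?W = "{q. q \<le> p \<and> p < q + 2 * n}"
  note u0 = nonneg_bdd_nonneg[OF nonneg_bdd_u]
  have pK: "p < K" using assms E_less_K by blast
  have "real n * \<Delta> (Suc s) x = (\<Sum>i\<in>J (Suc s) p. real n * u i x)"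
    unfolding \<Delta>_def sum_e_eq[OF assms] by (simp add: sum_distrib_left)
  also have "\<dots> = (\<Sum>i\<in>J (Suc s) p. \<Sum>q\<in>{i + s * n..<i + Suc s * n}. u i x)"
    by simp
  \<comment> \<open>The range of \<open>q\<close> depends on \<open>i\<close>; recording it as the
    condition \<open>i \<in> J s q\<close> over a fixed window makes the two sums
    interchangeable.\<close>
  also have "\<dots> \<le> (\<Sum>i\<in>J (Suc s) p. \<Sum>q\<in>?W. if i \<in> J s q then u i x else 0)"
  proof (intro sum_mono)
    fix i assume i: "i \<in> J (Suc s) p"
    have "(\<Sum>q\<in>{i + s * n..<i + Suc s * n}. u i x) = (\<Sum>q\<in>{i + s * n..<i + Suc s * n}. if i \<in> J s q then u i x else 0)"
      by (intro sum.cong) (auto simp: J_def)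
    also have "\<dots> \<le> (\<Sum>q\<in>?W. if i \<in> J s q then u i x else 0)"
      using i u0 card_window(2) by (intro sum_mono2) (auto simp: J_def algebra_simps)
    finally show "(\<Sum>q\<in>{i + s * n..<i + Suc s * n}. u i x) \<le> \<dots>" .
  qed
  also have "\<dots> = (\<Sum>q\<in>?W. \<Sum>i\<in>J (Suc s) p. if i \<in> J s q then u i x else 0)"
    by (rule sum.swap)
  also have "\<dots> \<le> (\<Sum>q\<in>?W. \<Sum>i\<in>J s q. u i x)"
  proof (intro sum_mono)
    fix q
    have "(\<Sum>i\<in>J (Suc s) p. if i \<in> J s q then u i x else 0) = (\<Sum>i\<in>J (Suc s) p \<inter> J s q. u i x)"
      using finite_J by (simp add: sum.inter_restrict)
    also have "\<dots> \<le> (\<Sum>i\<in>J s q. u i x)"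
      using finite_J u0 by (intro sum_mono2) auto
    finally show "(\<Sum>i\<in>J (Suc s) p. if i \<in> J s q then u i x else 0) \<le> \<dots>" .
  qed
  also have "\<dots> \<le> (\<Sum>q\<in>?W. 2 * A q (\<lambda>y. e q y * \<Delta> s y) x)"
  proof (intro sum_mono)
    fix q assume q: "q \<in> ?W"
    have "x \<in> \<Omega> q" using assms q \<Omega>_antimono[of q p] by (auto simp: E_def)
    then have "(\<Sum>i\<in>J s q. u i x) \<le> (\<Sum>i\<in>J s q. 2 * A q (\<lambda>y. e q y * u i y) x)"
      unfolding u_def by (intro sum_mono A_le_A_A nonneg_bdd_mult nonneg_bdd_e f) (auto simp: J_def)
    also have "\<dots> = 2 * A q (\<lambda>y. \<Sum>i\<in>J s q. e q y * u i y) x"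
      by (subst A_sum) (auto intro!: nonneg_bdd_mult nonneg_bdd_e nonneg_bdd_u simp: sum_distrib_left)
    also have "(\<lambda>y. \<Sum>i\<in>J s q. e q y * u i y) = (\<lambda>y. e q y * \<Delta> s y)"
      unfolding \<Delta>_def using q pK by (subst e_mult_sum) (auto simp: sum_distrib_left)
    finally show "(\<Sum>i\<in>J s q. u i x) \<le> 2 * A q (\<lambda>y. e q y * \<Delta> s y) x" .
  qed
  finally show ?thesis by (simp add: sum_distrib_left)
qed

text \<open>At most one \<open>e q x\<close> is nonzero, so cutting \<open>g\<close> along the sets
  \<open>E q\<close> costs no constant.\<close>

lemma lr_sum_e_le: "nonneg_bdd g \<Longrightarrow> (\<Sum>q<K. (e q x * g x) powr r) powr (1 / r) \<le> g x"
proof (cases "x \<in> \<Omega> 0")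
  case True
  assume g: "nonneg_bdd g"
  from True obtain p where p: "p < K" "x \<in> E p" using ex_E by blast
  have "(\<Sum>q<K. (e q x * g x) powr r) powr (1 / r) \<le> real 1 powr (1 / r) * g x"
    by (rule lr_sum_le[where J = "{p}"])
      (use r_gt_1 p E_unique nonneg_bdd_nonneg[OF g, of x] in \<open>auto simp: e_eq_0_iff intro!: mult_left_le_one_le\<close>)
  then show ?thesis by simp
next
  case False
  assume g: "nonneg_bdd g"
  have "e j x = 0" for j
    using False \<Omega>_antimono[of 0 j] by (auto simp: e_eq_0_iff E_def)
  then show ?thesis using nonneg_bdd_nonneg[OF g, of x] by simp
qed

lemma N_\<Delta>_Suc: "N (\<Delta> (Suc s)) \<le> ennreal (1 / 2) * N (\<Delta> s)"
proof -
  have h: "nonneg_bdd (\<lambda>x. e q x * \<Delta> s x)" for q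
    by (intro nonneg_bdd_mult nonneg_bdd_e nonneg_bdd_\<Delta>)
  \<comment> \<open>Roles are exchanged compared with \<open>\<Gamma>\<close>: the inputs have
    disjoint supports, while up to \<open>2 * n\<close> averaged outputs are added at each point,
    which costs \<open>(2 * n) powr (1 - 1 / r)\<close>.\<close>
  have "N (\<Delta> (Suc s)) \<le> ennreal (C * ((2 / n) * (2 * n) powr (1 - 1 / r)) * 1) * N (\<Delta> s)"
  proof (rule norm_step[OF h nonneg_bdd_\<Delta> nonneg_bdd_\<Delta>])
    fix x
    show "\<Delta> (Suc s) x \<le> 2 / n * (2 * n) powr (1 - 1 / r) * (\<Sum>p<K. A p (\<lambda>x. e p x * \<Delta> s x) x powr r) powr (1 / r)"
    proof (cases "x \<in> \<Omega> 0")
      case True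
      then obtain p where p: "p < K" "x \<in> E p" using ex_E by blast
      have "\<Delta> (Suc s) x \<le> 2 / n * (\<Sum>q\<in>{q. q \<le> p \<and> p < q + 2 * n}. A q (\<lambda>y. e q y * \<Delta> s y) x)"
        using \<Delta>_step[OF p(2), of s] n_pos by (simp add: field_simps)
      also have "\<dots> \<le> 2 / n * (real (2 * n) powr (1 - 1 / r) * (\<Sum>p<K. A p (\<lambda>x. e p x * \<Delta> s x) x powr r) powr (1 / r))"
        using p r_gt_1 nonneg_bdd_nonneg[OF nonneg_bdd_A[OF h]] card_window(1)
        by (intro mult_left_mono sum_le_lr_sum[where a = "\<lambda>p. A p (\<lambda>x. e p x * \<Delta> s x) x"]) auto
      finally show ?thesis by (simp add: mult.assoc)
    qed (simp add: \<Delta>_def sum_e_eq_0)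
    show "(\<Sum>p<K. (e p x * \<Delta> s x) powr r) powr (1 / r) \<le> 1 * \<Delta> s x"
      using lr_sum_e_le[OF nonneg_bdd_\<Delta>] by simp
  qed (use n_pos in auto)
  also have "\<dots> \<le> ennreal (1 / 2) * N (\<Delta> s)"
    using n_large' by (intro mult_right_mono ennreal_leI) (auto simp: ac_simps)
  finally show ?thesis .
qed

lemma N_\<Delta>_0: "N (\<Delta> 0) \<le> ennreal (C * (2 * n) powr (1 - 1 / r)) * N f"
proof -
  have h: "nonneg_bdd (\<lambda>x. e q x * f x)" for q
    by (intro nonneg_bdd_mult nonneg_bdd_e f)
  have "N (\<Delta> 0) \<le> ennreal (C * (2 * n) powr (1 - 1 / r) * 1) * N f"
  proof (rule norm_step[OF h f nonneg_bdd_\<Delta>])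
    fix x
    show "\<Delta> 0 x \<le> (2 * n) powr (1 - 1 / r) * (\<Sum>p<K. A p (\<lambda>x. e p x * f x) x powr r) powr (1 / r)"
    proof (cases "x \<in> \<Omega> 0")
      case True
      then obtain p where p: "p < K" "x \<in> E p" using ex_E by blast
      have sub: "J 0 p \<subseteq> {q. q \<le> p \<and> p < q + 2 * n}" by (auto simp: J_def)
      have "\<Delta> 0 x = (\<Sum>i\<in>J 0 p. A i (\<lambda>x. e i x * f x) x)"
        unfolding \<Delta>_def sum_e_eq[OF p(2)] u_def ..
      also have "\<dots> \<le> real (2 * n) powr (1 - 1 / r) * (\<Sum>p<K. A p (\<lambda>x. e p x * f x) x powr r) powr (1 / r)"
        using p r_gt_1 nonneg_bdd_nonneg[OF nonneg_bdd_A[OF h]] sub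
          order_trans[OF card_mono[OF card_window(2) sub] card_window(1)]
        by (intro sum_le_lr_sum[where a = "\<lambda>p. A p (\<lambda>x. e p x * f x) x"]) auto
      finally show ?thesis by simp
    qed (simp add: \<Delta>_def sum_e_eq_0)
    show "(\<Sum>p<K. (e p x * f x) powr r) powr (1 / r) \<le> 1 * f x"
      using lr_sum_e_le[OF f] by simp
  qed auto
  then show ?thesis by simp
qed

lemma principal_adjoint_bound:
  "N (\<lambda>x. \<Sum>i<K. A i (\<lambda>y. e i y * f y) x) \<le> ennreal (2 * C * (2 * n) powr (1 - 1 / r)) * N f"
proof -
  note u0 = nonneg_bdd_nonneg[OF nonneg_bdd_u]
  have m: "\<Delta> s \<in> borel_measurable lebesgue" "u s \<in> borel_measurable lebesgue" for s
    using nonneg_bdd_\<Delta> nonneg_bdd_u by (auto simp: nonneg_bdd_def)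
  have "(\<Sum>i<K. u i x) \<le> (\<Sum>s<K. \<Delta> s x)" for x
  proof (cases "x \<in> \<Omega> 0")
    case True
    then obtain p where p: "p < K" "x \<in> E p" using ex_E by blast
    have "u i x = 0" if "i \<notin> {..p}" for i
      using p(2) that \<Omega>_antimono[of "Suc p" i] unfolding u_def by (intro A_eq_0) (auto simp: E_def)
    then have "(\<Sum>i<K. u i x) = (\<Sum>i\<le>p. u i x)"
      using p by (intro sum.mono_neutral_right) auto
    also have "\<dots> \<le> (\<Sum>i\<le>p. \<Sum>s<K. if i \<in> J s p then u i x else 0)"
    proof (rule sum_mono)
      fix i assume i: "i \<in> {..p}"
      \<comment> \<open>The block containing the distance from layer \<open>i\<close> to layer
        \<open>p\<close>; it is counted because \<open>?s \<le> p < K\<close>.\<close>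
      let ?s = "(p - i) div n"
      have "?s \<le> p" by (meson diff_le_self div_le_dividend order_trans)
      then have s: "?s \<in> {..<K}" using p by simp
      have "p - i < Suc ?s * n" "?s * n \<le> p - i"
        using dividend_less_div_times[OF n_pos, of "p - i"] by auto
      then have "i \<in> J ?s p" using i unfolding J_def mem_Collect_eq atMost_iff by linarith
      then have "u i x = (if i \<in> J ?s p then u i x else 0)" by simp
      also have "\<dots> \<le> (\<Sum>s<K. if i \<in> J s p then u i x else 0)"
        using s u0 by (intro member_le_sum[where f = "\<lambda>s. if i \<in> J s p then u i x else 0"]) auto
      finally show "u i x \<le> \<dots>" .
    qed
    also have "\<dots> = (\<Sum>s<K. \<Sum>i\<le>p. if i \<in> J s p then u i x else 0)"
      by (rule sum.swap)
    also have "\<dots> \<le> (\<Sum>s<K. \<Sum>i\<in>J s p. u i x)"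
    proof (rule sum_mono)
      fix s
      have "(\<Sum>i\<le>p. if i \<in> J s p then u i x else 0) = (\<Sum>i\<in>{..p} \<inter> J s p. u i x)"
        by (simp add: sum.inter_restrict)
      also have "\<dots> \<le> (\<Sum>i\<in>J s p. u i x)"
        using finite_J u0 by (intro sum_mono2) auto
      finally show "(\<Sum>i\<le>p. if i \<in> J s p then u i x else 0) \<le> \<dots>" .
    qed
    finally show ?thesis unfolding \<Delta>_def sum_e_eq[OF p(2)] .
  next
    case False
    then have "u i x = 0" for i
      unfolding u_def using \<Omega>_antimono[of 0 i] by (intro A_eq_0) auto
    then show ?thesis by (simp add: \<Delta>_def sum_e_eq_0[OF False])
  qed
  then have "N (\<lambda>x. \<Sum>i<K. u i x) \<le> N (\<lambda>x. \<Sum>s<K. \<Delta> s x)"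
    using m u0 by (intro N_mono borel_measurable_sum sum_nonneg) auto
  also have "\<dots> \<le> 2 * N (\<Delta> 0)"
    by (intro N_geometric_sum m N_\<Delta>_Suc)
  also have "\<dots> \<le> 2 * (ennreal (C * (2 * n) powr (1 - 1 / r)) * N f)"
    by (intro mult_left_mono N_\<Delta>_0) auto
  also have "\<dots> = ennreal (2 * C * (2 * n) powr (1 - 1 / r)) * N f"
    using C_pos by (simp add: ennreal_mult' ac_simps)
  finally show ?thesis unfolding u_def .
qed

end
end

section \<open>Principal cubes\<close>

locale laminar_family =
  fixes D :: "'a::euclidean_space set set" and f :: "'a \<Rightarrow> real"
  assumes finite_D: "finite D"
    and lmeasurable_D: "Q \<in> D \<Longrightarrow> Q \<in> lmeasurable"
    and measure_D_pos: "Q \<in> D \<Longrightarrow> 0 < measure lebesgue Q"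
    and laminar_D: "Q \<in> D \<Longrightarrow> R \<in> D \<Longrightarrow> Q \<subseteq> R \<or> R \<subseteq> Q \<or> Q \<inter> R = {}"
    and f: "nonneg_bdd f"
begin

text \<open>The Calderon-Zygmund stopping condition, with members of \<open>D\<close> as
  competitors. Maximality is needed twice: it makes the children disjoint, and it controls the
  averages of cubes lying between a child and \<open>Q\<close>. Doubling of the average yields the
  sparseness constant one half.\<close>

definition stopping_children :: "'a set \<Rightarrow> 'a set set" where
  "stopping_children Q = {R \<in> D. R \<subset> Q \<and> 2 * cube_avg f Q < cube_avg f R \<and>
     (\<forall>P\<in>D. R \<subseteq> P \<longrightarrow> P \<subset> Q \<longrightarrow> 2 * cube_avg f Q < cube_avg f P \<longrightarrow> P = R)}"

primrec layer :: "nat \<Rightarrow> 'a set set" where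
  "layer 0 = {Q \<in> D. \<forall>R\<in>D. Q \<subseteq> R \<longrightarrow> R = Q}"
| "layer (Suc i) = (\<Union>Q\<in>layer i. stopping_children Q)"

lemma stopping_children_D: "R \<in> stopping_children Q \<Longrightarrow> R \<in> D"
  and stopping_children_subset: "R \<in> stopping_children Q \<Longrightarrow> R \<subset> Q"
  and stopping_children_avg: "R \<in> stopping_children Q \<Longrightarrow> 2 * cube_avg f Q < cube_avg f R"
  by (auto simp: stopping_children_def)

lemma layer_D: "Q \<in> layer i \<Longrightarrow> Q \<in> D"
  by (cases i) (auto dest: stopping_children_D)

lemma D_nonempty: "Q \<in> D \<Longrightarrow> Q \<noteq> {}"
  using measure_D_pos[of Q] by auto

lemma avg_nonneg: "0 \<le> cube_avg f Q"
  by (intro cube_avg_nonneg nonneg_bdd_nonneg[OF f])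

lemma ex_stopping_child:
  assumes "P \<in> D" "P \<subset> Q" "2 * cube_avg f Q < cube_avg f P"
  shows "\<exists>R\<in>stopping_children Q. P \<subseteq> R"
proof -
  let ?S = "{R \<in> D. R \<subset> Q \<and> 2 * cube_avg f Q < cube_avg f R}"
  have "finite ?S" "P \<in> ?S" using finite_D assms by auto
  from finite_has_maximal2[OF this] obtain R where R: "R \<in> ?S" "P \<subseteq> R" "\<forall>b\<in>?S. R \<subseteq> b \<longrightarrow> R = b"
    by auto
  then show ?thesis by (intro bexI[of _ R]) (auto simp: stopping_children_def)
qed

lemma disjoint_stopping_children:
  assumes "R \<in> stopping_children Q" "R' \<in> stopping_children Q" "R \<noteq> R'"
  shows "R \<inter> R' = {}"
proof -
  have "\<not> R \<subseteq> R'" "\<not> R' \<subseteq> R"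
    using assms unfolding stopping_children_def by auto
  then show ?thesis
    using laminar_D[OF stopping_children_D[OF assms(1)] stopping_children_D[OF assms(2)]] by simp
qed

lemma disjoint_layer: "Q \<in> layer i \<Longrightarrow> R \<in> layer i \<Longrightarrow> Q \<noteq> R \<Longrightarrow> Q \<inter> R = {}"
proof (induction i arbitrary: Q R)
  case 0
  then show ?case using laminar_D[of Q R] by auto
next
  case (Suc i)
  then obtain Q' R' where *: "Q' \<in> layer i" "R' \<in> layer i" "Q \<in> stopping_children Q'" "R \<in> stopping_children R'"
    by auto
  show ?case
  proof (cases "Q' = R'")
    case True
    then show ?thesis using * Suc.prems disjoint_stopping_children by blast
  next
    case False
    then show ?thesis using Suc.IH[OF *(1,2)] * stopping_children_subset by blast
  qed
qed

text \<open>A cube of layer \<open>i\<close> sits below a strictly increasing chain of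
  \<open>i\<close> members of \<open>D\<close>; finiteness of \<open>D\<close> therefore bounds the
  number of layers.\<close>

lemma card_supersets: "Q \<in> layer i \<Longrightarrow> i \<le> card {R \<in> D. Q \<subset> R}"
proof (induction i arbitrary: Q)
  case (Suc i)
  then obtain Q' where *: "Q' \<in> layer i" "Q \<in> stopping_children Q'" by auto
  have "Suc i \<le> card (insert Q' {R \<in> D. Q' \<subset> R})"
    using Suc.IH[OF *(1)] finite_D by simp
  also have "\<dots> \<le> card {R \<in> D. Q \<subset> R}"
    using stopping_children_subset[OF *(2)] layer_D[OF *(1)] finite_D
    by (intro card_mono) auto
  finally show ?case .
qed simp

lemma layer_eventually_empty: "Suc (card D) \<le> i \<Longrightarrow> layer i = {}"
proof (rule ccontr)
  assume i: "Suc (card D) \<le> i" and "layer i \<noteq> {}"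
  then obtain Q where "Q \<in> layer i" by auto
  then have "i \<le> card {R \<in> D. Q \<subset> R}" by (rule card_supersets)
  also have "\<dots> \<le> card D" using finite_D by (intro card_mono) auto
  finally show False using i by simp
qed

text \<open>Chebyshev's argument: the children are disjoint and carry at most the mass of
  \<open>f\<close> on \<open>Q\<close>, while each has more than twice the average of
  \<open>Q\<close>.\<close>

lemma measure_stopping_children:
  assumes "Q \<in> D"
  shows "2 * measure lebesgue (\<Union>(stopping_children Q)) \<le> measure lebesgue Q"
proof -
  let ?C = "stopping_children Q" and ?a = "cube_avg f Q"
  have fin: "finite ?C" using finite_D by (auto simp: stopping_children_def)
  have Q: "Q \<in> lmeasurable" using assms by (rule lmeasurable_D)
  have sets: "R \<in> sets lebesgue" if "R \<in> ?C" for R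
    using lmeasurable_D[OF stopping_children_D[OF that]] by (simp add: fmeasurable_def)
  have int: "set_lebesgue_integral lebesgue P f = cube_avg f P * measure lebesgue P" if "P \<in> D" for P
    using measure_D_pos[OF that] by (simp add: cube_avg_def)
  have "(\<Sum>R\<in>?C. set_lebesgue_integral lebesgue R f) = (\<Sum>R\<in>?C. cube_avg (\<lambda>y. f y * indicator R y) Q * measure lebesgue Q)"
  proof (rule sum.cong)
    fix R assume "R \<in> ?C"
    then have "R \<subseteq> Q" using stopping_children_subset by blast
    then have "set_lebesgue_integral lebesgue R f = set_lebesgue_integral lebesgue Q (\<lambda>y. f y * indicator R y)"
      unfolding set_lebesgue_integral_def
      by (intro Bochner_Integration.integral_cong) (auto simp: indicator_def)
    then show "set_lebesgue_integral lebesgue R f = cube_avg (\<lambda>y. f y * indicator R y) Q * measure lebesgue Q"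
      using measure_D_pos[OF assms] by (simp add: cube_avg_def)
  qed simp
  also have "\<dots> = cube_avg (\<lambda>y. \<Sum>R\<in>?C. f y * indicator R y) Q * measure lebesgue Q"
    unfolding sum_distrib_right[symmetric]
    using sets Q by (subst cube_avg_sum) (auto intro!: nonneg_bdd_mult f nonneg_bdd_indicator)
  also have "\<dots> \<le> ?a * measure lebesgue Q"
  proof (intro mult_right_mono cube_avg_mono)
    show "(\<Sum>R\<in>?C. f y * indicator R y) \<le> f y" for y
    proof (cases "\<exists>R\<in>?C. y \<in> R")
      case True
      then obtain R where R: "R \<in> ?C" "y \<in> R" by blast
      then have "y \<notin> R'" if "R' \<in> ?C" "R' \<noteq> R" for R'
        using disjoint_stopping_children[OF R(1) that(1)] that by auto
      then have "(\<Sum>R\<in>?C. f y * indicator R y) = (\<Sum>R\<in>{R}. f y * indicator R y)"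
        using fin R by (intro sum.mono_neutral_right) auto
      then show ?thesis using R by simp
    next
      case False
      then have "(\<Sum>R\<in>?C. f y * indicator R y) = 0" by (intro sum.neutral) auto
      then show ?thesis using nonneg_bdd_nonneg[OF f] by simp
    qed
  qed (use sets Q in \<open>auto intro!: nonneg_bdd_sum nonneg_bdd_mult f nonneg_bdd_indicator\<close>)
  finally have le: "(\<Sum>R\<in>?C. set_lebesgue_integral lebesgue R f) \<le> ?a * measure lebesgue Q" .
  show ?thesis
  proof (cases "?a = 0")
    case True
    \<comment> \<open>The average of \<open>Q\<close> cannot be cancelled when it is 0; but then a
      child would carry positive mass inside a cube without mass.\<close>
    have "?C = {}"
    proof (rule ccontr)
      assume "?C \<noteq> {}"
      then obtain R where R: "R \<in> ?C" by auto
      have "0 < set_lebesgue_integral lebesgue R f"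
        using int[OF stopping_children_D[OF R]] stopping_children_avg[OF R] True
          measure_D_pos[OF stopping_children_D[OF R]] by simp
      also have "\<dots> \<le> (\<Sum>R\<in>?C. set_lebesgue_integral lebesgue R f)"
        using R fin int[OF stopping_children_D] avg_nonneg
        by (intro member_le_sum[where f = "\<lambda>R. set_lebesgue_integral lebesgue R f"]) auto
      finally show False using le True by simp
    qed
    then show ?thesis by simp
  next
    case False
    then have a: "0 < ?a" using avg_nonneg[of Q] by simp
    have "2 * ?a * measure lebesgue (\<Union>?C) \<le> 2 * ?a * (\<Sum>R\<in>?C. measure lebesgue R)"
      using a fin sets measure_UNION_le[of ?C "\<lambda>R. R" lebesgue] by (intro mult_left_mono) auto
    also have "\<dots> \<le> (\<Sum>R\<in>?C. set_lebesgue_integral lebesgue R f)"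
      unfolding sum_distrib_left
    proof (rule sum_mono)
      fix R assume R: "R \<in> ?C"
      show "2 * ?a * measure lebesgue R \<le> set_lebesgue_integral lebesgue R f"
        using int[OF stopping_children_D[OF R]] stopping_children_avg[OF R] by (auto intro!: mult_right_mono)
    qed
    also note le
    finally show ?thesis using a by simp
  qed
qed

lemma Int_Union_layer:
  assumes "Q \<in> layer i"
  shows "Q \<inter> \<Union>(layer (Suc i)) = \<Union>(stopping_children Q)"
proof
  show "\<Union>(stopping_children Q) \<subseteq> Q \<inter> \<Union>(layer (Suc i))"
    using assms stopping_children_subset by fastforce
  show "Q \<inter> \<Union>(layer (Suc i)) \<subseteq> \<Union>(stopping_children Q)"
  proof
    fix x assume "x \<in> Q \<inter> \<Union>(layer (Suc i))"
    then obtain Q' R where *: "x \<in> Q" "x \<in> R" "Q' \<in> layer i" "R \<in> stopping_children Q'" by auto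
    then have "Q' = Q"
      using disjoint_layer[OF assms, of Q'] stopping_children_subset[of R Q'] by blast
    then show "x \<in> \<Union>(stopping_children Q)" using * by auto
  qed
qed

sublocale sparse_layers layer "Suc (card D)"
proof
  show "finite (layer i)" for i
    using finite_D layer_D by (meson finite_subset subsetI)
  show "layer i = {}" if "Suc (card D) \<le> i" for i
    using that by (rule layer_eventually_empty)
  show "\<exists>R\<in>layer i. Q \<subseteq> R" if "Q \<in> layer (Suc i)" for Q i
    using that stopping_children_subset by fastforce
  show "2 * measure lebesgue (Q \<inter> \<Union>(layer (Suc i))) \<le> measure lebesgue Q" if "Q \<in> layer i" for Q i
    unfolding Int_Union_layer[OF that] by (intro measure_stopping_children layer_D[OF that])
  show "Q \<in> lmeasurable" "0 < measure lebesgue Q" if "Q \<in> layer i" for Q i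
    using layer_D[OF that] by (rule lmeasurable_D, rule measure_D_pos)
  show "Q \<inter> R = {}" if "Q \<in> layer i" "R \<in> layer i" "Q \<noteq> R" for Q R i
    using that by (rule disjoint_layer)
qed

text \<open>Compare \<open>P\<close> with the parent \<open>Q'\<close> of \<open>Q\<close>. If
  \<open>P\<close> contains \<open>Q'\<close>, the induction hypothesis and the growth of averages
  from parent to child suffice; if \<open>P\<close> lies strictly between \<open>Q\<close> and
  \<open>Q'\<close>, an average above twice that of \<open>Q'\<close> would contradict the
  maximality of \<open>Q\<close>.\<close>

lemma cube_avg_superset_le:
  assumes "Q \<in> layer i" "P \<in> D" "Q \<subseteq> P"
  shows "cube_avg f P \<le> 2 * cube_avg f Q"
  using assms
proof (induction i arbitrary: Q)
  case 0
  then show ?case using avg_nonneg[of Q] by auto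
next
  case (Suc i)
  then obtain Q' where *: "Q' \<in> layer i" "Q \<in> stopping_children Q'" by auto
  have lt: "2 * cube_avg f Q' < cube_avg f Q" using stopping_children_avg[OF *(2)] .
  have "Q \<subseteq> P \<inter> Q'" using Suc.prems stopping_children_subset[OF *(2)] by auto
  then have "P \<inter> Q' \<noteq> {}" using D_nonempty[OF stopping_children_D[OF *(2)]] by auto
  then consider "Q' \<subseteq> P" | "P \<subset> Q'"
    using laminar_D[OF Suc.prems(2) layer_D[OF *(1)]] by auto
  then show ?case
  proof cases
    case 1
    then show ?thesis using Suc.IH[OF *(1) Suc.prems(2)] lt avg_nonneg[of Q] by simp
  next
    case 2
    then have "cube_avg f P \<le> 2 * cube_avg f Q' \<or> P = Q"
      using *(2) Suc.prems unfolding stopping_children_def by force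
    then show ?thesis using lt avg_nonneg[of Q] by auto
  qed
qed

text \<open>Let \<open>Q\<close> be the last principal cube containing \<open>x\<close>. If
  \<open>P\<close> contains \<open>Q\<close>, \<open>cube_avg_superset_le\<close> applies; if
  \<open>P\<close> is strictly smaller and had more than twice the average, a stopping child
  containing \<open>P\<close> would put \<open>x\<close> into the next layer.\<close>

lemma cube_avg_le_principal:
  assumes "P \<in> D" "x \<in> P"
  shows "cube_avg f P \<le> 2 * (\<Sum>p<Suc (card D). e p x * A p f x)"
proof -
  have "\<exists>m\<in>D. P \<subseteq> m \<and> (\<forall>b\<in>D. m \<subseteq> b \<longrightarrow> m = b)"
    using finite_has_maximal2[OF finite_D assms(1)] by auto
  then have "x \<in> \<Omega> 0" using assms(2) by (auto simp: \<Omega>_def)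
  then obtain p where p: "p < Suc (card D)" "x \<in> E p" using ex_E by blast
  then obtain Q where Q: "Q \<in> layer p" "x \<in> Q" by (auto simp: E_def \<Omega>_def)
  have "cube_avg f P \<le> 2 * cube_avg f Q"
  proof (cases "Q \<subseteq> P")
    case True
    then show ?thesis using cube_avg_superset_le[OF Q(1) assms(1)] by simp
  next
    case False
    then have "P \<subset> Q" using laminar_D[OF assms(1) layer_D[OF Q(1)]] assms(2) Q(2) by blast
    show ?thesis
    proof (rule ccontr)
      assume "\<not> ?thesis"
      then obtain R where "R \<in> stopping_children Q" "P \<subseteq> R"
        using ex_stopping_child[OF assms(1) \<open>P \<subset> Q\<close>] by auto
      then have "x \<in> \<Omega> (Suc p)" using Q(1) assms(2) by (auto simp: \<Omega>_def)
      then show False using p(2) by (simp add: E_def)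
    qed
  qed
  also have "cube_avg f Q = e p x * A p f x"
    using p(2) Q by (simp add: e_eq_1 A_eq)
  also have "\<dots> \<le> (\<Sum>p<Suc (card D). e p x * A p f x)"
    using p nonneg_bdd_nonneg[OF nonneg_bdd_A[OF f]]
    by (intro member_le_sum[where f = "\<lambda>p. e p x * A p f x"]) auto
  finally show ?thesis by simp
qed

end

section \<open>Shifted dyadic grids\<close>

lemma measure_box_One:
  fixes c :: "'a::euclidean_space"
  assumes "0 \<le> s"
  shows "measure lebesgue (box c (c + s *\<^sub>R One)) = s ^ DIM('a)"
    and "measure lebesgue (cbox c (c + s *\<^sub>R One)) = s ^ DIM('a)"
  using assms by (simp_all add: measure_lborel_box_eq measure_lborel_cbox_eq algebra_simps)

text \<open>Open, so that neighbours in a grid are genuinely disjoint; with rational closure, so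
  that each box still names an index in \<open>rat_cubes\<close>.\<close>

definition open_rat_box :: "'a::euclidean_space set \<Rightarrow> bool" where
  "open_rat_box R \<longleftrightarrow> (\<exists>c s. 0 < s \<and> R = box c (c + s *\<^sub>R One) \<and> cbox c (c + s *\<^sub>R One) \<in> rat_cubes)"

lemma box_One_nonempty: "0 < s \<Longrightarrow> box c (c + s *\<^sub>R One) \<noteq> ({} :: 'a::euclidean_space set)"
  by (auto simp: box_ne_empty algebra_simps)

lemma open_rat_box_closure:
  assumes "open_rat_box R"
  shows "closure R \<in> rat_cubes" "interior (closure R) = R"
proof -
  obtain c s where R: "0 < s" "R = box c (c + s *\<^sub>R One)" "cbox c (c + s *\<^sub>R One) \<in> rat_cubes"
    using assms by (auto simp: open_rat_box_def)
  have "closure R = cbox c (c + s *\<^sub>R One)"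
    unfolding R(2) by (rule closure_box[OF box_One_nonempty[OF R(1)]])
  then show "closure R \<in> rat_cubes" "interior (closure R) = R"
    using R by (auto simp: interior_cbox)
qed

lemma lmeasurable_open_rat_box: "open_rat_box R \<Longrightarrow> R \<in> lmeasurable"
  by (auto simp: open_rat_box_def)

lemma measure_open_rat_box_pos:
  assumes "open_rat_box R" shows "0 < measure lebesgue R"
proof -
  obtain c s where R: "0 < s" "R = box c (c + s *\<^sub>R One)"
    using assms by (auto simp: open_rat_box_def)
  show ?thesis unfolding R(2) measure_box_One(1)[OF less_imp_le[OF R(1)]] using R(1) by simp
qed

lemma shifted_dyadic_interval:
  fixes a l H :: real
  assumes "0 < H" "0 \<le> l" "3 * l \<le> H / 2 ^ j"
  shows "\<exists>c m. (c = 0 \<or> c = H / 3) \<and> c + H / 2 ^ j * of_int m \<le> a \<and> a + l \<le> c + H / 2 ^ j * (of_int m + 1)"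
proof -
  define s where "s = H / 2 ^ j"
  have s: "0 < s" using assms by (simp add: s_def)
  define m where "m = \<lfloor>a / s\<rfloor>"
  have m: "s * of_int m \<le> a" "a < s * (of_int m + 1)"
    using s floor_divide_lower[of s a] floor_divide_upper[of s a] by (auto simp: m_def mult.commute)
  show ?thesis
  proof (cases "a + l \<le> s * (of_int m + 1)")
    case True
    then show ?thesis using m unfolding s_def by (intro exI[of _ 0] exI[of _ m]) auto
  next
    case False
    \<comment> \<open>Since 3 does not divide \<open>2 ^ j\<close>, the remainder \<open>v\<close>
      is 1 or 2. The shifted interval with index \<open>m - u\<close> runs from
      \<open>s * (m + v / 3)\<close> to \<open>s * (m + 1 + v / 3)\<close>, so the grid point
      \<open>s * (m + 1)\<close>, which the given interval straddles, is at least
      \<open>s / 3\<close> away from both ends.\<close>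
    define u v :: nat where "u = 2 ^ j div 3" and "v = 2 ^ j mod 3"
    have uv: "2 ^ j = 3 * u + v" "v < 3" by (auto simp: u_def v_def)
    have v: "v = 1 \<or> v = 2"
      unfolding v_def
    proof (induction j)
      case (Suc j)
      have "2 ^ Suc j mod 3 = 2 * (2 ^ j mod 3) mod (3::nat)" by (simp add: mod_mult_right_eq)
      then show ?case using Suc by auto
    qed simp
    have H: "H / 3 = s * (real u + real v / 3)"
    proof -
      have "H = s * real (2 ^ j)" by (simp add: s_def)
      also have "\<dots> = s * (3 * real u + real v)" unfolding uv by simp
      finally show ?thesis by (simp add: field_simps)
    qed
    have l: "l \<le> s / 3" using assms by (simp add: s_def)
    have "H / 3 + s * of_int (m - int u) \<le> a"
    proof -
      have "H / 3 + s * of_int (m - int u) = s * (of_int m + 1) - s * (1 - real v / 3)"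
        unfolding H by (simp add: algebra_simps)
      also have "\<dots> \<le> s * (of_int m + 1) - s / 3"
        using v s by auto
      also have "\<dots> \<le> a" using False l by simp
      finally show ?thesis .
    qed
    moreover have "a + l \<le> H / 3 + s * (of_int (m - int u) + 1)"
    proof -
      have "a + l \<le> s * (of_int m + 1) + s / 3" using m l by simp
      also have "\<dots> \<le> s * (of_int m + 1) + s * (real v / 3)" using v s by auto
      also have "\<dots> = H / 3 + s * (of_int (m - int u) + 1)"
        unfolding H by (simp add: algebra_simps)
      finally show ?thesis .
    qed
    ultimately show ?thesis unfolding s_def by (intro exI[of _ "H / 3"] exI[of _ "m - int u"]) auto
  qed
qed

text \<open>Mod the scale \<open>H / 2 ^ j\<close> the shift \<open>H / 3\<close> is congruent to one or two thirds of that scale,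
  so the finitely many grids obtained from the subsets \<open>S\<close> of the basis cover every small cube.\<close>

definition grid_corner :: "real \<Rightarrow> 'a::euclidean_space set \<Rightarrow> nat \<Rightarrow> ('a \<Rightarrow> int) \<Rightarrow> 'a" where
  "grid_corner H S j m = (\<Sum>i\<in>Basis. ((if i \<in> S then H / 3 else 0) + H / 2 ^ j * of_int (m i)) *\<^sub>R i)"

definition grid_box :: "real \<Rightarrow> 'a::euclidean_space set \<Rightarrow> nat \<Rightarrow> ('a \<Rightarrow> int) \<Rightarrow> 'a set" where
  "grid_box H S j m = box (grid_corner H S j m) (grid_corner H S j m + (H / 2 ^ j) *\<^sub>R One)"

lemma grid_corner_inner: "i \<in> Basis \<Longrightarrow> grid_corner H S j m \<bullet> i = (if i \<in> S then H / 3 else 0) + H / 2 ^ j * of_int (m i)"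
  unfolding grid_corner_def by (rule inner_sum_left_Basis)

lemma mem_grid_box:
  "x \<in> grid_box H S j m \<longleftrightarrow> (\<forall>i\<in>Basis. (if i \<in> S then H / 3 else 0) + H / 2 ^ j * of_int (m i) < x \<bullet> i \<and>
      x \<bullet> i < (if i \<in> S then H / 3 else 0) + H / 2 ^ j * (of_int (m i) + 1))"
  unfolding grid_box_def mem_box
  by (intro ball_cong refl) (simp add: grid_corner_inner inner_add_left algebra_simps add_divide_distrib)

text \<open>The shift is the same at every scale, so it cancels, and on each axis the endpoints of
  the coarse box are integer multiples of the fine scale \<open>s\<close>. Either the fine interval
  lies in the coarse one on all axes, or some axis separates the two open boxes.\<close>

lemma grid_box_subset_or_disjoint:
  assumes H: "0 < H" and "j \<le> k"
  shows "grid_box H S k m' \<subseteq> grid_box H S j m \<or> grid_box H S k m' \<inter> grid_box H S j m = {}"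
proof -
  define t :: int where "t = 2 ^ (k - j)"
  define s where "s = H / 2 ^ k"
  have s: "0 < s" using H by (simp add: s_def)
  have "(2::real) ^ k = 2 ^ j * 2 ^ (k - j)" using assms(2) by (simp flip: power_add)
  then have t: "H / 2 ^ j = s * of_int t" by (simp add: s_def t_def)
  have up: "s * of_int a + s \<le> s * of_int b" if "a < b" for a b :: int
  proof -
    have "s * (of_int a + 1) \<le> s * of_int b" using that s by (intro mult_left_mono) auto
    then show ?thesis by (simp add: algebra_simps)
  qed
  have le: "s * of_int a \<le> s * of_int b" if "a \<le> b" for a b :: int
    using that s by (intro mult_left_mono) auto
  show ?thesis
  proof (cases "\<forall>i\<in>Basis. t * m i \<le> m' i \<and> m' i < t * (m i + 1)")
    case True
    have "grid_box H S k m' \<subseteq> grid_box H S j m"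
    proof
      fix x assume x: "x \<in> grid_box H S k m'"
      show "x \<in> grid_box H S j m"
        unfolding mem_grid_box
      proof (intro ballI)
        fix i :: 'a assume i: "i \<in> Basis"
        define c where "c = (if i \<in> S then H / 3 else 0)"
        have *: "c + s * of_int (m' i) < x \<bullet> i" "x \<bullet> i < c + s * (of_int (m' i) + 1)"
          "s * of_int (t * m i) \<le> s * of_int (m' i)" "s * of_int (m' i) + s \<le> s * of_int (t * (m i + 1))"
          using x i True unfolding mem_grid_box c_def s_def[symmetric] by (blast intro: le up)+
        show "(if i \<in> S then H / 3 else 0) + H / 2 ^ j * of_int (m i) < x \<bullet> i \<and>
            x \<bullet> i < (if i \<in> S then H / 3 else 0) + H / 2 ^ j * (of_int (m i) + 1)"
        proof -
          have "s * of_int t * of_int (m i) = s * of_int (t * m i)"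
            "s * of_int t * (of_int (m i) + 1) = s * of_int (t * (m i + 1))"
            "s * (of_int (m' i) + 1) = s * of_int (m' i) + s"
            by (simp_all add: algebra_simps)
          then show ?thesis using * unfolding t c_def[symmetric] by linarith
        qed
      qed
    qed
    then show ?thesis ..
  next
    case False
    then obtain i where i: "i \<in> Basis" "m' i < t * m i \<or> t * (m i + 1) \<le> m' i" by force
    have "False" if x: "x \<in> grid_box H S k m'" "x \<in> grid_box H S j m" for x
    proof -
      define c where "c = (if i \<in> S then H / 3 else 0)"
      have "c + s * of_int (m' i) < x \<bullet> i" "x \<bullet> i < c + s * (of_int (m' i) + 1)"
        "c + s * of_int (t * m i) < x \<bullet> i" "x \<bullet> i < c + s * of_int (t * (m i + 1))"
        using x i unfolding mem_grid_box c_def s_def[symmetric] t by (auto simp: algebra_simps)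
      then show False using i(2) up[of "m' i" "t * m i"] le[of "t * (m i + 1)" "m' i"]
        by (auto simp: algebra_simps)
    qed
    then show ?thesis by auto
  qed
qed

lemma grid_box_laminar:
  assumes "0 < H"
  shows "grid_box H S j m \<subseteq> grid_box H S k m' \<or> grid_box H S k m' \<subseteq> grid_box H S j m \<or>
    grid_box H S j m \<inter> grid_box H S k m' = {}"
  using grid_box_subset_or_disjoint[OF assms, of j k S m' m]
    grid_box_subset_or_disjoint[OF assms, of k j S m m'] by (cases "j \<le> k") auto

lemma open_rat_box_grid_box:
  assumes "0 < H" "H \<in> \<rat>"
  shows "open_rat_box (grid_box H S j m)"
proof -
  have "cbox (grid_corner H S j m) (grid_corner H S j m + (H / 2 ^ j) *\<^sub>R One) \<in> rat_cubes"
    unfolding rat_cubes_def using assms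
    by (intro CollectI exI[of _ "grid_corner H S j m"] exI[of _ "H / 2 ^ j"] exI conjI refl ballI)
      (auto simp: inner_add_left grid_corner_inner)
  then show ?thesis
    unfolding open_rat_box_def grid_box_def using assms
    by (intro exI[of _ "grid_corner H S j m"] exI[of _ "H / 2 ^ j"]) auto
qed

lemma grid_cover:
  fixes a :: "'a::euclidean_space"
  assumes "0 < l" "3 * l \<le> H"
  obtains S j m where "S \<subseteq> Basis" "cbox a (a + l *\<^sub>R One) \<subseteq> closure (grid_box H S j m)"
    "measure lebesgue (grid_box H S j m) \<le> 6 ^ DIM('a) * measure lebesgue (cbox a (a + l *\<^sub>R One))"
proof -
  have H: "0 < H" using assms by simp
  \<comment> \<open>The finest scale with \<open>3 * l \<le> H / 2 ^ j\<close>. The next scale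
    fails, so the side of the covering box is below \<open>6 * l\<close>; this is the origin of the
    factor \<open>6 ^ DIM('a)\<close>.\<close>
  define j where "j = (LEAST j. H / 2 ^ Suc j < 3 * l)"
  obtain j0 where "H / (3 * l) < 2 ^ j0" using real_arch_pow[of 2 "H / (3 * l)"] by auto
  also have "2 ^ j0 < (2::real) ^ Suc j0" by simp
  finally have "H / 2 ^ Suc j0 < 3 * l" using assms by (simp add: field_simps)
  then have j1: "H / 2 ^ Suc j < 3 * l" unfolding j_def by (rule LeastI)
  have j2: "3 * l \<le> H / 2 ^ j"
  proof (cases j)
    case (Suc i)
    then have "\<not> H / 2 ^ Suc i < 3 * l"
      using not_less_Least[of i "\<lambda>j. H / 2 ^ Suc j < 3 * l"] unfolding j_def by simp
    then show ?thesis using Suc by simp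
  qed (use assms in simp)
  have "\<exists>c m. (c = 0 \<or> c = H / 3) \<and> c + H / 2 ^ j * of_int m \<le> a \<bullet> i \<and> a \<bullet> i + l \<le> c + H / 2 ^ j * (of_int m + 1)" for i
    using assms H j2 by (intro shifted_dyadic_interval) auto
  then obtain c m where cm: "\<And>i. c i = 0 \<or> c i = H / 3" "\<And>i. c i + H / 2 ^ j * of_int (m i) \<le> a \<bullet> i"
      "\<And>i. a \<bullet> i + l \<le> c i + H / 2 ^ j * (of_int (m i) + 1)"
    by metis
  \<comment> \<open>The coordinates in which the shifted grid had to be chosen;
    \<open>Pow Basis\<close> thus indexes all grids.\<close>
  define S where "S = {i \<in> Basis. c i = H / 3}"
  have c: "(if i \<in> S then H / 3 else 0) = c i" if "i \<in> Basis" for i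
    using cm(1)[of i] that by (auto simp: S_def)
  have gc: "grid_corner H S j m \<bullet> i = c i + H / 2 ^ j * of_int (m i)" if "i \<in> Basis" for i
    using grid_corner_inner[OF that] c[OF that] by simp
  show thesis
  proof
    show "S \<subseteq> Basis" by (auto simp: S_def)
    have clo: "closure (grid_box H S j m) = cbox (grid_corner H S j m) (grid_corner H S j m + (H / 2 ^ j) *\<^sub>R One)"
      unfolding grid_box_def using H by (intro closure_box box_One_nonempty) auto
    show "cbox a (a + l *\<^sub>R One) \<subseteq> closure (grid_box H S j m)"
      unfolding clo using cm(2,3)
      by (intro subset_box_imp(1)[rotated] ballI conjI)
        (auto simp: gc inner_add_left algebra_simps add_divide_distrib)
    have "measure lebesgue (grid_box H S j m) = (H / 2 ^ j) ^ DIM('a)"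
      unfolding grid_box_def using H by (intro measure_box_One) auto
    also have "\<dots> \<le> (6 * l) ^ DIM('a)"
      using H j1 by (intro power_mono) (auto simp: field_simps)
    also have "\<dots> = 6 ^ DIM('a) * measure lebesgue (cbox a (a + l *\<^sub>R One))"
      using assms by (subst measure_box_One) (auto simp: power_mult_distrib)
    finally show "measure lebesgue (grid_box H S j m) \<le> 6 ^ DIM('a) * measure lebesgue (cbox a (a + l *\<^sub>R One))" .
  qed
qed

lemma laminar_cover:
  fixes \<Q> :: "'a::euclidean_space set set"
  assumes "finite \<Q>" "\<Q> \<subseteq> rat_cubes"
  obtains D :: "'a set \<Rightarrow> 'a set set" where
    "\<And>S. finite (D S)" "\<And>S R. R \<in> D S \<Longrightarrow> open_rat_box R"
    "\<And>S Q R. Q \<in> D S \<Longrightarrow> R \<in> D S \<Longrightarrow> Q \<subseteq> R \<or> R \<subseteq> Q \<or> Q \<inter> R = {}"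
    "\<And>Q. Q \<in> \<Q> \<Longrightarrow> \<exists>S\<subseteq>Basis. \<exists>R\<in>D S. Q \<subseteq> closure R \<and> measure lebesgue R \<le> 6 ^ DIM('a) * measure lebesgue Q"
proof -
  have "\<forall>Q\<in>\<Q>. \<exists>a l. 0 < l \<and> Q = cbox a (a + l *\<^sub>R One)"
    using assms(2) unfolding rat_cubes_def by blast
  then obtain a l where al: "\<And>Q. Q \<in> \<Q> \<Longrightarrow> 0 < l Q \<and> Q = cbox (a Q) (a Q + l Q *\<^sub>R One)"
    by metis
  obtain H0 where H0: "\<And>Q. Q \<in> \<Q> \<Longrightarrow> 3 * l Q \<le> H0"
    using bdd_above_finite[OF finite_imageI[OF assms(1)], of "\<lambda>Q. 3 * l Q"]
    by (auto simp: bdd_above_def)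
  \<comment> \<open>\<open>H\<close> is at least three times every side, so that the same grids
    serve all cubes, and it is an integer, so that all corners are rational.\<close>
  define H where "H = real (Suc (nat \<lceil>H0\<rceil>))"
  have H: "0 < H" "H \<in> \<rat>" "\<And>Q. Q \<in> \<Q> \<Longrightarrow> 3 * l Q \<le> H"
  proof -
    have "H0 \<le> H" unfolding H_def by linarith
    then show "\<And>Q. Q \<in> \<Q> \<Longrightarrow> 3 * l Q \<le> H" using H0 by force
  qed (auto simp: H_def)
  have "\<forall>Q\<in>\<Q>. \<exists>S j m. S \<subseteq> Basis \<and> Q \<subseteq> closure (grid_box H S j m) \<and>
      measure lebesgue (grid_box H S j m) \<le> 6 ^ DIM('a) * measure lebesgue Q"
  proof
    fix Q assume Q: "Q \<in> \<Q>"
    show "\<exists>S j m. S \<subseteq> Basis \<and> Q \<subseteq> closure (grid_box H S j m) \<and>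
      measure lebesgue (grid_box H S j m) \<le> 6 ^ DIM('a) * measure lebesgue Q"
      using grid_cover[of "l Q" H "a Q"] al[OF Q] H(3)[OF Q] by metis
  qed
  then obtain S j m where c: "\<And>Q. Q \<in> \<Q> \<Longrightarrow> S Q \<subseteq> Basis \<and> Q \<subseteq> closure (grid_box H (S Q) (j Q) (m Q)) \<and>
      measure lebesgue (grid_box H (S Q) (j Q) (m Q)) \<le> 6 ^ DIM('a) * measure lebesgue Q"
    by metis
  define D where "D T = (\<lambda>Q. grid_box H T (j Q) (m Q)) ` {Q \<in> \<Q>. S Q = T}" for T
  show thesis
  proof
    show "finite (D T)" for T using assms(1) by (auto simp: D_def)
    show "open_rat_box R" if "R \<in> D T" for R T
      using that H open_rat_box_grid_box by (auto simp: D_def)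
    show "Q \<subseteq> R \<or> R \<subseteq> Q \<or> Q \<inter> R = {}" if "Q \<in> D T" "R \<in> D T" for Q R T
    proof -
      obtain P P' where "Q = grid_box H T (j P) (m P)" "R = grid_box H T (j P') (m P')"
        using \<open>Q \<in> D T\<close> \<open>R \<in> D T\<close> by (auto simp: D_def)
      then show ?thesis using grid_box_laminar[OF H(1)] by metis
    qed
    show "\<exists>T\<subseteq>Basis. \<exists>R\<in>D T. Q \<subseteq> closure R \<and> measure lebesgue R \<le> 6 ^ DIM('a) * measure lebesgue Q" if "Q \<in> \<Q>" for Q
      using c[OF that] that by (intro exI[of _ "S Q"]) (auto simp: D_def)
  qed
qed

section \<open>The Fatou property and the Koethe dual\<close>

lemma (in function_norm) N_indicator_pos:
  assumes "F \<in> sets lebesgue" "0 < emeasure lebesgue F"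
  shows "N (indicator F) \<noteq> 0"
proof
  assume "N (indicator F) = 0"
  then have "AE x in lebesgue. indicat_real F x = 0"
    using assms(1) by (subst (asm) N_eq_0_iff) auto
  then have "AE x in lebesgue. x \<notin> F" by eventually_elim auto
  then have "F \<in> null_sets lebesgue" using AE_iff_null_sets[OF assms(1)] by simp
  then show False using assms(2) by auto
qed

locale fatou_norm = function_norm +
  assumes fatou: "fatou_property N"
begin

lemma N_le_of_incseq:
  assumes "\<And>n. fs n \<in> borel_measurable lebesgue" "f \<in> borel_measurable lebesgue"
    and "AE x in lebesgue. (\<forall>n. 0 \<le> fs n x \<and> fs n x \<le> fs (Suc n) x) \<and> (\<lambda>n. fs n x) \<longlonglongrightarrow> f x"
    and "\<And>n. N (fs n) \<le> B"
  shows "N f \<le> B"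
proof (cases "B = \<infinity>")
  case False
  have le: "(SUP n. N (fs n)) \<le> B" using assms(4) by (intro SUP_least)
  then have "(SUP n. N (fs n)) < \<infinity>" using False by (auto simp: less_top le_less_trans)
  then have "N f = (SUP n. N (fs n))"
    using fatou assms(1-3) unfolding fatou_property_def meas_def by blast
  then show ?thesis using le by simp
qed simp

text \<open>The Fatou property speaks of increasing sequences only; the tail infima
  \<open>v n\<close> increase to the same limit and lie below \<open>fs n\<close>.\<close>

lemma N_le_of_tendsto:
  assumes fs: "\<And>n. fs n \<in> borel_measurable lebesgue" "\<And>n x. 0 \<le> fs n x" and f: "f \<in> borel_measurable lebesgue"
    and lim: "AE x in lebesgue. (\<lambda>n. fs n x) \<longlonglongrightarrow> f x"
    and N: "\<And>n. N (fs n) \<le> B"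
  shows "N f \<le> B"
proof -
  define v where "v n x = (INF k\<in>{n..}. fs k x)" for n x
  have bdd: "bdd_below ((\<lambda>k. fs k x) ` {n..})" for x n
    using fs(2) by (intro bdd_belowI[of _ 0]) auto
  have v0: "0 \<le> v n x" for n x
    unfolding v_def using fs(2) by (intro cINF_greatest) auto
  have v_le: "v n x \<le> fs k x" if "n \<le> k" for n k x
    unfolding v_def using that bdd by (intro cINF_lower) auto
  have v_meas: "v n \<in> borel_measurable lebesgue" for n
    unfolding v_def using fs(1) bdd by (intro borel_measurable_cINF) auto
  have v_mono: "v n x \<le> v (Suc n) x" for n x
    unfolding v_def using bdd by (intro cINF_superset_mono) auto
  have v_lim: "(\<lambda>n. v n x) \<longlonglongrightarrow> f x" if lx: "(\<lambda>n. fs n x) \<longlonglongrightarrow> f x" for x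
  proof (rule LIMSEQ_I)
      fix e :: real assume e: "0 < e"
      then obtain n0 where n0: "\<And>n. n \<ge> n0 \<Longrightarrow> norm (fs n x - f x) < e / 2"
        using LIMSEQ_D[OF lx, of "e / 2"] by auto
      have "norm (v n x - f x) < e" if "n \<ge> n0" for n
      proof -
        have "f x - e / 2 \<le> fs k x" if "k \<ge> n" for k
          using n0[OF order_trans[OF \<open>n \<ge> n0\<close> that]] unfolding real_norm_def by linarith
        then have "f x - e / 2 \<le> v n x" unfolding v_def by (intro cINF_greatest) auto
        moreover have "v n x \<le> f x + e / 2" using v_le[of n n x] n0[OF that] unfolding real_norm_def by linarith
        ultimately show ?thesis using e unfolding real_norm_def by linarith
      qed
      then show "\<exists>n0. \<forall>n\<ge>n0. norm (v n x - f x) < e" by blast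
  qed
  show ?thesis
  proof (rule N_le_of_incseq[OF v_meas f])
    show "AE x in lebesgue. (\<forall>n. 0 \<le> v n x \<and> v n x \<le> v (Suc n) x) \<and> (\<lambda>n. v n x) \<longlonglongrightarrow> f x"
      using lim by eventually_elim (use v0 v_mono v_lim in auto)
    show "N (v n) \<le> B" for n
      using N_mono[OF fs(1)[of n] v_meas v0 v_le[OF order_refl]] N[of n] by (rule order_trans)
  qed
qed

text \<open>Besides the norm bound it supplies finiteness almost everywhere, which both
  \<open>maximal_bounded\<close> and \<open>Xlr_norm\<close> demand separately. Finiteness comes
  from saturation, the norm bound from the Fatou property.\<close>

lemma N_SUP_le:
  assumes fs: "\<And>n. fs n \<in> borel_measurable lebesgue" "\<And>n x. 0 \<le> fs n x" "\<And>n x. fs n x \<le> fs (Suc n) x"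
    and N: "\<And>n. N (fs n) \<le> B" and B: "B < \<infinity>"
  shows "AE x in lebesgue. (SUP n. ennreal (fs n x)) < \<infinity>"
    and "N (\<lambda>x. enn2real (SUP n. ennreal (fs n x))) \<le> B"
proof -
  have mono: "incseq (\<lambda>n. ennreal (fs n x))" for x
    using fs(3) by (intro incseq_SucI ennreal_leI)
  have meas: "(\<lambda>x. SUP n. ennreal (fs n x)) \<in> borel_measurable lebesgue"
    using fs(1) by measurable
  define S where "S = {x. (SUP n. ennreal (fs n x)) = \<infinity>}"
  have S: "S \<in> sets lebesgue"
    using measurable_sets[OF meas, of "{\<infinity>}"] by (simp add: S_def vimage_def)
  have "emeasure lebesgue S = 0"
  proof (rule ccontr)
    assume "emeasure lebesgue S \<noteq> 0"
    then have "0 < emeasure lebesgue S" by (simp add: zero_less_iff_neq_zero)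
    then obtain F where F: "F \<in> sets lebesgue" "F \<subseteq> S" "0 < emeasure lebesgue F" "N (indicator F) < \<infinity>"
      using N_saturated[OF S] by blast
    \<comment> \<open>On \<open>F\<close> the sequence exceeds every \<open>k\<close>, so the
      truncations \<open>min (fs n x) k\<close> restricted to \<open>F\<close> increase to
      \<open>k\<close> times the indicator. Letting \<open>k\<close> grow contradicts
      \<open>B < \<infinity>\<close>, because the norm of the indicator is positive and
      finite.\<close>
    have le: "ennreal (real k) * N (indicator F) \<le> B" for k :: nat
    proof -
      have "N (\<lambda>x. real k * indicator F x) \<le> B"
      proof (rule N_le_of_incseq[where fs = "\<lambda>n x. min (fs n x) k * indicator F x"])
        show "AE x in lebesgue. (\<forall>n. 0 \<le> min (fs n x) k * indicator F x \<and>
          min (fs n x) k * indicator F x \<le> min (fs (Suc n) x) k * indicator F x) \<and>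
          (\<lambda>n. min (fs n x) k * indicator F x) \<longlonglongrightarrow> real k * indicator F x"
        proof (intro AE_I2 conjI allI)
          fix x n
          show "0 \<le> min (fs n x) k * indicator F x" using fs(2) by (auto simp: indicator_def)
          show "min (fs n x) k * indicator F x \<le> min (fs (Suc n) x) k * indicator F x"
            using fs(3)[of n x] by (auto simp: indicator_def)
        next
          fix x
          show "(\<lambda>n. min (fs n x) k * indicator F x) \<longlonglongrightarrow> real k * indicator F x"
          proof (cases "x \<in> F")
            case True
            then have "(SUP n. ennreal (fs n x)) = \<infinity>" using F(2) unfolding S_def by blast
            then have "ennreal k < (SUP n. ennreal (fs n x))"
              by (metis ennreal_less_top infinity_ennreal_def)
            then obtain n0 where "ennreal k < ennreal (fs n0 x)" by (auto simp: less_SUP_iff)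
            then have n0: "real k < fs n0 x" using fs(2)[of n0 x] by (simp add: ennreal_less_iff)
            have "real k \<le> fs n x" if "n \<ge> n0" for n
              using lift_Suc_mono_le[of "\<lambda>n. fs n x", OF fs(3) that] n0 by simp
            then have "eventually (\<lambda>n. min (fs n x) k * indicator F x = real k * indicator F x) sequentially"
              by (intro eventually_sequentiallyI[of n0]) (simp add: min_absorb2)
            then show ?thesis by (rule tendsto_eventually)
          qed simp
        qed
        fix n
        show "N (\<lambda>x. min (fs n x) k * indicator F x) \<le> B"
        proof -
          have "N (\<lambda>x. min (fs n x) k * indicator F x) \<le> N (fs n)"
            using fs F(1) by (intro N_mono) (auto simp: indicator_def)
          then show ?thesis using N[of n] by simp
        qed
      qed (use fs(1) F(1) in auto)
      then show ?thesis using F(1) by (subst (asm) N_cmult) auto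
    qed
    have "N (indicator F) \<noteq> 0" using N_indicator_pos[OF F(1,3)] .
    then obtain a where a: "N (indicator F) = ennreal a" "0 < a"
      using F(4) by (cases "N (indicator F)") (auto simp: zero_less_iff_neq_zero)
    obtain b where b: "B = ennreal b" "0 \<le> b" using B by (cases B) auto
    obtain k :: nat where "b / a < k" using reals_Archimedean2 by blast
    then have "b < k * a" using a by (simp add: field_simps)
    moreover have "ennreal (k * a) \<le> ennreal b" using le[of k] a b by (simp add: ennreal_mult)
    ultimately show False using b by simp
  qed
  then have "S \<in> null_sets lebesgue" using S by auto
  then have "AE x in lebesgue. x \<notin> S" by (rule AE_not_in)
  then show fin: "AE x in lebesgue. (SUP n. ennreal (fs n x)) < \<infinity>"
    unfolding S_def mem_Collect_eq infinity_ennreal_def less_top .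
  show "N (\<lambda>x. enn2real (SUP n. ennreal (fs n x))) \<le> B"
  proof (rule N_le_of_incseq[OF fs(1)])
    show "AE x in lebesgue. (\<forall>n. 0 \<le> fs n x \<and> fs n x \<le> fs (Suc n) x) \<and>
        (\<lambda>n. fs n x) \<longlonglongrightarrow> enn2real (SUP n. ennreal (fs n x))"
      using fin
    proof eventually_elim
      case (elim x)
      have "(\<lambda>n. enn2real (ennreal (fs n x))) \<longlonglongrightarrow> enn2real (SUP n. ennreal (fs n x))"
        using elim LIMSEQ_SUP[OF mono[of x]] by (intro tendsto_enn2real) auto
      then show ?case using fs by simp
    qed
  qed (use N meas in auto)
qed

end

context function_norm
begin

lemma koethe_dual_Hoelder:
  assumes h: "h \<in> borel_measurable lebesgue" and fin: "N h < \<infinity>" and g: "g \<in> borel_measurable lebesgue"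
  shows "(\<integral>\<^sup>+x. ennreal \<bar>h x * g x\<bar> \<partial>lebesgue) \<le> N h * koethe_dual N g"
proof (cases "N h = 0")
  case True
  \<comment> \<open>\<open>koethe_dual\<close> tests only functions of norm exactly 1, so a function
    of norm 0 cannot be normalized and is treated apart.\<close>
  then have "AE x in lebesgue. h x = 0" using N_eq_0_iff[OF h] by simp
  then have "(\<integral>\<^sup>+x. ennreal \<bar>h x * g x\<bar> \<partial>lebesgue) = (\<integral>\<^sup>+x. 0 \<partial>(lebesgue :: 'a measure))"
    by (intro nn_integral_cong_AE) (auto elim: eventually_mono)
  then show ?thesis by simp
next
  case False
  then obtain a where a: "N h = ennreal a" "0 < a"
    using fin by (cases "N h") (auto simp: zero_less_iff_neq_zero)
  have "N (\<lambda>x. (1 / a) * h x) = 1"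
    unfolding N_cmult[OF h] using a by (simp add: ennreal_mult[symmetric])
  then have "(\<integral>\<^sup>+x. ennreal \<bar>(1 / a) * h x * g x\<bar> \<partial>lebesgue) \<le> koethe_dual N g"
    unfolding koethe_dual_def meas_def using h by (intro SUP_upper) auto
  then have "ennreal a * (\<integral>\<^sup>+x. ennreal \<bar>(1 / a) * h x * g x\<bar> \<partial>lebesgue) \<le> N h * koethe_dual N g"
    unfolding a(1) by (rule mult_left_mono) simp
  moreover have "ennreal a * (\<integral>\<^sup>+x. ennreal \<bar>(1 / a) * h x * g x\<bar> \<partial>lebesgue) = (\<integral>\<^sup>+x. ennreal \<bar>h x * g x\<bar> \<partial>lebesgue)"
    using a h g by (subst nn_integral_cmult[symmetric]) (auto simp: ennreal_mult'[symmetric] abs_mult intro!: nn_integral_cong)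
  ultimately show ?thesis by simp
qed

end

section \<open>Bounded functions on a set of finite measure, in place of an abstract Hilbert
  space\<close>

definition bdd_on :: "'a::euclidean_space set \<Rightarrow> ('a \<Rightarrow> real) \<Rightarrow> bool" where
  "bdd_on B v \<longleftrightarrow> v \<in> borel_measurable lebesgue \<and> (\<exists>b. \<forall>x. \<bar>v x\<bar> \<le> b) \<and> (\<forall>x. x \<notin> B \<longrightarrow> v x = 0)"

lemma bdd_onI: "v \<in> borel_measurable lebesgue \<Longrightarrow> (\<And>x. \<bar>v x\<bar> \<le> b) \<Longrightarrow> (\<And>x. x \<notin> B \<Longrightarrow> v x = 0) \<Longrightarrow> bdd_on B v"
  by (auto simp: bdd_on_def)

lemma bdd_on_measurable: "bdd_on B v \<Longrightarrow> v \<in> borel_measurable lebesgue"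
  by (simp add: bdd_on_def)

lemma bdd_on_diff: "bdd_on B u \<Longrightarrow> bdd_on B v \<Longrightarrow> bdd_on B (\<lambda>x. u x - v x)"
  unfolding bdd_on_def by (auto intro!: borel_measurable_diff) (meson abs_triangle_ineq4 add_mono order_trans)

lemma bdd_on_mult:
  assumes "bdd_on B u" "bdd_on B v" shows "bdd_on B (\<lambda>x. u x * v x)"
proof -
  obtain b b' where b: "\<And>x. \<bar>u x\<bar> \<le> b" "\<And>x. \<bar>v x\<bar> \<le> b'" using assms by (auto simp: bdd_on_def)
  have "\<bar>u x * v x\<bar> \<le> b * b'" for x
    unfolding abs_mult by (intro mult_mono b) (use b[of x] in linarith)+
  then show ?thesis using assms by (intro bdd_onI[where b = "b * b'"]) (auto simp: bdd_on_def)
qed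

lemma bdd_on_cmult:
  assumes "bdd_on B u" shows "bdd_on B (\<lambda>x. c * u x)"
proof -
  obtain b where b: "\<And>x. \<bar>u x\<bar> \<le> b" using assms by (auto simp: bdd_on_def)
  have "\<bar>c * u x\<bar> \<le> \<bar>c\<bar> * b" for x
    unfolding abs_mult by (intro mult_left_mono b) auto
  then show ?thesis using assms by (intro bdd_onI[where b = "\<bar>c\<bar> * b"]) (auto simp: bdd_on_def)
qed

lemma integrable_bdd_on:
  assumes "bdd_on B v" "B \<in> lmeasurable"
  shows "integrable lebesgue v"
proof -
  obtain b where b: "\<And>x. \<bar>v x\<bar> \<le> b" using assms by (auto simp: bdd_on_def)
  show ?thesis
    by (rule integrableI_bounded_set[where A = B and B = b])
      (use assms b in \<open>auto simp: bdd_on_def fmeasurable_def\<close>)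
qed

text \<open>Weighted arithmetic-geometric mean: \<open>\<bar>u\<bar>\<close> is at most
  \<open>1 / 2 ^ n\<close> on \<open>B\<close> plus \<open>2 ^ n * u\<^sup>2\<close>. A decay of
  \<open>8 ^ n\<close> survives the weight \<open>2 ^ n\<close>, so the integrals are summable and
  almost everywhere convergence follows without passing to a subsequence.\<close>

lemma summable_of_fast_L2:
  fixes u :: "nat \<Rightarrow> 'a::euclidean_space \<Rightarrow> real"
  assumes B: "B \<in> lmeasurable" and u: "\<And>n. bdd_on B (u n)"
    and small: "\<And>n. (\<integral>x. (u n x)\<^sup>2 \<partial>lebesgue) \<le> 4 / 8 ^ n"
  shows "AE x in lebesgue. summable (\<lambda>n. \<bar>u n x\<bar>)"
proof -
  let ?b = "measure lebesgue B"
  have sq: "bdd_on B (\<lambda>x. (u n x)\<^sup>2)" for n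
    using bdd_on_mult[OF u[of n] u[of n]] by (simp add: power2_eq_square)
  have abs: "bdd_on B (\<lambda>x. \<bar>u n x\<bar>)" for n
    using u[of n] by (auto simp: bdd_on_def)
  have ind: "bdd_on B (indicator B)"
    using B by (intro bdd_onI[where b = 1]) (auto simp: indicator_def)
  have int: "(\<integral>x. \<bar>u n x\<bar> \<partial>lebesgue) \<le> (?b + 4) / 2 ^ n" for n
  proof -
    have "(\<integral>x. \<bar>u n x\<bar> \<partial>lebesgue) \<le> (\<integral>x. (1 / 2 ^ n) * indicator B x + 2 ^ n * (u n x)\<^sup>2 \<partial>lebesgue)"
    proof (rule integral_mono)
      fix x
      show "\<bar>u n x\<bar> \<le> (1 / 2 ^ n) * indicator B x + 2 ^ n * (u n x)\<^sup>2"
      proof (cases "x \<in> B")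
        case True
        \<comment> \<open>The weighted inequality comes from this square after division by
          \<open>2 ^ n\<close>.\<close>
        have "0 \<le> (2 ^ n * \<bar>u n x\<bar> - 1)\<^sup>2" by simp
        then have "2 * (2 ^ n * \<bar>u n x\<bar>) \<le> 1 + (2 ^ n)\<^sup>2 * (u n x)\<^sup>2"
          by (simp add: power2_eq_square algebra_simps)
        moreover have "0 \<le> 2 ^ n * \<bar>u n x\<bar>" by simp
        ultimately have "2 ^ n * \<bar>u n x\<bar> \<le> 1 + (2 ^ n)\<^sup>2 * (u n x)\<^sup>2" by linarith
        then have "2 ^ n * \<bar>u n x\<bar> / 2 ^ n \<le> (1 + (2 ^ n)\<^sup>2 * (u n x)\<^sup>2) / 2 ^ n"
          by (rule divide_right_mono) simp
        then show ?thesis using True by (simp add: add_divide_distrib power2_eq_square)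
      next
        case False
        then show ?thesis using u[of n] by (auto simp: bdd_on_def)
      qed
    qed (use integrable_bdd_on[OF abs B] integrable_bdd_on[OF sq B] integrable_bdd_on[OF ind B] in auto)
    also have "\<dots> = (1 / 2 ^ n) * ?b + 2 ^ n * (\<integral>x. (u n x)\<^sup>2 \<partial>lebesgue)"
      using integrable_bdd_on[OF sq B] integrable_bdd_on[OF ind B] B by (subst Bochner_Integration.integral_add) auto
    also have "\<dots> \<le> (1 / 2 ^ n) * ?b + 2 ^ n * (4 / 8 ^ n)"
      by (intro add_left_mono mult_left_mono small) auto
    also have "2 ^ n * (4 / 8 ^ n) = 4 / (4::real) ^ n"
    proof -
      have "(8::real) ^ n = 2 ^ n * 4 ^ n" by (simp flip: power_mult_distrib)
      then show ?thesis by simp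
    qed
    also have "\<dots> \<le> 4 / 2 ^ n" by (intro divide_left_mono power_mono) auto
    finally show ?thesis by (simp add: add_divide_distrib)
  qed
  have "(\<integral>\<^sup>+x. (\<Sum>n. ennreal \<bar>u n x\<bar>) \<partial>lebesgue) = (\<Sum>n. \<integral>\<^sup>+x. ennreal \<bar>u n x\<bar> \<partial>lebesgue)"
    using bdd_on_measurable[OF u] by (intro nn_integral_suminf) auto
  also have "\<dots> = (\<Sum>n. ennreal (\<integral>x. \<bar>u n x\<bar> \<partial>lebesgue))"
    using integrable_bdd_on[OF abs B] by (subst nn_integral_eq_integral) auto
  also have "\<dots> \<le> (\<Sum>n. ennreal ((?b + 4) / 2 ^ n))"
    by (intro suminf_le ennreal_leI int) auto
  also have "\<dots> = ennreal (\<Sum>n. (?b + 4) / 2 ^ n)"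
    using summable_mult[OF summable_geometric[of "1/2::real"], of "?b + 4"]
    by (intro suminf_ennreal2) (auto simp: power_one_over)
  also have "\<dots> < \<infinity>" by simp
  finally have "AE x in lebesgue. (\<Sum>n. ennreal \<bar>u n x\<bar>) \<noteq> \<infinity>"
    using bdd_on_measurable[OF u] by (intro nn_integral_PInf_AE) auto
  then show ?thesis
    by eventually_elim (auto intro!: summable_suminf_not_top)
qed

lemma convergent_of_summable_diff:
  fixes u :: "nat \<Rightarrow> real"
  assumes "summable (\<lambda>n. \<bar>u (Suc n) - u n\<bar>)"
  shows "convergent u"
proof -
  have "summable (\<lambda>n. u (Suc n) - u n)" using assms by (rule summable_rabs_cancel)
  then have "convergent (\<lambda>n. \<Sum>i<n. u (Suc i) - u i)" by (simp add: summable_iff_convergent)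
  then have "convergent (\<lambda>n. u n - u 0)" by (simp add: sum_lessThan_telescope)
  then show ?thesis by (subst (asm) convergent_diff_const_right_iff)
qed

section \<open>The L2-nearest point of the unit ball and norming functionals\<close>

context fatou_norm
begin

context
  fixes h :: "'a \<Rightarrow> real" and B :: "'a set"
  assumes h: "bdd_on B h" "\<And>x. 0 \<le> h x" and B: "B \<in> lmeasurable"
begin

definition below :: "('a \<Rightarrow> real) set" where
  "below = {u. u \<in> borel_measurable lebesgue \<and> (\<forall>x. 0 \<le> u x \<and> u x \<le> h x) \<and> N u \<le> 1}"

definition dist2 :: "('a \<Rightarrow> real) \<Rightarrow> real" where
  "dist2 u = (\<integral>x. (h x - u x)\<^sup>2 \<partial>lebesgue)"

lemma bdd_on_below:
  assumes "u \<in> borel_measurable lebesgue" "\<And>x. 0 \<le> u x" "\<And>x. u x \<le> h x"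
  shows "bdd_on B u"
proof -
  obtain b where b: "\<And>x. \<bar>h x\<bar> \<le> b" using h(1) by (auto simp: bdd_on_def)
  show ?thesis
  proof (rule bdd_onI[OF assms(1)])
    show "\<bar>u x\<bar> \<le> b" for x using assms(2,3)[of x] b[of x] by linarith
    show "u x = 0" if "x \<notin> B" for x
      using assms(2,3)[of x] h(1) that by (auto simp: bdd_on_def order.antisym)
  qed
qed

lemma integrable_sq_diff:
  "bdd_on B u \<Longrightarrow> bdd_on B v \<Longrightarrow> integrable lebesgue (\<lambda>x. (u x - v x)\<^sup>2)"
  unfolding power2_eq_square by (intro integrable_bdd_on[OF _ B] bdd_on_mult bdd_on_diff)

lemma dist2_nonneg: "0 \<le> dist2 u"
  unfolding dist2_def by (intro Bochner_Integration.integral_nonneg) auto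

lemma below_midpoint:
  assumes "u \<in> below" "v \<in> below"
  shows "(\<lambda>x. (u x + v x) / 2) \<in> below"
proof -
  have m: "u \<in> borel_measurable lebesgue" "v \<in> borel_measurable lebesgue"
    using assms by (auto simp: below_def)
  have "N (\<lambda>x. (u x + v x) / 2) = N (\<lambda>x. (1/2) * u x + (1/2) * v x)"
    by (intro arg_cong[where f = N]) (auto simp: field_simps)
  also have "\<dots> \<le> N (\<lambda>x. (1/2) * u x) + N (\<lambda>x. (1/2) * v x)"
    using m by (intro N_add) auto
  also have "\<dots> = ennreal (1/2) * N u + ennreal (1/2) * N v"
    unfolding N_cmult[OF m(1)] N_cmult[OF m(2)] by simp
  also have "\<dots> \<le> ennreal (1/2) * 1 + ennreal (1/2) * 1"
    using assms by (intro add_mono mult_left_mono) (auto simp: below_def)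
  also have "\<dots> = ennreal (1/2 + 1/2)" by (subst ennreal_plus) auto
  also have "\<dots> = 1" by simp
  finally have "N (\<lambda>x. (u x + v x) / 2) \<le> 1" .
  moreover have "0 \<le> (u x + v x) / 2 \<and> (u x + v x) / 2 \<le> h x" for x
  proof -
    have "0 \<le> u x" "u x \<le> h x" "0 \<le> v x" "v x \<le> h x" using assms by (auto simp: below_def)
    then show ?thesis by simp
  qed
  ultimately show ?thesis using m by (auto simp: below_def)
qed

text \<open>Hilbert space projection made explicit: a minimizing sequence is Cauchy by the
  parallelogram law, converges almost everywhere by \<open>summable_of_fast_L2\<close>, stays in the
  unit ball by the Fatou property, and its distances converge by dominated convergence.\<close>

lemma ex_projection: "\<exists>u\<in>below. \<forall>v\<in>below. dist2 u \<le> dist2 v"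
proof -
  have "(\<lambda>x. 0) \<in> below" using h by (auto simp: below_def N_zero)
  then have ne: "dist2 ` below \<noteq> {}" by auto
  have bdd: "bdd_below (dist2 ` below)" using dist2_nonneg by (intro bdd_belowI[of _ 0]) auto
  define d where "d = Inf (dist2 ` below)"
  have d: "d \<le> dist2 v" if "v \<in> below" for v
    unfolding d_def using that bdd by (intro cInf_lower) auto
  have "\<exists>u\<in>below. dist2 u < d + 1 / 8 ^ n" for n :: nat
    using cInf_lessD[OF ne, of "d + 1 / 8 ^ n"] by (auto simp: d_def)
  then obtain u where u: "\<And>n. u n \<in> below" "\<And>n. dist2 (u n) < d + 1 / 8 ^ n" by metis
  have um: "u n \<in> borel_measurable lebesgue" "0 \<le> u n x" "u n x \<le> h x" "N (u n) \<le> 1" for n x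
    using u(1)[of n] by (auto simp: below_def)
  have ub: "bdd_on B (u n)" for n by (intro bdd_on_below um)
  have small: "(\<integral>x. (u (Suc n) x - u n x)\<^sup>2 \<partial>lebesgue) \<le> 4 / 8 ^ n" for n
  proof -
    let ?m = "\<lambda>x. (u (Suc n) x + u n x) / 2"
    have mb: "bdd_on B ?m" using below_midpoint[OF u(1) u(1), of "Suc n" n] by (intro bdd_on_below) (auto simp: below_def)
    \<comment> \<open>Parallelogram law; the midpoint again belongs to \<open>below\<close>, so its
      distance is at least \<open>d\<close>, and \<open>d\<close> cancels.\<close>
    have "(u (Suc n) x - u n x)\<^sup>2 = 2 * (h x - u (Suc n) x)\<^sup>2 + 2 * (h x - u n x)\<^sup>2 - 4 * (h x - ?m x)\<^sup>2" for x
      by (simp add: power2_eq_square field_simps)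
    then have "(\<integral>x. (u (Suc n) x - u n x)\<^sup>2 \<partial>lebesgue)
        = (\<integral>x. 2 * (h x - u (Suc n) x)\<^sup>2 + 2 * (h x - u n x)\<^sup>2 - 4 * (h x - ?m x)\<^sup>2 \<partial>lebesgue)" by simp
    also have "\<dots> = 2 * dist2 (u (Suc n)) + 2 * dist2 (u n) - 4 * dist2 ?m"
      unfolding dist2_def using integrable_sq_diff[OF h(1) ub] integrable_sq_diff[OF h(1) mb]
      by (subst Bochner_Integration.integral_diff) (auto intro!: Bochner_Integration.integral_add)
    also have "\<dots> \<le> 2 * (1 / 8 ^ Suc n) + 2 * (1 / 8 ^ n)"
      using u(2)[of n] u(2)[of "Suc n"] d[OF below_midpoint[OF u(1) u(1)], of "Suc n" n] by argo
    also have "\<dots> \<le> 4 / 8 ^ n" by (simp add: field_simps)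
    finally show ?thesis .
  qed
  have conv: "AE x in lebesgue. convergent (\<lambda>n. u n x)"
    using summable_of_fast_L2[OF B bdd_on_diff[OF ub ub] small]
    by eventually_elim (rule convergent_of_summable_diff)
  \<comment> \<open>Clamping to the interval from 0 to \<open>h x\<close> gives a legal member of
    \<open>below\<close> also at points where the sequence diverges and \<open>lim\<close> is
    meaningless.\<close>
  define w where "w x = max 0 (min (h x) (lim (\<lambda>n. u n x)))" for x
  have hm: "h \<in> borel_measurable lebesgue" using h(1) by (rule bdd_on_measurable)
  have wm: "w \<in> borel_measurable lebesgue"
    unfolding w_def using um(1) hm by (intro borel_measurable_max borel_measurable_min borel_measurable_lim_metric) auto
  have w: "0 \<le> w x" "w x \<le> h x" for x using h(2)[of x] by (auto simp: w_def)
  have lim: "AE x in lebesgue. (\<lambda>n. u n x) \<longlonglongrightarrow> w x"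
    using conv
  proof eventually_elim
    case (elim x)
    then have l: "(\<lambda>n. u n x) \<longlonglongrightarrow> lim (\<lambda>n. u n x)" by (simp add: convergent_LIMSEQ_iff)
    have "0 \<le> lim (\<lambda>n. u n x)" "lim (\<lambda>n. u n x) \<le> h x"
      using um by (auto intro!: LIMSEQ_le_const[OF l] LIMSEQ_le_const2[OF l])
    then have "w x = lim (\<lambda>n. u n x)" by (simp add: w_def)
    then show ?case using l by simp
  qed
  have "N w \<le> 1" by (rule N_le_of_tendsto[OF um(1,2) wm lim um(4)])
  then have wb: "w \<in> below" using wm w by (auto simp: below_def)
  have hh: "integrable lebesgue (\<lambda>x. h x * h x)" by (intro integrable_bdd_on[OF _ B] bdd_on_mult h)
  have "(\<lambda>n. dist2 (u n)) \<longlonglongrightarrow> dist2 w"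
    unfolding dist2_def
  proof (rule integral_dominated_convergence[where w = "\<lambda>x. h x * h x"])
    show "AE x in lebesgue. (\<lambda>n. (h x - u n x)\<^sup>2) \<longlonglongrightarrow> (h x - w x)\<^sup>2"
      using lim by eventually_elim (auto intro!: tendsto_intros)
    show "AE x in lebesgue. norm ((h x - u n x)\<^sup>2) \<le> h x * h x" for n
    proof (rule AE_I2)
      fix x
      have "0 \<le> h x - u n x" "h x - u n x \<le> h x" using um(2,3)[of n x] by auto
      then show "norm ((h x - u n x)\<^sup>2) \<le> h x * h x"
        by (auto simp: power2_eq_square intro!: mult_mono)
    qed
  qed (use hm um(1) wm hh in auto)
  moreover have "(\<lambda>n. d + 1 / 8 ^ n) \<longlonglongrightarrow> d + 0"
    by (intro tendsto_intros LIMSEQ_divide_realpow_zero) auto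
  ultimately have "dist2 w \<le> d + 0"
    using u(2) by (intro LIMSEQ_le) (auto intro: less_imp_le)
  then show ?thesis using wb d by (intro bexI[of _ w] ballI) (auto intro: order_trans)
qed

text \<open>First-order condition at the nearest point, obtained by moving from \<open>u\<close>
  towards \<open>f\<close> and letting the step \<open>t\<close> tend to 0. The competitor
  \<open>f\<close> is not assumed to lie below \<open>h\<close>.\<close>

lemma projection_variational:
  assumes u: "u \<in> below" "\<And>v. v \<in> below \<Longrightarrow> dist2 u \<le> dist2 v"
    and f: "bdd_on B f" "\<And>x. 0 \<le> f x" "N f \<le> 1"
  shows "(\<integral>x. (h x - u x) * f x \<partial>lebesgue) \<le> (\<integral>x. (h x - u x) * u x \<partial>lebesgue)"
proof -
  have um: "u \<in> borel_measurable lebesgue" "\<And>x. 0 \<le> u x" "\<And>x. u x \<le> h x" "N u \<le> 1"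
    using u(1) by (auto simp: below_def)
  have fm: "f \<in> borel_measurable lebesgue" and hm: "h \<in> borel_measurable lebesgue"
    using f(1) h(1) by (auto simp: bdd_on_def)
  have ub: "bdd_on B u" by (intro bdd_on_below um)
  let ?g = "\<lambda>x. h x - u x" and ?k = "\<lambda>x. f x - u x"
  have gb: "bdd_on B ?g" and kb: "bdd_on B ?k" using h ub f by (auto intro: bdd_on_diff)
  define a where "a = (\<integral>x. ?g x * ?k x \<partial>lebesgue)"
  define b where "b = (\<integral>x. ?k x * ?k x \<partial>lebesgue)"
  have step: "2 * a \<le> t * b" if t: "0 < t" "t \<le> 1" for t
  proof -
    \<comment> \<open>Points of the segment may exceed \<open>h\<close>; cutting them off at
      \<open>h\<close> returns to \<open>below\<close> and cannot increase the distance to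
      \<open>h\<close>.\<close>
    define w where "w x = min (h x) ((1 - t) * u x + t * f x)" for x
    have wm: "w \<in> borel_measurable lebesgue" unfolding w_def using hm um fm by auto
    have w0: "0 \<le> w x" "w x \<le> h x" for x
      using h(2)[of x] um(2)[of x] f(2)[of x] t by (auto simp: w_def)
    have "N w \<le> N (\<lambda>x. (1 - t) * u x + t * f x)"
      using um fm wm w0 by (intro N_mono) (auto simp: w_def)
    also have "\<dots> \<le> N (\<lambda>x. (1 - t) * u x) + N (\<lambda>x. t * f x)"
      using um fm by (intro N_add) auto
    also have "\<dots> = ennreal (1 - t) * N u + ennreal t * N f"
      unfolding N_cmult[OF um(1)] N_cmult[OF fm] using t by simp
    also have "\<dots> \<le> ennreal (1 - t) * 1 + ennreal t * 1"
      using um f by (intro add_mono mult_left_mono) auto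
    also have "\<dots> = ennreal ((1 - t) + t)" using t by (subst ennreal_plus) auto
    finally have "w \<in> below" using wm w0 by (auto simp: below_def)
    then have "dist2 u \<le> dist2 w" by (rule u(2))
    also have "dist2 w \<le> (\<integral>x. (?g x - t * ?k x)\<^sup>2 \<partial>lebesgue)"
      unfolding dist2_def
    proof (rule Bochner_Integration.integral_mono)
      show "integrable lebesgue (\<lambda>x. (h x - w x)\<^sup>2)"
        using wm w0 by (intro integrable_sq_diff bdd_on_below h) auto
      show "integrable lebesgue (\<lambda>x. (?g x - t * ?k x)\<^sup>2)"
        by (intro integrable_sq_diff gb bdd_on_cmult kb)
      fix x
      have eq: "?g x - t * ?k x = h x - ((1 - t) * u x + t * f x)" by (simp add: algebra_simps)
      show "(h x - w x)\<^sup>2 \<le> (?g x - t * ?k x)\<^sup>2"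
        unfolding eq w_def by (intro power2_le_iff_abs_le[THEN iffD2] abs_le_square_iff[THEN iffD1]) (auto simp: min_def)
    qed
    also have "\<dots> = (\<integral>x. ((?g x)\<^sup>2 - 2 * t * (?g x * ?k x)) + t\<^sup>2 * (?k x * ?k x) \<partial>lebesgue)"
      by (intro Bochner_Integration.integral_cong) (auto simp: power2_eq_square algebra_simps)
    also have "\<dots> = dist2 u - 2 * t * a + t\<^sup>2 * b"
      unfolding dist2_def a_def b_def
      using integrable_bdd_on[OF bdd_on_mult[OF gb gb] B] integrable_bdd_on[OF bdd_on_mult[OF gb kb] B]
        integrable_bdd_on[OF bdd_on_mult[OF kb kb] B]
      by (simp add: power2_eq_square)
    finally have "t * (2 * a) \<le> t * (t * b)" by (simp add: power2_eq_square algebra_simps)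
    then show ?thesis using t by simp
  qed
  have "2 * a \<le> 0"
  proof (rule LIMSEQ_le_const)
    show "(\<lambda>n. inverse (real (Suc n)) * b) \<longlonglongrightarrow> 0"
      using tendsto_mult[OF LIMSEQ_inverse_real_of_nat tendsto_const[of b]] by simp
    show "\<exists>n0. \<forall>n\<ge>n0. 2 * a \<le> inverse (real (Suc n)) * b"
      using step[of "inverse (real (Suc n))" for n] by (intro exI[of _ 0] allI impI) (simp add: field_simps)
  qed
  then have "a \<le> 0" by simp
  also have "a = (\<integral>x. ?g x * f x - ?g x * u x \<partial>lebesgue)"
    unfolding a_def by (simp add: right_diff_distrib)
  also have "\<dots> = (\<integral>x. ?g x * f x \<partial>lebesgue) - (\<integral>x. ?g x * u x \<partial>lebesgue)"
    by (intro Bochner_Integration.integral_diff integrable_bdd_on[OF _ B] bdd_on_mult gb f ub)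
  finally show ?thesis by simp
qed

text \<open>With \<open>g = h - u\<close> and \<open>c\<close> the integral of \<open>g * u\<close>,
  the variational inequality bounds the integral of \<open>g / c\<close> against the unit ball by 1,
  whereas against \<open>h\<close> it gives 1 plus the integral of \<open>g\<^sup>2\<close> divided
  by \<open>c\<close>.\<close>

lemma koethe_norming_bdd:
  assumes "1 < N h"
  shows "\<exists>g. g \<in> borel_measurable lebesgue \<and> (\<forall>x. 0 \<le> g x) \<and> koethe_dual N g \<le> 1 \<and>
    1 < (\<integral>\<^sup>+x. ennreal (h x * g x) \<partial>lebesgue)"
proof -
  obtain u where u: "u \<in> below" "\<And>v. v \<in> below \<Longrightarrow> dist2 u \<le> dist2 v" using ex_projection by blast
  have um: "u \<in> borel_measurable lebesgue" "\<And>x. 0 \<le> u x" "\<And>x. u x \<le> h x" "N u \<le> 1"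
    using u(1) by (auto simp: below_def)
  have hm: "h \<in> borel_measurable lebesgue" using h(1) by (rule bdd_on_measurable)
  have ub: "bdd_on B u" by (intro bdd_on_below um)
  define g where "g x = h x - u x" for x
  have gb: "bdd_on B g" unfolding g_def by (intro bdd_on_diff h ub)
  have gm: "g \<in> borel_measurable lebesgue" using gb by (rule bdd_on_measurable)
  have g0: "0 \<le> g x" for x using um(3)[of x] by (simp add: g_def)
  define c where "c = (\<integral>x. g x * u x \<partial>lebesgue)"
  have le_c: "(\<integral>x. g x * f x \<partial>lebesgue) \<le> c" if "bdd_on B f" "\<And>x. 0 \<le> f x" "N f \<le> 1" for f
    using projection_variational[OF u that] by (simp add: g_def c_def)
  have nn: "(\<integral>\<^sup>+x. ennreal (g x * f x) \<partial>lebesgue) = ennreal (\<integral>x. g x * f x \<partial>lebesgue)"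
    if "bdd_on B f" "\<And>x. 0 \<le> f x" for f
    using that g0 by (intro nn_integral_eq_integral integrable_bdd_on[OF _ B] bdd_on_mult gb) auto
  let ?S = "{x. 0 < g x}"
  have S: "?S \<in> sets lebesgue"
    using measurable_sets[OF gm, of "{0<..}"] by (simp add: vimage_def)
  have "emeasure lebesgue ?S \<noteq> 0"
  proof
    assume "emeasure lebesgue ?S = 0"
    then have "?S \<in> null_sets lebesgue" using S by auto
    from AE_not_in[OF this] have "AE x in lebesgue. \<bar>h x\<bar> \<le> \<bar>u x\<bar>"
    proof eventually_elim
      case (elim x)
      then show ?case using g0[of x] um(2)[of x] by (auto simp: g_def)
    qed
    then have "N h \<le> N u" using um hm by (intro N_mono_AE) auto
    then show False using assms um(4) by auto
  qed
  then have Spos: "0 < emeasure lebesgue ?S" by (simp add: zero_less_iff_neq_zero)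
  then obtain F where F: "F \<in> sets lebesgue" "F \<subseteq> ?S" "0 < emeasure lebesgue F" "N (indicator F) < \<infinity>"
    using N_saturated[OF S] by blast
  obtain a where a: "N (indicator F) = ennreal a" "0 < a"
    using F(4) N_indicator_pos[OF F(1,3)] by (cases "N (indicator F)") (auto simp: zero_less_iff_neq_zero)
  have pos: "0 < (\<integral>x. g x * f x \<partial>lebesgue)"
    if f: "bdd_on B f" "\<And>x. 0 \<le> f x" and T: "T \<in> sets lebesgue" "0 < emeasure lebesgue T" "\<And>x. x \<in> T \<Longrightarrow> 0 < g x * f x" for f T
  proof (rule ccontr)
    assume "\<not> 0 < (\<integral>x. g x * f x \<partial>lebesgue)"
    then have "(\<integral>\<^sup>+x. ennreal (g x * f x) \<partial>lebesgue) = 0"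
      unfolding nn[OF f] by (simp add: ennreal_neg)
    then have "AE x in lebesgue. ennreal (g x * f x) = 0"
      using gm bdd_on_measurable[OF f(1)] by (subst (asm) nn_integral_0_iff_AE) auto
    then have "AE x in lebesgue. x \<notin> T"
    proof eventually_elim
      case (elim x)
      then show ?case using T(3)[of x] by (auto simp: ennreal_eq_0_iff)
    qed
    then have "T \<in> null_sets lebesgue" using AE_iff_null_sets[OF T(1)] by simp
    then show False using T(2) by auto
  qed
  \<comment> \<open>Saturation yields a set \<open>F\<close> of finite norm on which
    \<open>g > 0\<close>; its normalized indicator is an admissible competitor with positive
    pairing, and that pairing is at most \<open>c\<close>.\<close>
  have c: "0 < c"
  proof -
    let ?f = "\<lambda>x. (1 / a) * indicator F x"
    have fb: "bdd_on B ?f"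
    proof (intro bdd_on_cmult bdd_onI[where b = 1])
      show "indicator F x = (0::real)" if "x \<notin> B" for x
        using F(2) gb that by (auto simp: bdd_on_def indicator_def)
    qed (use F(1) in auto)
    have "N ?f \<le> 1" using F(1) a by (subst N_cmult) (auto simp: ennreal_mult[symmetric])
    then have "(\<integral>x. g x * ?f x \<partial>lebesgue) \<le> c" using a fb by (intro le_c) auto
    moreover have "0 < (\<integral>x. g x * ?f x \<partial>lebesgue)"
      using a F by (intro pos[OF fb _ F(1,3)]) auto
    ultimately show ?thesis by linarith
  qed
  have gg: "0 < (\<integral>x. g x * g x \<partial>lebesgue)"
    using g0 by (intro pos[OF gb _ S Spos]) auto
  show ?thesis
  proof (intro exI[of _ "\<lambda>x. g x / c"] conjI allI)
    show "(\<lambda>x. g x / c) \<in> borel_measurable lebesgue" using gm by auto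
    show "0 \<le> g x / c" for x using g0 c by simp
    show "koethe_dual N (\<lambda>x. g x / c) \<le> 1"
      unfolding koethe_dual_def meas_def
    proof (intro SUP_least)
      fix f assume "f \<in> {f. f \<in> borel_measurable lebesgue \<and> N f = 1}"
      then have f: "f \<in> borel_measurable lebesgue" "N f = 1" by auto
      \<comment> \<open>The variational inequality concerns bounded functions supported in
        \<open>B\<close>. As \<open>g\<close> vanishes outside \<open>B\<close>, cutting
        \<open>f\<close> off there loses nothing, and monotone convergence removes the bound
        \<open>n\<close>.\<close>
      define fs where "fs n x = min \<bar>f x\<bar> (real n) * indicator B x" for n x
      have Bs: "B \<in> sets lebesgue" using B by auto
      have fsm: "fs n \<in> borel_measurable lebesgue" for n unfolding fs_def using f(1) Bs by measurable
      have fsb: "bdd_on B (fs n)" for n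
        by (rule bdd_onI[OF fsm, where b = n]) (auto simp: fs_def indicator_def)
      have fs0: "0 \<le> fs n x" for n x by (auto simp: fs_def)
      have "N (fs n) \<le> N f" for n
        using f(1) fsm by (intro N_mono_AE) (auto simp: fs_def indicator_def)
      then have fsN: "N (fs n) \<le> 1" for n using f(2) by simp
      have eq: "ennreal \<bar>f x * (g x / c)\<bar> = (SUP n. ennreal (1 / c) * ennreal (g x * fs n x))" for x
      proof -
        obtain n0 :: nat where n0: "\<bar>f x\<bar> \<le> n0" using real_arch_simple by blast
        have eq: "ennreal (1 / c) * ennreal (g x * fs n x) = ennreal (g x * fs n x / c)" for n
          using c g0[of x] fs0[of n x] by (simp add: ennreal_mult[symmetric])
        show ?thesis
          unfolding eq
        proof (rule antisym)
          have "g x * fs n0 x = g x * \<bar>f x\<bar>"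
            using n0 gb by (cases "x \<in> B") (auto simp: fs_def bdd_on_def)
          then have "ennreal \<bar>f x * (g x / c)\<bar> = ennreal (g x * fs n0 x / c)"
            using c g0[of x] by (auto simp: abs_mult ac_simps)
          also have "\<dots> \<le> (SUP n. ennreal (g x * fs n x / c))" by (intro SUP_upper) auto
          finally show "ennreal \<bar>f x * (g x / c)\<bar> \<le> \<dots>" .
          show "(SUP n. ennreal (g x * fs n x / c)) \<le> ennreal \<bar>f x * (g x / c)\<bar>"
          proof (intro SUP_least ennreal_leI)
            fix n
            have "g x * fs n x / c \<le> g x * \<bar>f x\<bar> / c"
              using c g0[of x] by (intro divide_right_mono mult_left_mono) (auto simp: fs_def indicator_def)
            then show "g x * fs n x / c \<le> \<bar>f x * (g x / c)\<bar>"
              using c g0[of x] by (simp add: abs_mult ac_simps)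
          qed
        qed
      qed
      have "(\<integral>\<^sup>+x. ennreal \<bar>f x * (g x / c)\<bar> \<partial>lebesgue) = (SUP n. \<integral>\<^sup>+x. ennreal (1 / c) * ennreal (g x * fs n x) \<partial>lebesgue)"
        unfolding eq
      proof (rule nn_integral_monotone_convergence_SUP)
        show "incseq (\<lambda>n x. ennreal (1 / c) * ennreal (g x * fs n x))"
          using g0 by (intro incseq_SucI le_funI mult_left_mono ennreal_leI)
            (auto simp: fs_def indicator_def intro!: min.mono)
        show "(\<lambda>x. ennreal (1 / c) * ennreal (g x * fs n x)) \<in> borel_measurable lebesgue" for n
          using gm fsm by measurable
      qed
      also have "\<dots> \<le> 1"
      proof (rule SUP_least)
        fix n
        have "(\<integral>\<^sup>+x. ennreal (1 / c) * ennreal (g x * fs n x) \<partial>lebesgue) = ennreal (1 / c) * ennreal (\<integral>x. g x * fs n x \<partial>lebesgue)"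
          unfolding nn[OF fsb fs0, symmetric] using gm fsm[of n] by (intro nn_integral_cmult) measurable
        also have "\<dots> \<le> ennreal (1 / c) * ennreal c"
          by (intro mult_left_mono ennreal_leI le_c fsb fs0 fsN) auto
        also have "\<dots> = 1" using c by (simp add: ennreal_mult[symmetric])
        finally show "(\<integral>\<^sup>+x. ennreal (1 / c) * ennreal (g x * fs n x) \<partial>lebesgue) \<le> 1" .
      qed
      finally show "(\<integral>\<^sup>+x. ennreal \<bar>f x * (g x / c)\<bar> \<partial>lebesgue) \<le> 1" .
    qed
    have "(\<integral>\<^sup>+x. ennreal (h x * (g x / c)) \<partial>lebesgue) = (\<integral>\<^sup>+x. ennreal (1 / c) * ennreal (g x * h x) \<partial>lebesgue)"
      using c g0 h(2) by (intro nn_integral_cong) (auto simp: ennreal_mult[symmetric] ac_simps)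
    also have "\<dots> = ennreal (1 / c) * ennreal (\<integral>x. g x * h x \<partial>lebesgue)"
      unfolding nn[OF h, symmetric] using gm hm by (intro nn_integral_cmult) measurable
    also have "(\<integral>x. g x * h x \<partial>lebesgue) = (\<integral>x. g x * g x + g x * u x \<partial>lebesgue)"
      by (intro Bochner_Integration.integral_cong) (auto simp: g_def algebra_simps)
    also have "\<dots> = (\<integral>x. g x * g x \<partial>lebesgue) + c"
      unfolding c_def by (intro Bochner_Integration.integral_add integrable_bdd_on[OF _ B] bdd_on_mult gb ub)
    also have "ennreal (1 / c) * ennreal ((\<integral>x. g x * g x \<partial>lebesgue) + c) = ennreal (1 + (\<integral>x. g x * g x \<partial>lebesgue) / c)"
      using c gg by (subst ennreal_mult[symmetric]) (auto simp: field_simps)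
    also have "\<dots> > 1"
      using c gg by (simp add: ennreal_less_iff flip: ennreal_1)
    finally show "1 < (\<integral>\<^sup>+x. ennreal (h x * (g x / c)) \<partial>lebesgue)" .
  qed
qed

end

text \<open>The norm is recovered from its Koethe dual (Lorentz--Luxemburg). After truncation the separating
  functional is the direction from the \<open>L\<^sup>2\<close>-nearest point of the unit ball.\<close>

lemma koethe_norming:
  assumes h: "h \<in> borel_measurable lebesgue" "\<And>x. 0 \<le> h x" and N: "1 < N h"
  shows "\<exists>g. g \<in> borel_measurable lebesgue \<and> (\<forall>x. 0 \<le> g x) \<and> koethe_dual N g \<le> 1 \<and>
    1 < (\<integral>\<^sup>+x. ennreal (h x * g x) \<partial>lebesgue)"
proof -
  define hs where "hs n x = min (h x) (real n) * indicator (cball 0 (real n)) x" for n x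
  have hsm: "hs n \<in> borel_measurable lebesgue" for n
    unfolding hs_def using h(1)
    by (intro borel_measurable_times borel_measurable_min borel_measurable_indicator) auto
  have hs0: "0 \<le> hs n x" "hs n x \<le> h x" for n x using h(2)[of x] by (auto simp: hs_def indicator_def)
  have "\<exists>n. 1 < N (hs n)"
  proof (rule ccontr)
    assume "\<not> (\<exists>n. 1 < N (hs n))"
    then have le: "N (hs n) \<le> 1" for n by (auto simp: not_less)
    have "N h \<le> 1"
    proof (rule N_le_of_incseq[OF hsm h(1) _ le], intro AE_I2 conjI allI)
      fix x n
      show "0 \<le> hs n x" by (rule hs0)
      show "hs n x \<le> hs (Suc n) x" using h(2)[of x] by (auto simp: hs_def indicator_def)
    next
      fix x
      obtain n0 :: nat where n0: "max (h x) (norm x) \<le> n0" using real_arch_simple by blast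
      have "eventually (\<lambda>n. hs n x = h x) sequentially"
        using n0 by (intro eventually_sequentiallyI[of n0]) (auto simp: hs_def indicator_def)
      then show "(\<lambda>n. hs n x) \<longlonglongrightarrow> h x" by (rule tendsto_eventually)
    qed
    then show False using N by auto
  qed
  then obtain n where n: "1 < N (hs n)" by auto
  have "bdd_on (cball 0 (real n)) (hs n)"
    by (rule bdd_onI[OF hsm, where b = n]) (use h(2) in \<open>auto simp: hs_def indicator_def\<close>)
  from koethe_norming_bdd[OF this hs0(1) _ n] obtain g where g: "g \<in> borel_measurable lebesgue" "\<forall>x. 0 \<le> g x"
    "koethe_dual N g \<le> 1" "1 < (\<integral>\<^sup>+x. ennreal (hs n x * g x) \<partial>lebesgue)" by auto
  have "(\<integral>\<^sup>+x. ennreal (hs n x * g x) \<partial>lebesgue) \<le> (\<integral>\<^sup>+x. ennreal (h x * g x) \<partial>lebesgue)"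
    using g(2) hs0 by (intro nn_integral_mono ennreal_leI mult_right_mono) auto
  with g(4) have "1 < (\<integral>\<^sup>+x. ennreal (h x * g x) \<partial>lebesgue)" by (rule less_le_trans)
  then show ?thesis using g by blast
qed

lemma N_le_by_duality:
  assumes h: "h \<in> borel_measurable lebesgue" "\<And>x. 0 \<le> h x" and "0 \<le> b"
    and le: "\<And>g. g \<in> borel_measurable lebesgue \<Longrightarrow> (\<And>x. 0 \<le> g x) \<Longrightarrow> koethe_dual N g \<le> 1 \<Longrightarrow>
      (\<integral>\<^sup>+x. ennreal (h x * g x) \<partial>lebesgue) \<le> ennreal b"
  shows "N h \<le> ennreal b"
proof (rule ccontr)
  assume "\<not> N h \<le> ennreal b"
  \<comment> \<open>\<open>N h\<close> may be infinite, so \<open>h\<close> is rescaled by a finite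
    \<open>t\<close> strictly between \<open>b\<close> and \<open>N h\<close>.\<close>
  then obtain b' where b': "ennreal b < b'" "b' < N h" using dense by (auto simp: not_le)
  then obtain t where t: "b' = ennreal t" "b < t" "0 < t"
    using \<open>0 \<le> b\<close> by (cases b') (auto simp: ennreal_less_iff)
  have m: "(\<lambda>x. (1 / t) * h x) \<in> borel_measurable lebesgue" using h by auto
  have "1 < N (\<lambda>x. (1 / t) * h x)"
  proof -
    have "1 = ennreal (1 / t) * ennreal t" using t by (simp add: ennreal_mult[symmetric])
    also have "\<dots> < ennreal (1 / t) * N h"
      using b' t by (intro ennreal_mult_strict_left_mono) auto
    finally show ?thesis unfolding N_cmult[OF h(1)] using t by simp
  qed
  from koethe_norming[OF m _ this] obtain g where g: "g \<in> borel_measurable lebesgue" "\<And>x. 0 \<le> g x"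
    "koethe_dual N g \<le> 1" "1 < (\<integral>\<^sup>+x. ennreal ((1 / t) * h x * g x) \<partial>lebesgue)" using h t by auto
  have "(\<integral>\<^sup>+x. ennreal ((1 / t) * h x * g x) \<partial>lebesgue) = (\<integral>\<^sup>+x. ennreal (1 / t) * ennreal (h x * g x) \<partial>lebesgue)"
    using t h g by (intro nn_integral_cong) (auto simp: ennreal_mult[symmetric] ac_simps)
  also have "\<dots> = ennreal (1 / t) * (\<integral>\<^sup>+x. ennreal (h x * g x) \<partial>lebesgue)"
    using h g by (intro nn_integral_cmult) measurable
  also have "\<dots> \<le> ennreal (1 / t) * ennreal b"
    by (intro mult_left_mono le g) auto
  also have "\<dots> \<le> 1" using t \<open>0 \<le> b\<close> by (simp add: ennreal_mult[symmetric])
  finally show False using g(4) by simp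
qed

end

section \<open>Rational cubes and the maximal function\<close>

lemma countable_rational_vectors: "countable {a::'a::euclidean_space. \<forall>i\<in>Basis. a \<bullet> i \<in> \<rat>}"
proof -
  have "{a::'a. \<forall>i\<in>Basis. a \<bullet> i \<in> \<rat>} \<subseteq> (\<lambda>f. \<Sum>i\<in>Basis. f i *\<^sub>R i) ` (PiE Basis (\<lambda>_. \<rat>))"
  proof
    fix a :: 'a assume a: "a \<in> {a. \<forall>i\<in>Basis. a \<bullet> i \<in> \<rat>}"
    have "a = (\<Sum>i\<in>Basis. restrict (\<lambda>i. a \<bullet> i) Basis i *\<^sub>R i)"
      by (simp add: euclidean_representation)
    then show "a \<in> (\<lambda>f. \<Sum>i\<in>Basis. f i *\<^sub>R i) ` (PiE Basis (\<lambda>_. \<rat>))"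
      using a by (intro image_eqI[of _ _ "restrict (\<lambda>i. a \<bullet> i) Basis"]) auto
  qed
  moreover have "countable (PiE (Basis :: 'a set) (\<lambda>_. \<rat> :: real set))"
    by (intro countable_PiE countable_rat) auto
  ultimately show ?thesis by (meson countable_image countable_subset)
qed

lemma countable_rat_cubes: "countable (rat_cubes :: 'a::euclidean_space set set)"
proof -
  let ?V = "{a::'a. \<forall>i\<in>Basis. a \<bullet> i \<in> \<rat>}"
  have "rat_cubes \<subseteq> (\<lambda>(a, b). cbox a b) ` (?V \<times> ?V)"
    unfolding rat_cubes_def by auto
  then show ?thesis
    by (rule countable_subset) (intro countable_image countable_SIGMA countable_rational_vectors)
qed

lemma rat_cubes_nonempty: "(rat_cubes :: 'a::euclidean_space set set) \<noteq> {}"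
proof -
  have "cbox 0 (0 + 1 *\<^sub>R One) \<in> (rat_cubes :: 'a set set)"
    unfolding rat_cubes_def by (intro CollectI exI[of _ 0] exI[of _ 1] exI conjI refl) auto
  then show ?thesis by blast
qed

lemma rat_cubeE:
  assumes "Q \<in> rat_cubes"
  obtains a t where "0 < t" "Q = cbox a (a + t *\<^sub>R One)"
  using assms unfolding rat_cubes_def by blast

lemma rat_cube_measure:
  assumes "Q \<in> rat_cubes"
  shows "Q \<in> lmeasurable" "Q \<in> sets lebesgue" "0 < measure lebesgue Q"
    "emeasure lebesgue Q = ennreal (measure lebesgue Q)"
proof -
  obtain a t where Q: "0 < t" "Q = cbox a (a + t *\<^sub>R One)" using assms by (rule rat_cubeE)
  show 1: "Q \<in> lmeasurable" unfolding Q(2) by simp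
  then show "Q \<in> sets lebesgue" by auto
  show "0 < measure lebesgue Q"
    unfolding Q(2) measure_box_One(2)[OF less_imp_le[OF Q(1)]] using Q(1) by simp
  show "emeasure lebesgue Q = ennreal (measure lebesgue Q)"
    using 1 by (intro emeasure_eq_measure2) (auto simp: fmeasurable_def)
qed

text \<open>Finite stages exhausting \<open>rat_cubes\<close>: sums and suprema over all rational
  cubes become increasing sequences, the form required by the Fatou property.\<close>

definition first_cubes :: "nat \<Rightarrow> 'a::euclidean_space set set" where
  "first_cubes n = from_nat_into rat_cubes ` {..n}"

lemma first_cubes:
  shows finite_first_cubes: "finite (first_cubes n)"
    and first_cubes_nonempty: "first_cubes n \<noteq> {}"
    and first_cubes_subset: "first_cubes n \<subseteq> rat_cubes"
    and first_cubes_mono: "m \<le> n \<Longrightarrow> first_cubes m \<subseteq> first_cubes n"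
  using from_nat_into[OF rat_cubes_nonempty] by (auto simp: first_cubes_def)

lemma ex_first_cubes:
  assumes "Q \<in> rat_cubes" shows "\<exists>n. Q \<in> first_cubes n"
proof -
  have "Q \<in> range (from_nat_into rat_cubes)"
    unfolding range_from_nat_into[OF rat_cubes_nonempty countable_rat_cubes] by fact
  then obtain n where "Q = from_nat_into rat_cubes n" by blast
  then have "Q \<in> first_cubes n" unfolding first_cubes_def by blast
  then show ?thesis ..
qed

lemma finite_subset_first_cubes:
  assumes "finite S" "S \<subseteq> rat_cubes" shows "\<exists>n. S \<subseteq> first_cubes n"
  using assms
proof (induction S)
  case (insert Q S)
  obtain m where m: "S \<subseteq> first_cubes m" using insert.IH insert.prems by auto
  obtain n where n: "Q \<in> first_cubes n" using ex_first_cubes[of Q] insert.prems by auto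
  have "insert Q S \<subseteq> first_cubes (max m n)"
    using m n first_cubes_mono[of m "max m n"] first_cubes_mono[of n "max m n"] by (simp add: subset_iff) blast
  then show ?case ..
qed simp

lemma infsum_rat_cubes:
  fixes g :: "'a::euclidean_space set \<Rightarrow> ennreal"
  shows "infsum g rat_cubes = (SUP n. sum g (first_cubes n))"
proof -
  have "infsum g rat_cubes = (SUP F\<in>{F. finite F \<and> F \<subseteq> rat_cubes}. sum g F)"
    by (intro nonneg_infsum_complete) auto
  also have "\<dots> = (SUP n. sum g (first_cubes n))"
  proof (rule antisym)
    show "(SUP F\<in>{F. finite F \<and> F \<subseteq> rat_cubes}. sum g F) \<le> (SUP n. sum g (first_cubes n))"
    proof (rule SUP_least)
      fix F :: "'a set set" assume "F \<in> {F. finite F \<and> F \<subseteq> rat_cubes}"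
      then obtain n where "F \<subseteq> first_cubes n" using finite_subset_first_cubes by blast
      then have "sum g F \<le> sum g (first_cubes n)" by (intro sum_mono2 finite_first_cubes) auto
      also have "\<dots> \<le> (SUP n. sum g (first_cubes n))" by (intro SUP_upper) auto
      finally show "sum g F \<le> \<dots>" .
    qed
    show "(SUP n. sum g (first_cubes n)) \<le> (SUP F\<in>{F. finite F \<and> F \<subseteq> rat_cubes}. sum g F)"
      using finite_first_cubes first_cubes_subset by (intro SUP_least SUP_upper) blast
  qed
  finally show ?thesis .
qed

text \<open>The left side has the shape in which \<open>lr_norm\<close> is written. An infinite
  supremum is treated apart because \<open>enn2real\<close> would send it to 0.\<close>

lemma SUP_powr:
  fixes s :: "nat \<Rightarrow> real"
  assumes s: "\<And>n. 0 \<le> s n" "\<And>n. s n \<le> s (Suc n)" and p: "0 < p"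
  shows "(if (SUP n. ennreal (s n)) = \<infinity> then \<infinity> else ennreal (enn2real (SUP n. ennreal (s n)) powr p))
    = (SUP n. ennreal (s n powr p))"
proof (cases "(SUP n. ennreal (s n)) = \<infinity>")
  case True
  have "(SUP n. ennreal (s n powr p)) = \<infinity>"
    unfolding infinity_ennreal_def
  proof (subst SUP_eq_top_iff, intro allI impI)
    fix y :: ennreal assume "y < top"
    then obtain b where b: "y = ennreal b" "0 \<le> b" by (cases y) auto
    have "ennreal (b powr (1 / p)) < (SUP n. ennreal (s n))"
      unfolding True by simp
    then obtain n where "ennreal (b powr (1 / p)) < ennreal (s n)" by (auto simp: less_SUP_iff)
    then have "b powr (1 / p) < s n" by (simp add: ennreal_less_iff)
    then have "(b powr (1 / p)) powr p < s n powr p" using p by (intro powr_less_mono2) auto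
    then have "b < s n powr p" using b p by (cases "b = 0") (auto simp: powr_powr)
    then show "\<exists>n\<in>UNIV. y < ennreal (s n powr p)" using b by (auto simp: ennreal_less_iff)
  qed
  then show ?thesis unfolding if_P[OF True] by (rule sym)
next
  case False
  have mono: "incseq (\<lambda>n. ennreal (s n))" using s by (intro incseq_SucI ennreal_leI)
  have "(\<lambda>n. enn2real (ennreal (s n))) \<longlonglongrightarrow> enn2real (SUP n. ennreal (s n))"
  proof (rule tendsto_enn2real)
    have "ennreal (enn2real (SUP n. ennreal (s n))) = (SUP n. ennreal (s n))"
      using False by (intro ennreal_enn2real) (simp only: less_top infinity_ennreal_def)
    then show "(\<lambda>n. ennreal (s n)) \<longlonglongrightarrow> ennreal (enn2real (SUP n. ennreal (s n)))"
      using LIMSEQ_SUP[OF mono] by presburger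
  qed simp
  then have "(\<lambda>n. s n) \<longlonglongrightarrow> enn2real (SUP n. ennreal (s n))" using s by simp
  then have "(\<lambda>n. s n powr p) \<longlonglongrightarrow> enn2real (SUP n. ennreal (s n)) powr p"
    using p s by (intro tendsto_powr') auto
  then have "(\<lambda>n. ennreal (s n powr p)) \<longlonglongrightarrow> ennreal (enn2real (SUP n. ennreal (s n)) powr p)"
    by (rule tendsto_ennrealI)
  moreover have "(\<lambda>n. ennreal (s n powr p)) \<longlonglongrightarrow> (SUP n. ennreal (s n powr p))"
    using s p by (intro LIMSEQ_SUP incseq_SucI ennreal_leI powr_mono2) auto
  ultimately have "ennreal (enn2real (SUP n. ennreal (s n)) powr p) = (SUP n. ennreal (s n powr p))"
    by (rule LIMSEQ_unique)
  then show ?thesis unfolding if_not_P[OF False] .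
qed

section \<open>Finite stages of the mixed norm\<close>

definition lr_part :: "real \<Rightarrow> ('a::euclidean_space set \<Rightarrow> 'a \<Rightarrow> real) \<Rightarrow> nat \<Rightarrow> 'a \<Rightarrow> real" where
  "lr_part r F n x = (\<Sum>Q\<in>first_cubes n. \<bar>F Q x\<bar> powr r) powr (1 / r)"

lemma lr_part_nonneg: "0 \<le> lr_part r F n x"
  by (simp add: lr_part_def)

lemma lr_part_mono: "0 < r \<Longrightarrow> lr_part r F n x \<le> lr_part r F (Suc n) x"
  unfolding lr_part_def using first_cubes_mono[of n "Suc n"]
  by (intro powr_mono2 sum_mono2 finite_first_cubes sum_nonneg) auto

lemma borel_measurable_lr_part:
  assumes "\<And>Q. Q \<in> rat_cubes \<Longrightarrow> F Q \<in> borel_measurable lebesgue"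
  shows "lr_part r F n \<in> borel_measurable lebesgue"
proof -
  have "F Q \<in> borel_measurable lebesgue" if "Q \<in> first_cubes n" for Q
    using assms first_cubes_subset[of n] that by blast
  then show ?thesis
    unfolding lr_part_def by (intro borel_measurable_lr_sum borel_measurable_abs)
qed

lemma lr_norm_eq_SUP:
  assumes "0 < r"
  shows "lr_norm r F x = (SUP n. ennreal (lr_part r F n x))"
proof -
  have "(\<Sum>\<^sub>\<infinity>Q\<in>rat_cubes. ennreal (\<bar>F Q x\<bar> powr r)) = (SUP n. ennreal (\<Sum>Q\<in>first_cubes n. \<bar>F Q x\<bar> powr r))"
    unfolding infsum_rat_cubes by simp
  then show ?thesis
    unfolding lr_norm_def Let_def lr_part_def using assms first_cubes_mono[OF le_SucI[OF order_refl]]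
    by (simp only:) (intro SUP_powr sum_mono2 finite_first_cubes sum_nonneg; auto)
qed

lemma borel_measurable_lr_norm:
  assumes "\<And>Q. Q \<in> rat_cubes \<Longrightarrow> F Q \<in> borel_measurable lebesgue" "0 < r"
  shows "lr_norm r F \<in> borel_measurable lebesgue"
proof -
  have "(\<lambda>x. SUP n. ennreal (lr_part r F n x)) \<in> borel_measurable lebesgue"
    using borel_measurable_lr_part[OF assms(1)] by measurable
  then show ?thesis using lr_norm_eq_SUP[OF assms(2), of F] by presburger
qed

lemma lr_norm_finite_support:
  assumes "finite S" "S \<subseteq> rat_cubes" "\<And>Q. Q \<in> rat_cubes \<Longrightarrow> Q \<notin> S \<Longrightarrow> F Q x = 0"
  shows "lr_norm r F x = ennreal ((\<Sum>Q\<in>S. \<bar>F Q x\<bar> powr r) powr (1 / r))"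
proof -
  have "(\<Sum>\<^sub>\<infinity>Q\<in>rat_cubes. ennreal (\<bar>F Q x\<bar> powr r)) = (\<Sum>\<^sub>\<infinity>Q\<in>S. ennreal (\<bar>F Q x\<bar> powr r))"
    using assms by (intro infsum_cong_neutral) auto
  also have "\<dots> = ennreal (\<Sum>Q\<in>S. \<bar>F Q x\<bar> powr r)" using assms(1) by simp
  finally show ?thesis unfolding lr_norm_def Let_def by (simp add: sum_nonneg)
qed

text \<open>Unlike \<open>cube_avg\<close>, which is 0 for a non-integrable function, this average
  takes the value infinity; it is the one that occurs in \<open>maximal\<close>.\<close>

definition eavg :: "('a::euclidean_space \<Rightarrow> real) \<Rightarrow> 'a set \<Rightarrow> ennreal" where
  "eavg f Q = (\<integral>\<^sup>+ y\<in>Q. ennreal \<bar>f y\<bar> \<partial>lebesgue) / emeasure lebesgue Q"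

lemma rat_cubes_subset_cubes: "Q \<in> rat_cubes \<Longrightarrow> cube Q"
  unfolding rat_cubes_def cube_def by blast

lemma ex_rat_cube_superset:
  fixes a :: "'a::euclidean_space"
  assumes "t < s"
  shows "\<exists>b t'. t < t' \<and> t' < s \<and> cbox a (a + t *\<^sub>R One) \<subseteq> cbox b (b + t' *\<^sub>R One) \<and>
    (\<forall>i\<in>Basis. b \<bullet> i \<in> \<rat> \<and> (b + t' *\<^sub>R One) \<bullet> i \<in> \<rat>)"
proof -
  \<comment> \<open>The corner moves down by less than \<open>d\<close> on each axis while the side
    grows by more than \<open>d\<close>, so the enlarged cube still covers the old one.\<close>
  define d where "d = (s - t) / 2"
  have d: "0 < d" using assms by (simp add: d_def)
  have "\<forall>i. \<exists>q\<in>\<rat>. a \<bullet> i - d < q \<and> q < a \<bullet> i"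
    using d by (intro allI Rats_dense_in_real) auto
  then obtain q where q: "\<And>i. q i \<in> \<rat>" "\<And>i. a \<bullet> i - d < q i" "\<And>i. q i < a \<bullet> i" by metis
  obtain t' where t': "t' \<in> \<rat>" "t + d < t'" "t' < s"
    using Rats_dense_in_real[of "t + d" s] d by (auto simp: d_def field_simps)
  define b where "b = (\<Sum>i\<in>Basis. q i *\<^sub>R i)"
  have b: "b \<bullet> i = q i" if "i \<in> Basis" for i using that by (simp add: b_def)
  show ?thesis
  proof (intro exI[of _ b] exI[of _ t'] conjI ballI)
    show "cbox a (a + t *\<^sub>R One) \<subseteq> cbox b (b + t' *\<^sub>R One)"
    proof (intro subset_box_imp(1) ballI conjI)
      fix i :: 'a assume i: "i \<in> Basis"
      show "b \<bullet> i \<le> a \<bullet> i" using q(3)[of i] b[OF i] by simp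
      show "(a + t *\<^sub>R One) \<bullet> i \<le> (b + t' *\<^sub>R One) \<bullet> i"
        using q(2)[of i] b[OF i] t' i by (simp add: inner_add_left)
    qed
  qed (use q t' d b in \<open>auto simp: inner_add_left\<close>)
qed

text \<open>A cube of side \<open>t\<close> lies in a rational cube of side less than
  \<open>s\<close> for every \<open>s > t\<close>; the loss is a ratio of volumes that tends to 1 as
  \<open>s\<close> approaches \<open>t\<close>.\<close>

lemma maximal_eq_SUP_rat_cubes:
  fixes f :: "'a::euclidean_space \<Rightarrow> real"
  shows "maximal f x = (SUP Q\<in>rat_cubes. eavg f Q * indicator Q x)"
proof (rule antisym)
  show "(SUP Q\<in>rat_cubes. eavg f Q * indicator Q x) \<le> maximal f x"
  proof (rule SUP_least)
    fix Q :: "'a set" assume Q: "Q \<in> rat_cubes"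
    show "eavg f Q * indicator Q x \<le> maximal f x"
    proof (cases "x \<in> Q")
      case True
      then have "Q \<in> {Q. cube Q \<and> x \<in> Q}" using rat_cubes_subset_cubes[OF Q] by simp
      then show ?thesis unfolding maximal_def eavg_def using True by (auto intro: SUP_upper)
    qed simp
  qed
  let ?S = "SUP Q\<in>rat_cubes. eavg f Q * indicator Q x"
  show "maximal f x \<le> ?S"
    unfolding maximal_def
  proof (rule SUP_least)
    fix Q :: "'a set" assume "Q \<in> {Q. cube Q \<and> x \<in> Q}"
    then obtain a t where t: "0 < t" and Q: "Q = cbox a (a + t *\<^sub>R One)" and x: "x \<in> Q"
      unfolding cube_def by blast
    let ?I = "\<integral>\<^sup>+ y\<in>Q. ennreal \<bar>f y\<bar> \<partial>lebesgue"
    show "?I / emeasure lebesgue Q \<le> ?S"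
    proof (cases "?S = \<infinity>")
      case False
      have bound: "?I \<le> ?S * ennreal (s ^ DIM('a))" if s: "t < s" for s
      proof -
        obtain b t' where b: "t < t'" "t' < s" "Q \<subseteq> cbox b (b + t' *\<^sub>R One)"
            "\<forall>i\<in>Basis. b \<bullet> i \<in> \<rat> \<and> (b + t' *\<^sub>R One) \<bullet> i \<in> \<rat>"
          using ex_rat_cube_superset[OF s, of a] unfolding Q by blast
        define R where "R = cbox b (b + t' *\<^sub>R One)"
        have R: "R \<in> rat_cubes" unfolding rat_cubes_def R_def using b t by (intro CollectI exI[of _ b] exI[of _ t'] exI) auto
        have "?I \<le> (\<integral>\<^sup>+ y\<in>R. ennreal \<bar>f y\<bar> \<partial>lebesgue)"
          using b(3) by (intro nn_integral_mono) (auto simp: R_def indicator_def)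
        also have "\<dots> = eavg f R * emeasure lebesgue R"
          unfolding eavg_def using rat_cube_measure[OF R]
          by (subst mult.commute) (simp add: ennreal_times_divide mult.commute[of "ennreal _"] mult_divide_eq_ennreal)
        also have "emeasure lebesgue R = ennreal (t' ^ DIM('a))"
          unfolding rat_cube_measure(4)[OF R] unfolding R_def using b t by (subst measure_box_One) auto
        also have "eavg f R * ennreal (t' ^ DIM('a)) \<le> ?S * ennreal (s ^ DIM('a))"
        proof (intro mult_mono ennreal_leI power_mono)
          have "eavg f R = eavg f R * indicator R x" using x b(3) by (auto simp: R_def indicator_def)
          also have "\<dots> \<le> ?S" by (rule SUP_upper[OF R])
          finally show "eavg f R \<le> ?S" .
        qed (use b t in auto)
        finally show ?thesis .
      qed
      \<comment> \<open>Multiplication by \<open>?S\<close> is continuous here because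
        \<open>?S\<close> is finite.\<close>
      have "(\<lambda>n. ?S * ennreal ((t + inverse (real (Suc n))) ^ DIM('a))) \<longlonglongrightarrow> ?S * ennreal ((t + 0) ^ DIM('a))"
        using False by (intro ennreal_tendsto_cmult tendsto_ennrealI tendsto_intros LIMSEQ_inverse_real_of_nat)
          (simp only: less_top infinity_ennreal_def)
      then have "?I \<le> ?S * ennreal ((t + 0) ^ DIM('a))"
        using bound by (intro LIMSEQ_le_const) auto
      moreover have "emeasure lebesgue Q = ennreal (t ^ DIM('a))"
        using t measure_box_One(2)[of t a] by (subst emeasure_eq_measure2) (auto simp: Q)
      ultimately show ?thesis
        using t by (simp add: divide_le_posI_ennreal mult.commute)
    next
      case True
      show ?thesis unfolding True by simp
    qed
  qed
qed

lemma eavg_eq_cube_avg: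
  assumes f: "set_integrable lebesgue Q f" "\<And>x. 0 \<le> f x" and Q: "Q \<in> rat_cubes"
  shows "eavg f Q = ennreal (cube_avg f Q)"
proof -
  have "(\<integral>\<^sup>+ y\<in>Q. ennreal \<bar>f y\<bar> \<partial>lebesgue) = (\<integral>\<^sup>+ y. ennreal (indicator Q y *\<^sub>R f y) \<partial>lebesgue)"
    using f(2) by (intro nn_integral_cong) (auto simp: indicator_def)
  also have "\<dots> = ennreal (set_lebesgue_integral lebesgue Q f)"
    unfolding set_lebesgue_integral_def
    using f by (intro nn_integral_eq_integral) (auto simp: set_integrable_def)
  finally show ?thesis
    unfolding eavg_def cube_avg_def rat_cube_measure(4)[OF Q]
    using rat_cube_measure(3)[OF Q] f(2)
    by (simp add: divide_ennreal set_lebesgue_integral_def Bochner_Integration.integral_nonneg)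
qed

section \<open>Monotone approximation of the maximal function by finite maxima\<close>

definition trunc :: "nat \<Rightarrow> ('a::euclidean_space \<Rightarrow> real) \<Rightarrow> 'a \<Rightarrow> real" where
  "trunc n f x = min \<bar>f x\<bar> (real n)"

lemma nonneg_bdd_trunc: "f \<in> borel_measurable lebesgue \<Longrightarrow> nonneg_bdd (trunc n f)"
  unfolding trunc_def by (intro nonneg_bddI[where B = n]) auto

lemma trunc_le: "trunc n f x \<le> \<bar>f x\<bar>" and trunc_mono: "m \<le> n \<Longrightarrow> trunc m f x \<le> trunc n f x"
  and trunc_nonneg: "0 \<le> trunc n f x"
  by (auto simp: trunc_def)

lemma SUP_trunc: "(SUP n. ennreal (trunc n f x)) = ennreal \<bar>f x\<bar>"
proof (rule antisym)
  show "(SUP n. ennreal (trunc n f x)) \<le> ennreal \<bar>f x\<bar>"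
    by (intro SUP_least ennreal_leI trunc_le)
  obtain n :: nat where "\<bar>f x\<bar> \<le> n" using real_arch_simple by blast
  then have "\<bar>f x\<bar> = trunc n f x" by (simp add: trunc_def)
  then show "ennreal \<bar>f x\<bar> \<le> (SUP n. ennreal (trunc n f x))" by (metis SUP_upper UNIV_I)
qed

lemma eavg_eq_SUP:
  assumes f: "f \<in> borel_measurable lebesgue" and Q: "Q \<in> rat_cubes"
  shows "eavg f Q = (SUP n. ennreal (cube_avg (trunc n f) Q))"
proof -
  have m: "trunc n f \<in> borel_measurable lebesgue" for n using nonneg_bdd_trunc[OF f] by (auto simp: nonneg_bdd_def)
  have "(\<integral>\<^sup>+ y\<in>Q. ennreal \<bar>f y\<bar> \<partial>lebesgue) = (\<integral>\<^sup>+ y. (SUP n. ennreal (trunc n f y) * indicator Q y) \<partial>lebesgue)"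
    unfolding SUP_trunc[symmetric] by (simp add: SUP_mult_right_ennreal)
  also have "\<dots> = (SUP n. \<integral>\<^sup>+ y. ennreal (trunc n f y) * indicator Q y \<partial>lebesgue)"
    using m rat_cube_measure(2)[OF Q]
    by (intro nn_integral_monotone_convergence_SUP incseq_SucI le_funI mult_right_mono ennreal_leI trunc_mono) auto
  finally have "eavg f Q = (SUP n. eavg (trunc n f) Q)"
    unfolding eavg_def using trunc_nonneg[of _ f] by (simp add: SUP_divide_ennreal abs_of_nonneg)
  then show ?thesis using eavg_eq_cube_avg[OF set_integrable_nonneg_bdd[OF nonneg_bdd_trunc[OF f] rat_cube_measure(1)[OF Q]] trunc_nonneg Q] by simp
qed

text \<open>One index controls both the height of the truncation and the number of cubes, so a
  single increasing sequence reaches the maximal function.\<close>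

definition max_part :: "nat \<Rightarrow> ('a::euclidean_space \<Rightarrow> real) \<Rightarrow> 'a \<Rightarrow> real" where
  "max_part n f x = Max ((\<lambda>Q. cube_avg (trunc n f) Q * indicator Q x) ` first_cubes n)"

lemma max_part_le_iff: "max_part n f x \<le> c \<longleftrightarrow> (\<forall>Q\<in>first_cubes n. cube_avg (trunc n f) Q * indicator Q x \<le> c)"
  unfolding max_part_def using finite_first_cubes[of n] first_cubes_nonempty[of n] by (subst Max_le_iff) auto

lemma max_part_upper: "Q \<in> first_cubes n \<Longrightarrow> cube_avg (trunc n f) Q * indicator Q x \<le> max_part n f x"
  using max_part_le_iff by blast

lemma max_part_nonneg:
  fixes f :: "'a::euclidean_space \<Rightarrow> real"
  shows "0 \<le> max_part n f x"
proof -
  obtain Q :: "'a set" where "Q \<in> first_cubes n" using first_cubes_nonempty[of n] by auto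
  then have "cube_avg (trunc n f) Q * indicator Q x \<le> max_part n f x" by (rule max_part_upper)
  moreover have "0 \<le> cube_avg (trunc n f) Q * indicator Q x" by (simp add: cube_avg_nonneg trunc_nonneg)
  ultimately show ?thesis by linarith
qed

lemma borel_measurable_max_part:
  fixes f :: "'a::euclidean_space \<Rightarrow> real"
  shows "max_part n f \<in> borel_measurable lebesgue"
proof -
  have "Q \<in> sets lebesgue" if "Q \<in> first_cubes n" for Q :: "'a set"
    using first_cubes_subset[of n] that rat_cube_measure(2) by blast
  then show ?thesis
    unfolding max_part_def
    by (intro borel_measurable_Max finite_first_cubes borel_measurable_times borel_measurable_indicator) auto
qed

lemma cube_avg_trunc_mono:
  assumes "f \<in> borel_measurable lebesgue" "Q \<in> rat_cubes" "m \<le> n"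
  shows "cube_avg (trunc m f) Q \<le> cube_avg (trunc n f) Q"
  using assms by (intro cube_avg_mono nonneg_bdd_trunc trunc_mono rat_cube_measure)

lemma max_part_mono:
  fixes f :: "'a::euclidean_space \<Rightarrow> real"
  assumes f: "f \<in> borel_measurable lebesgue"
  shows "max_part n f x \<le> max_part (Suc n) f x"
  unfolding max_part_le_iff
proof
  fix Q :: "'a set" assume Q: "Q \<in> first_cubes n"
  then have Q': "Q \<in> rat_cubes" "Q \<in> first_cubes (Suc n)"
    using first_cubes_subset[of n] first_cubes_mono[of n "Suc n"] by auto
  have "cube_avg (trunc n f) Q * indicator Q x \<le> cube_avg (trunc (Suc n) f) Q * indicator Q x"
    by (intro mult_right_mono cube_avg_trunc_mono f Q') auto
  also have "\<dots> \<le> max_part (Suc n) f x" by (rule max_part_upper[OF Q'(2)])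
  finally show "cube_avg (trunc n f) Q * indicator Q x \<le> \<dots>" .
qed

lemma maximal_eq_SUP_max_part:
  fixes f :: "'a::euclidean_space \<Rightarrow> real"
  assumes f: "f \<in> borel_measurable lebesgue"
  shows "maximal f x = (SUP n. ennreal (max_part n f x))"
proof (rule antisym)
  show "maximal f x \<le> (SUP n. ennreal (max_part n f x))"
    unfolding maximal_eq_SUP_rat_cubes
  proof (rule SUP_least)
    fix Q :: "'a set" assume Q: "Q \<in> rat_cubes"
    obtain m where m: "Q \<in> first_cubes m" using ex_first_cubes[OF Q] by blast
    show "eavg f Q * indicator Q x \<le> (SUP n. ennreal (max_part n f x))"
    proof (cases "x \<in> Q")
      case True
      have "(SUP n. ennreal (cube_avg (trunc n f) Q)) \<le> (SUP n. ennreal (max_part n f x))"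
      proof (rule SUP_least)
        fix n
        have Qk: "Q \<in> first_cubes (max m n)" using first_cubes_mono[of m "max m n"] m by auto
        have "cube_avg (trunc n f) Q \<le> cube_avg (trunc (max m n) f) Q"
          by (intro cube_avg_trunc_mono f Q) simp
        also have "\<dots> \<le> max_part (max m n) f x" using max_part_upper[OF Qk, of f x] True by simp
        finally have "ennreal (cube_avg (trunc n f) Q) \<le> ennreal (max_part (max m n) f x)" by (rule ennreal_leI)
        also have "\<dots> \<le> (SUP n. ennreal (max_part n f x))" by (intro SUP_upper) auto
        finally show "ennreal (cube_avg (trunc n f) Q) \<le> \<dots>" .
      qed
      then show ?thesis using True eavg_eq_SUP[OF f Q] by simp
    qed simp
  qed
  show "(SUP n. ennreal (max_part n f x)) \<le> maximal f x"
  proof (rule SUP_least)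
    fix n
    have "max_part n f x \<in> (\<lambda>Q. cube_avg (trunc n f) Q * indicator Q x) ` first_cubes n"
      unfolding max_part_def using finite_first_cubes[of n] first_cubes_nonempty[of n] by (intro Max_in) auto
    then obtain Q where Q: "Q \<in> first_cubes n" "max_part n f x = cube_avg (trunc n f) Q * indicator Q x" by auto
    have Qr: "Q \<in> rat_cubes" using Q(1) first_cubes_subset[of n] by auto
    have "ennreal (max_part n f x) = ennreal (cube_avg (trunc n f) Q) * indicator Q x"
      unfolding Q(2) by (auto simp: indicator_def)
    also have "\<dots> \<le> eavg f Q * indicator Q x"
      unfolding eavg_eq_SUP[OF f Qr] by (intro mult_right_mono SUP_upper) auto
    also have "\<dots> \<le> maximal f x"
      unfolding maximal_eq_SUP_rat_cubes by (intro SUP_upper Qr)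
    finally show "ennreal (max_part n f x) \<le> maximal f x" .
  qed
qed

lemma borel_measurable_maximal:
  assumes "f \<in> borel_measurable lebesgue" shows "maximal f \<in> borel_measurable lebesgue"
proof -
  have "(\<lambda>x. SUP n. ennreal (max_part n f x)) \<in> borel_measurable lebesgue"
    using borel_measurable_max_part[of _ f] by measurable
  then show ?thesis using maximal_eq_SUP_max_part[OF assms] by presburger
qed

section \<open>From the averaging operator to the maximal operator\<close>

text \<open>The expression equals \<open>4 * C * (2 * n) powr (p - 1)\<close>; the cases needed are
  \<open>p = 1 / r\<close> and \<open>p = 1 - 1 / r\<close>.\<close>

lemma ex_window_size:
  fixes C p :: real
  assumes "p < 1"
  shows "\<forall>\<^sub>F n in sequentially. C * (2 / real n) * (2 * real n) powr p \<le> 1 / 2"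
proof -
  have lim: "filterlim (\<lambda>n. 2 * real n) at_top sequentially"
    by (intro filterlim_tendsto_pos_mult_at_top[OF tendsto_const] filterlim_real_sequentially) auto
  have "(\<lambda>n. (2 * real n) powr (p - 1)) \<longlonglongrightarrow> 0"
    using assms by (intro tendsto_neg_powr lim) auto
  then have "(\<lambda>n. (4 * C) * (2 * real n) powr (p - 1)) \<longlonglongrightarrow> (4 * C) * 0"
    by (intro tendsto_intros)
  then have "\<forall>\<^sub>F n in sequentially. (4 * C) * (2 * real n) powr (p - 1) < 1 / 2"
    by (rule order_tendstoD(2)) simp
  then show ?thesis using eventually_gt_at_top[of 0]
  proof eventually_elim
    case (elim n)
    have "C * (2 / real n) * (2 * real n) powr p = (4 * C) * (2 * real n) powr (p - 1)"
      using elim by (simp add: powr_diff field_simps)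
    then show ?case using elim by simp
  qed
qed

text \<open>A cube occurring again in a deeper layer would be covered entirely by the layer below
  its first occurrence, against sparseness. Hence a family indexed by cubes can encode one function
  per layer.\<close>

lemma (in sparse_layers) L_disjoint_levels:
  assumes "Q \<in> L i" "Q \<in> L j" shows "i = j"
proof -
  have "x \<in> \<Omega> (Suc i)" if "Q \<in> L i" "Q \<in> L j" "x \<in> Q" "i < j" for i j x
    using \<Omega>_antimono[of "Suc i" j] that by (auto simp: \<Omega>_def)
  then have sub: "Q \<subseteq> \<Omega> (Suc i)" if "Q \<in> L i" "Q \<in> L j" "i < j" for i j using that by blast
  have "\<not> i < j" if "Q \<in> L i" "Q \<in> L j" for i j
  proof
    assume "i < j"
    then have "Q \<inter> \<Union>(L (Suc i)) = Q" using sub[OF that] by (auto simp: \<Omega>_def)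
    then show False using sparse_L[OF that(1)] measure_L_pos[OF that(1)] by simp
  qed
  then show ?thesis using assms by (meson linorder_neqE_nat)
qed

lemma (in sparse_layers) sum_L_powr:
  assumes "0 < r"
  shows "A i f x powr r = (\<Sum>Q\<in>L i. (cube_avg f Q * indicator Q x) powr r)"
proof (cases "x \<in> \<Omega> i")
  case True
  then obtain Q where Q: "Q \<in> L i" "x \<in> Q" by (auto simp: \<Omega>_def)
  have "(\<Sum>Q\<in>L i. (cube_avg f Q * indicator Q x) powr r) = (\<Sum>Q\<in>L i. cube_avg f Q powr r * indicator Q x)"
    using assms by (intro sum.cong) (auto simp: indicator_def)
  also have "\<dots> = cube_avg f Q powr r" by (rule sum_L_indicator[OF Q])
  finally show ?thesis using A_eq[OF Q] by simp
next
  case False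
  then have "(\<Sum>Q\<in>L i. (cube_avg f Q * indicator Q x) powr r) = 0"
    by (intro sum.neutral) (auto simp: \<Omega>_def indicator_def)
  then show ?thesis using A_eq_0[OF False] by simp
qed

lemma (in sparse_layers) sum_L_indicator_le:
  fixes c :: real
  assumes "0 \<le> c" shows "(\<Sum>Q\<in>L i. c * indicator Q x) \<le> c"
proof (cases "x \<in> \<Omega> i")
  case True
  then obtain Q where Q: "Q \<in> L i" "x \<in> Q" by (auto simp: \<Omega>_def)
  show ?thesis using sum_L_indicator[OF Q, of "\<lambda>_. c"] by simp
next
  case False
  then have "(\<Sum>Q\<in>L i. c * indicator Q x) = 0"
    by (intro sum.neutral) (auto simp: \<Omega>_def indicator_def)
  then show ?thesis using assms by simp
qed

text \<open>Test family: the closure of a box \<open>R\<close> of layer \<open>i\<close> carries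
  \<open>h i\<close> restricted to \<open>R\<close>. Disjointness within a layer collapses the sums
  over cubes to \<open>h i\<close> before averaging and to \<open>A i (h i)\<close> after it;
  replacing \<open>R\<close> by its closure keeps the averages and only enlarges the averaged
  side.\<close>

lemma (in function_norm) vector_bound_layers:
  fixes h :: "nat \<Rightarrow> 'a \<Rightarrow> real"
  assumes M: "\<And>F. Xlr_norm N r F < \<infinity> \<Longrightarrow> Xlr_norm N r (Mfam F) \<le> ennreal C * Xlr_norm N r F"
    and C: "0 < C" and r: "1 < r"
    and L: "sparse_layers L K" and boxes: "\<And>i R. R \<in> L i \<Longrightarrow> open_rat_box R"
    and h: "\<And>i. nonneg_bdd (h i)"
  shows "N (\<lambda>x. (\<Sum>i<K. sparse_layers.A L i (h i) x powr r) powr (1 / r))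
    \<le> ennreal C * N (\<lambda>x. (\<Sum>i<K. h i x powr r) powr (1 / r))"
proof -
  interpret sparse_layers L K by fact
  have r0: "0 < r" using r by simp
  note clo = open_rat_box_closure[OF boxes]
  have inj: "inj_on closure (L i)" for i
    using clo(2) by (intro inj_on_inverseI[where g = interior])
  define S where "S = (\<Union>i<K. closure ` L i)"
  have S: "finite S" "S \<subseteq> rat_cubes" using finite_L clo(1) by (auto simp: S_def)
  have disj: "closure ` L i \<inter> closure ` L j = {}" if "i \<noteq> j" for i j
  proof -
    have "interior Q \<in> L i" if "Q \<in> closure ` L i" for Q i using that clo(2) by auto
    then show ?thesis using L_disjoint_levels that by blast
  qed
  have sum_S: "(\<Sum>Q\<in>S. g Q) = (\<Sum>i<K. \<Sum>R\<in>L i. g (closure R))" for g :: "'a set \<Rightarrow> real"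
  proof -
    have "(\<Sum>Q\<in>S. g Q) = (\<Sum>i<K. \<Sum>Q\<in>closure ` L i. g Q)"
      unfolding S_def using finite_L disj by (intro sum.UNION_disjoint) auto
    then show ?thesis by (simp add: sum.reindex[OF inj])
  qed
  \<comment> \<open>At most one summand is nonzero, so the sum merely selects the layer of a cube;
    \<open>interior\<close> recovers the open box from its closure.\<close>
  define F where "F Q x = (\<Sum>i<K. if interior Q \<in> L i then h i x * indicator (interior Q) x else 0)" for Q x
  have F_clo: "F (closure R) = (\<lambda>x. h i x * indicator R x)" if R: "R \<in> L i" "i < K" for R i
  proof
    fix x
    define k where "k j = (if R \<in> L j then h j x * indicator R x else 0)" for j
    have "R \<notin> L j" if "j \<noteq> i" for j using L_disjoint_levels[OF R(1), of j] that by auto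
    then have "(\<Sum>j<K. k j) = (\<Sum>j\<in>{i}. k j)"
      using R by (intro sum.mono_neutral_right) (auto simp: k_def)
    moreover have "F (closure R) x = (\<Sum>j<K. k j)"
      unfolding F_def k_def clo(2)[OF R(1)] ..
    moreover have "(\<Sum>j\<in>{i}. k j) = k i" by simp
    moreover have "k i = h i x * indicator R x" using R(1) unfolding k_def by (rule if_P)
    ultimately show "F (closure R) x = h i x * indicator R x" by presburger
  qed
  have F_0: "F Q = (\<lambda>x. 0)" if "Q \<in> rat_cubes" "Q \<notin> S" for Q
  proof -
    have "interior Q \<notin> L i" if "i < K" for i
    proof
      assume i: "interior Q \<in> L i"
      obtain a t where Q: "0 < t" "Q = cbox a (a + t *\<^sub>R One)" using \<open>Q \<in> rat_cubes\<close> by (rule rat_cubeE)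
      have "closure (interior Q) = Q"
        unfolding Q(2) interior_cbox by (rule closure_box[OF box_One_nonempty[OF Q(1)]])
      then have "Q \<in> S" unfolding S_def using i that by blast
      then show False using \<open>Q \<notin> S\<close> by simp
    qed
    then show ?thesis by (intro ext) (auto simp: F_def)
  qed
  have F_meas: "F Q \<in> borel_measurable lebesgue" for Q
  proof -
    have "(\<lambda>x. if interior Q \<in> L i then h i x * indicator (interior Q) x else 0) \<in> borel_measurable lebesgue" for i
      using nonneg_bdd_measurable[OF nonneg_bdd_mult[OF h[of i] nonneg_bdd_indicator[OF sets_L]], of "interior Q" i]
      by (cases "interior Q \<in> L i") auto
    then show ?thesis unfolding F_def by (intro borel_measurable_sum)
  qed
  have h0: "0 \<le> h i x" for i x by (rule nonneg_bdd_nonneg[OF h])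
  have avg: "cube_avg (F (closure R)) (closure R) = cube_avg (h i) R" if R: "R \<in> L i" "i < K" for R i
  proof -
    obtain c s where cs: "0 < s" "R = box c (c + s *\<^sub>R One)" using boxes[OF R(1)] by (auto simp: open_rat_box_def)
    have "closure R = cbox c (c + s *\<^sub>R One)"
      unfolding cs(2) by (rule closure_box[OF box_One_nonempty[OF cs(1)]])
    then have "measure lebesgue (closure R) = measure lebesgue R"
      using measure_box_One[of s c] cs by simp
    moreover have "set_lebesgue_integral lebesgue (closure R) (\<lambda>x. h i x * indicator R x) = set_lebesgue_integral lebesgue R (h i)"
      unfolding set_lebesgue_integral_def using closure_subset[of R]
      by (intro Bochner_Integration.integral_cong) (auto simp: indicator_def)
    ultimately show ?thesis unfolding F_clo[OF R] cube_avg_def by simp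
  qed
  have avg0: "0 \<le> cube_avg (h i) R" for i R using h0 by (rule cube_avg_nonneg)
  have nF: "lr_norm r F x = ennreal ((\<Sum>i<K. \<Sum>R\<in>L i. \<bar>h i x * indicator R x\<bar> powr r) powr (1 / r))" for x
  proof -
    have "lr_norm r F x = ennreal ((\<Sum>Q\<in>S. \<bar>F Q x\<bar> powr r) powr (1 / r))"
      using F_0 by (intro lr_norm_finite_support S) simp
    then show ?thesis by (simp add: sum_S F_clo)
  qed
  have nM: "lr_norm r (Mfam F) x = ennreal ((\<Sum>i<K. \<Sum>R\<in>L i. (cube_avg (h i) R * indicator (closure R) x) powr r) powr (1 / r))" for x
  proof -
    have "lr_norm r (Mfam F) x = ennreal ((\<Sum>Q\<in>S. \<bar>Mfam F Q x\<bar> powr r) powr (1 / r))"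
      using F_0 by (intro lr_norm_finite_support S) (simp add: Mfam_def cube_avg_def set_lebesgue_integral_def)
    also have "(\<Sum>Q\<in>S. \<bar>Mfam F Q x\<bar> powr r) = (\<Sum>i<K. \<Sum>R\<in>L i. (cube_avg (h i) R * indicator (closure R) x) powr r)"
      unfolding sum_S using avg avg0 by (intro sum.cong refl) (simp add: Mfam_def abs_mult)
    finally show ?thesis .
  qed
  have meas_h: "(\<lambda>x. (\<Sum>i<K. h i x powr r) powr (1 / r)) \<in> borel_measurable lebesgue"
    using h by (intro borel_measurable_lr_sum) (auto simp: nonneg_bdd_def)
  have meas_A: "(\<lambda>x. (\<Sum>i<K. A i (h i) x powr r) powr (1 / r)) \<in> borel_measurable lebesgue"
    using nonneg_bdd_A[OF h] by (intro borel_measurable_lr_sum) (auto simp: nonneg_bdd_def)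
  have "Xlr_norm N r F = N (\<lambda>x. enn2real (lr_norm r F x))"
    unfolding Xlr_norm_def meas_def using F_meas nF by auto
  also have "\<dots> \<le> N (\<lambda>x. (\<Sum>i<K. h i x powr r) powr (1 / r))"
  proof (rule N_mono[OF meas_h])
    show "(\<lambda>x. enn2real (lr_norm r F x)) \<in> borel_measurable lebesgue"
      using borel_measurable_lr_norm[of F r] F_meas r0 by measurable
    fix x
    have "(\<Sum>R\<in>L i. \<bar>h i x * indicator R x\<bar> powr r) \<le> h i x powr r" for i
    proof -
      have "(\<Sum>R\<in>L i. \<bar>h i x * indicator R x\<bar> powr r) = (\<Sum>R\<in>L i. h i x powr r * indicator R x)"
        using h0[of i x] r0 by (intro sum.cong) (auto simp: indicator_def)
      then show ?thesis using sum_L_indicator_le[of "h i x powr r" x i] by simp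
    qed
    then show "enn2real (lr_norm r F x) \<le> (\<Sum>i<K. h i x powr r) powr (1 / r)"
      unfolding nF using r0 by (auto intro!: powr_mono2 sum_mono sum_nonneg)
  qed simp
  finally have XF: "Xlr_norm N r F \<le> N (\<lambda>x. (\<Sum>i<K. h i x powr r) powr (1 / r))" .
  show ?thesis
  proof (cases "N (\<lambda>x. (\<Sum>i<K. h i x powr r) powr (1 / r)) = \<infinity>")
    case False
    \<comment> \<open>The operator bound is available for families of finite norm only; if the right
      side is infinite the claim is trivial because \<open>C > 0\<close>.\<close>
    then have fin: "Xlr_norm N r F < \<infinity>" using XF by (simp add: less_top[symmetric] top_unique neq_top_trans)
    have Mm: "Mfam F Q \<in> borel_measurable lebesgue" if "Q \<in> rat_cubes" for Q
      unfolding Mfam_def using rat_cube_measure(2)[OF that] by measurable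
    have "N (\<lambda>x. (\<Sum>i<K. A i (h i) x powr r) powr (1 / r)) \<le> N (\<lambda>x. enn2real (lr_norm r (Mfam F) x))"
    proof (rule N_mono[OF _ meas_A])
      show "(\<lambda>x. enn2real (lr_norm r (Mfam F) x)) \<in> borel_measurable lebesgue"
        using borel_measurable_lr_norm[of "Mfam F" r] Mm r0 by measurable
      fix x
      show "(\<Sum>i<K. A i (h i) x powr r) powr (1 / r) \<le> enn2real (lr_norm r (Mfam F) x)"
      proof -
        have "cube_avg (h i) R * indicator R x \<le> cube_avg (h i) R * indicator (closure R) x" for i R
          using avg0 closure_subset[of R] by (intro mult_left_mono) (auto simp: indicator_def)
        then show ?thesis
          unfolding nM sum_L_powr[OF r0] using r0 avg0
          by (auto intro!: powr_mono2 sum_mono sum_nonneg)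
      qed
    qed simp
    also have "\<dots> = Xlr_norm N r (Mfam F)"
      unfolding Xlr_norm_def meas_def using Mm nM by auto
    also have "\<dots> \<le> ennreal C * Xlr_norm N r F" by (rule M[OF fin])
    also have "\<dots> \<le> ennreal C * N (\<lambda>x. (\<Sum>i<K. h i x powr r) powr (1 / r))"
      by (intro mult_left_mono XF) auto
    finally show ?thesis .
  next
    case True
    show ?thesis unfolding True using C by (simp add: ennreal_mult_top)
  qed
qed

text \<open>The quantifier order is the point: \<open>n\<close>, and with it \<open>b\<close>, is
  chosen from \<open>C\<close> and \<open>r\<close> before the layers and the function are
  known.\<close>

lemma (in function_norm) ex_sparse_bound:
  assumes M: "Mfam_bounded N r" and r: "1 < r"
  shows "\<exists>b>0. \<forall>L K f. sparse_layers L K \<longrightarrow> (\<forall>i. \<forall>R\<in>L i. open_rat_box R) \<longrightarrow> nonneg_bdd f \<longrightarrow>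
    N (\<lambda>x. \<Sum>p<K. sparse_layers.e L p x * sparse_layers.A L p f x) \<le> ennreal b * N f \<and>
    N (\<lambda>x. \<Sum>i<K. sparse_layers.A L i (\<lambda>y. sparse_layers.e L i y * f y) x) \<le> ennreal b * N f"
proof -
  obtain C0 where C0: "\<And>F. Xlr_norm N r F < \<infinity> \<Longrightarrow> Xlr_norm N r (Mfam F) \<le> ennreal C0 * Xlr_norm N r F"
    using M unfolding Mfam_bounded_def by blast
  define C where "C = max 1 C0"
  have C: "0 < C" by (simp add: C_def)
  have MC: "Xlr_norm N r (Mfam F) \<le> ennreal C * Xlr_norm N r F" if "Xlr_norm N r F < \<infinity>" for F
  proof -
    have "ennreal C0 * Xlr_norm N r F \<le> ennreal C * Xlr_norm N r F"
      by (intro mult_right_mono ennreal_leI) (auto simp: C_def)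
    then show ?thesis using C0[OF that] by (rule order_trans[rotated])
  qed
  have "\<forall>\<^sub>F n in sequentially. 0 < n \<and> C * (2 / real n) * (2 * real n) powr (1 / r) \<le> 1 / 2 \<and>
      C * (2 / real n) * (2 * real n) powr (1 - 1 / r) \<le> 1 / 2"
    using r by (intro eventually_conj eventually_gt_at_top ex_window_size) auto
  then obtain n where n: "0 < n" "C * (2 / real n) * (2 * real n) powr (1 / r) \<le> 1 / 2"
      "C * (2 / real n) * (2 * real n) powr (1 - 1 / r) \<le> 1 / 2"
    by (auto simp: eventually_sequentially)
  define b where "b = max (2 * C * (2 * n) powr (1 / r)) (2 * C * (2 * n) powr (1 - 1 / r))"
  have "0 < b" using C n by (simp add: b_def less_max_iff_disj)
  moreover have "N (\<lambda>x. \<Sum>p<K. sparse_layers.e L p x * sparse_layers.A L p f x) \<le> ennreal b * N f \<and>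
    N (\<lambda>x. \<Sum>i<K. sparse_layers.A L i (\<lambda>y. sparse_layers.e L i y * f y) x) \<le> ennreal b * N f"
    if L: "sparse_layers L K" and boxes: "\<forall>i. \<forall>R\<in>L i. open_rat_box R" and f: "nonneg_bdd f" for L K f
  proof -
    interpret sparse_layers L K by fact
    interpret sparse_layers_norm L K N C r n
    proof unfold_locales
      show "N (\<lambda>x. (\<Sum>i<K. A i (h i) x powr r) powr (1 / r)) \<le> ennreal C * N (\<lambda>x. (\<Sum>i<K. h i x powr r) powr (1 / r))"
        if "\<And>i. nonneg_bdd (h i)" for h
        using boxes that by (intro vector_bound_layers[OF MC C r L]) auto
    qed (use C r n in auto)
    have "ennreal (2 * C * (2 * n) powr (1 / r)) * N f \<le> ennreal b * N f"
      "ennreal (2 * C * (2 * n) powr (1 - 1 / r)) * N f \<le> ennreal b * N f"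
      by (intro mult_right_mono ennreal_leI; simp add: b_def)+
    then show ?thesis
      using principal_bound[OF f] principal_adjoint_bound[OF f] by (auto intro: order_trans)
  qed
  ultimately show ?thesis by blast
qed

text \<open>Each \<open>A i\<close> is symmetric: pairing \<open>u\<close> with \<open>A i v\<close>
  gives the sum over layer \<open>i\<close> of the products of the two averages weighted by
  measure.\<close>

lemma (in sparse_layers) principal_duality:
  assumes f: "nonneg_bdd f" and g: "nonneg_bdd g"
  shows "(\<integral>\<^sup>+x. ennreal (g x * (\<Sum>i<K. e i x * A i f x)) \<partial>lebesgue)
    = (\<integral>\<^sup>+x. ennreal (f x * (\<Sum>i<K. A i (\<lambda>y. e i y * g y) x)) \<partial>lebesgue)"
proof -
  have key: "(\<integral>\<^sup>+x. ennreal (u x * A i v x) \<partial>lebesgue) =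
      ennreal (\<Sum>Q\<in>L i. cube_avg u Q * cube_avg v Q * measure lebesgue Q)"
    if u: "nonneg_bdd u" and v: "nonneg_bdd v" for u v i
  proof -
    have v0: "0 \<le> cube_avg v Q" for Q using v by (intro cube_avg_nonneg nonneg_bdd_nonneg)
    have int: "integrable lebesgue (\<lambda>x. cube_avg v Q * (indicator Q x *\<^sub>R u x))" if "Q \<in> L i" for Q
      using set_integrable_nonneg_bdd[OF u lmeasurable_L[OF that]] by (auto simp: set_integrable_def)
    have eq: "u x * A i v x = (\<Sum>Q\<in>L i. cube_avg v Q * (indicator Q x *\<^sub>R u x))" for x
      unfolding A_def sum_distrib_left by (intro sum.cong) auto
    have "(\<integral>\<^sup>+x. ennreal (u x * A i v x) \<partial>lebesgue) = ennreal (\<integral>x. u x * A i v x \<partial>lebesgue)"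
    proof (rule nn_integral_eq_integral)
      show "integrable lebesgue (\<lambda>x. u x * A i v x)" unfolding eq using int by (intro Bochner_Integration.integrable_sum)
    qed (use nonneg_bdd_nonneg[OF u] nonneg_bdd_nonneg[OF nonneg_bdd_A[OF v]] in auto)
    also have "(\<integral>x. u x * A i v x \<partial>lebesgue) = (\<Sum>Q\<in>L i. cube_avg v Q * set_lebesgue_integral lebesgue Q u)"
      unfolding eq using int
      by (subst Bochner_Integration.integral_sum) (auto simp: set_lebesgue_integral_def)
    also have "\<dots> = (\<Sum>Q\<in>L i. cube_avg u Q * cube_avg v Q * measure lebesgue Q)"
      using cube_avg_mult_measure[of _ i u] by (intro sum.cong) (auto simp: ac_simps)
    finally show ?thesis .
  qed
  have eg: "nonneg_bdd (\<lambda>y. e i y * g y)" for i by (intro nonneg_bdd_mult nonneg_bdd_e g)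
  note [measurable] = nonneg_bdd_measurable[OF f] nonneg_bdd_measurable[OF g]
    nonneg_bdd_measurable[OF nonneg_bdd_A[OF f]] nonneg_bdd_measurable[OF nonneg_bdd_A[OF eg]]
    nonneg_bdd_measurable[OF nonneg_bdd_e]
  note nn = nonneg_bdd_nonneg[OF f] nonneg_bdd_nonneg[OF g] nonneg_bdd_nonneg[OF nonneg_bdd_A[OF f]]
    nonneg_bdd_nonneg[OF nonneg_bdd_A[OF eg]]
  have "(\<integral>\<^sup>+x. ennreal (g x * (\<Sum>i<K. e i x * A i f x)) \<partial>lebesgue) = (\<integral>\<^sup>+x. (\<Sum>i<K. ennreal (e i x * g x * A i f x)) \<partial>lebesgue)"
    using nn by (intro nn_integral_cong) (auto simp: sum_distrib_left ac_simps)
  also have "\<dots> = (\<Sum>i<K. \<integral>\<^sup>+x. ennreal (e i x * g x * A i f x) \<partial>lebesgue)"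
    by (intro nn_integral_sum) measurable
  also have "\<dots> = (\<Sum>i<K. \<integral>\<^sup>+x. ennreal (f x * A i (\<lambda>y. e i y * g y) x) \<partial>lebesgue)"
    unfolding key[OF eg f] key[OF f eg] by (simp add: ac_simps)
  also have "\<dots> = (\<integral>\<^sup>+x. (\<Sum>i<K. ennreal (f x * A i (\<lambda>y. e i y * g y) x)) \<partial>lebesgue)"
    by (intro nn_integral_sum[symmetric]) measurable
  also have "\<dots> = (\<integral>\<^sup>+x. ennreal (f x * (\<Sum>i<K. A i (\<lambda>y. e i y * g y) x)) \<partial>lebesgue)"
    using nn by (intro nn_integral_cong) (auto simp: sum_distrib_left)
  finally show ?thesis .
qed

text \<open>Factor \<open>6 ^ DIM('a)\<close> for replacing a rational cube by a grid box, factor 2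
  for comparison with principal cubes; one sparse family for each of the finitely many
  grids.\<close>

lemma ex_sparse_domination:
  fixes f :: "'a::euclidean_space \<Rightarrow> real"
  assumes f: "nonneg_bdd f"
  obtains L :: "'a set \<Rightarrow> nat \<Rightarrow> 'a set set" and K where "\<forall>S. sparse_layers (L S) (K S)" "\<forall>S i. \<forall>R\<in>L S i. open_rat_box R"
    "AE x in lebesgue. \<forall>Q\<in>first_cubes n. cube_avg f Q * indicator Q x \<le> 2 * 6 ^ DIM('a) *
      (\<Sum>S\<in>Pow Basis. \<Sum>p<K S. sparse_layers.e (L S) p x * sparse_layers.A (L S) p f x)"
proof -
  obtain D :: "'a set \<Rightarrow> 'a set set" where D: "\<And>S. finite (D S)" "\<And>S R. R \<in> D S \<Longrightarrow> open_rat_box R"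
    "\<And>S Q R. Q \<in> D S \<Longrightarrow> R \<in> D S \<Longrightarrow> Q \<subseteq> R \<or> R \<subseteq> Q \<or> Q \<inter> R = {}"
    "\<And>Q. Q \<in> first_cubes n \<Longrightarrow> \<exists>S\<subseteq>Basis. \<exists>R\<in>D S. Q \<subseteq> closure R \<and> measure lebesgue R \<le> 6 ^ DIM('a) * measure lebesgue Q"
    using laminar_cover[OF finite_first_cubes first_cubes_subset] by metis
  have lam: "laminar_family (D S) f" for S
    using D(1-3) f by unfold_locales (auto intro: lmeasurable_open_rat_box measure_open_rat_box_pos)
  define L where "L S = laminar_family.layer (D S) f" for S
  define K where "K S = Suc (card (D S))" for S
  have sl: "sparse_layers (L S) (K S)" for S
  proof -
    interpret laminar_family "D S" f by (rule lam)
    show ?thesis unfolding L_def K_def by (rule sparse_layers_axioms)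
  qed
  have boxes: "open_rat_box R" if "R \<in> L S i" for S i R
    using D(2) laminar_family.layer_D[OF lam] that unfolding L_def by blast
  define T where "T S x = (\<Sum>p<K S. sparse_layers.e (L S) p x * sparse_layers.A (L S) p f x)" for S x
  have T0: "0 \<le> T S x" for S x
  proof -
    interpret sparse_layers "L S" "K S" by (rule sl)
    show ?thesis unfolding T_def by (intro sum_nonneg mult_nonneg_nonneg nonneg_bdd_nonneg[OF nonneg_bdd_A[OF f]]) auto
  qed
  \<comment> \<open>A rational cube is only covered by the closure of a grid box, while the layers
    see the open box; the boundaries form a null set.\<close>
  define Z where "Z = (\<Union>S\<in>Pow Basis. \<Union>R\<in>D S. closure R - R)"
  have negl: "closure R - R \<in> null_sets lebesgue" if R: "R \<in> D S" for R S
  proof -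
    obtain c s where cs: "0 < s" "R = box c (c + s *\<^sub>R One)" using D(2)[OF R] by (auto simp: open_rat_box_def)
    have "closure R = cbox c (c + s *\<^sub>R One)"
      unfolding cs(2) by (rule closure_box[OF box_One_nonempty[OF cs(1)]])
    then show ?thesis
      using negligible_frontier_interval[of c "c + s *\<^sub>R One"] cs by (simp add: negligible_iff_null_sets)
  qed
  have "Z \<in> null_sets lebesgue"
    unfolding Z_def using D(1) negl by (intro null_sets.finite_UN) auto
  then have "AE x in lebesgue. x \<notin> Z" by (rule AE_not_in)
  then have "AE x in lebesgue. \<forall>Q\<in>first_cubes n. cube_avg f Q * indicator Q x \<le> 2 * 6 ^ DIM('a) * (\<Sum>S\<in>Pow Basis. T S x)"
  proof eventually_elim
    case (elim x)
    show ?case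
    proof
      fix Q :: "'a set" assume Q: "Q \<in> first_cubes n"
      show "cube_avg f Q * indicator Q x \<le> 2 * 6 ^ DIM('a) * (\<Sum>S\<in>Pow Basis. T S x)"
      proof (cases "x \<in> Q")
        case True
        have Qr: "Q \<in> rat_cubes" using Q first_cubes_subset[of n] by auto
        obtain S R where SR: "S \<subseteq> Basis" "R \<in> D S" "Q \<subseteq> closure R" "measure lebesgue R \<le> 6 ^ DIM('a) * measure lebesgue Q"
          using D(4)[OF Q] by blast
        have x: "x \<in> R" using elim True SR by (auto simp: Z_def)
        have Rpos: "0 < measure lebesgue R" by (rule measure_open_rat_box_pos[OF D(2)[OF SR(2)]])
        have f0: "0 \<le> f y" for y by (rule nonneg_bdd_nonneg[OF f])
        have "set_lebesgue_integral lebesgue Q f \<le> set_lebesgue_integral lebesgue R f"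
          unfolding set_lebesgue_integral_def
        proof (rule integral_mono_AE)
          show "AE y in lebesgue. indicator Q y *\<^sub>R f y \<le> indicator R y *\<^sub>R f y"
            using AE_not_in[OF negl[OF SR(2)]]
            by eventually_elim (use SR(3) f0 in \<open>auto simp: indicator_def\<close>)
        qed (use set_integrable_nonneg_bdd[OF f] rat_cube_measure(1)[OF Qr] lmeasurable_open_rat_box[OF D(2)[OF SR(2)]]
            in \<open>auto simp: set_integrable_def\<close>)
        then have "cube_avg f Q \<le> set_lebesgue_integral lebesgue R f / measure lebesgue Q"
          unfolding cube_avg_def by (intro divide_right_mono) auto
        also have "\<dots> \<le> set_lebesgue_integral lebesgue R f * (6 ^ DIM('a) / measure lebesgue R)"
        proof -
          have "1 / measure lebesgue Q \<le> 6 ^ DIM('a) / measure lebesgue R"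
            using SR(4) Rpos rat_cube_measure(3)[OF Qr] by (simp add: field_simps)
          moreover have "0 \<le> set_lebesgue_integral lebesgue R f"
            unfolding set_lebesgue_integral_def using f0 by (intro Bochner_Integration.integral_nonneg) auto
          ultimately have "set_lebesgue_integral lebesgue R f * (1 / measure lebesgue Q) \<le> set_lebesgue_integral lebesgue R f * (6 ^ DIM('a) / measure lebesgue R)"
            by (rule mult_left_mono)
          then show ?thesis by simp
        qed
        also have "\<dots> = 6 ^ DIM('a) * cube_avg f R" by (simp add: cube_avg_def)
        also have "\<dots> \<le> 6 ^ DIM('a) * (2 * T S x)"
        proof -
          interpret laminar_family "D S" f by (rule lam)
          show ?thesis using cube_avg_le_principal[OF SR(2) x] unfolding T_def L_def K_def by (intro mult_left_mono) auto
        qed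
        also have "\<dots> \<le> 6 ^ DIM('a) * (2 * (\<Sum>S\<in>Pow Basis. T S x))"
          using SR(1) T0 by (intro mult_left_mono member_le_sum[where f = "\<lambda>S. T S x"]) auto
        finally show ?thesis using True by simp
      next
        case False
        then show ?thesis using T0 by (simp add: sum_nonneg)
      qed
    qed
  qed
  then show ?thesis using sl boxes unfolding T_def by (intro that[of L K]) auto
qed

context fatou_norm
begin

lemma maximal_bounded_of_Mfam_bounded:
  assumes M: "Mfam_bounded N r" and r: "1 < r"
  shows "maximal_bounded N" "maximal_bounded (koethe_dual N)"
proof -
  obtain b where b: "0 < b" "\<And>L K f. sparse_layers L K \<Longrightarrow> \<forall>i. \<forall>R\<in>L i. open_rat_box R \<Longrightarrow> nonneg_bdd f \<Longrightarrow>
    N (\<lambda>x. \<Sum>p<K. sparse_layers.e L p x * sparse_layers.A L p f x) \<le> ennreal b * N f \<and>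
    N (\<lambda>x. \<Sum>i<K. sparse_layers.A L i (\<lambda>y. sparse_layers.e L i y * f y) x) \<le> ennreal b * N f"
    using ex_sparse_bound[OF M r] by meson
  \<comment> \<open>\<open>2 * 6 ^ DIM('a)\<close> from the domination, \<open>2 ^ DIM('a)\<close>
    for the number of grids, \<open>b\<close> for each sparse operator.\<close>
  define c where "c = 2 * 6 ^ DIM('a) * (2 ^ DIM('a) * b)"
  have cardP: "card (Pow (Basis :: 'a set)) = 2 ^ DIM('a)" by (simp add: card_Pow)
  have c: "0 < c" using b(1) by (simp add: c_def)
  have N_trunc: "N (trunc n f) \<le> N f" if "f \<in> borel_measurable lebesgue" for f n
    using that nonneg_bdd_measurable[OF nonneg_bdd_trunc[OF that]] trunc_le[of n f] trunc_nonneg[of n f]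
    by (intro N_mono_AE) (auto simp: abs_of_nonneg)
  have sum_c: "ennreal (2 * 6 ^ DIM('a)) * (\<Sum>S\<in>Pow (Basis :: 'a set). ennreal b * y) = ennreal c * y" for y
  proof -
    have "(\<Sum>S\<in>Pow (Basis :: 'a set). ennreal b * y) = ennreal (2 ^ DIM('a)) * (ennreal b * y)"
      by (simp add: cardP ennreal_power[symmetric])
    then show ?thesis using b(1) by (simp add: c_def ennreal_mult' mult.assoc)
  qed

  have maxN: "N (max_part n f) \<le> ennreal c * N f" if f: "f \<in> borel_measurable lebesgue" for f n
  proof -
    let ?f = "trunc n f"
    have fb: "nonneg_bdd ?f" by (rule nonneg_bdd_trunc[OF f])
    obtain L :: "'a set \<Rightarrow> nat \<Rightarrow> 'a set set" and K where sl_all: "\<forall>S. sparse_layers (L S) (K S)" and boxes_all: "\<forall>S i. \<forall>R\<in>L S i. open_rat_box R"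
      and dom: "AE x in lebesgue. \<forall>Q\<in>first_cubes n. cube_avg ?f Q * indicator Q x \<le> 2 * 6 ^ DIM('a) *
      (\<Sum>S\<in>Pow Basis. \<Sum>p<K S. sparse_layers.e (L S) p x * sparse_layers.A (L S) p ?f x)"
      by (rule ex_sparse_domination[OF fb, of n])
      have sl: "sparse_layers (L S) (K S)" for S using sl_all ..
      have boxes: "\<forall>i. \<forall>R\<in>L S i. open_rat_box R" for S using boxes_all by blast
    define T where "T S x = (\<Sum>p<K S. sparse_layers.e (L S) p x * sparse_layers.A (L S) p ?f x)" for S x
    have Tb: "nonneg_bdd (T S)" for S
    proof -
      interpret sparse_layers "L S" "K S" by (rule sl)
      show ?thesis unfolding T_def by (intro nonneg_bdd_sum nonneg_bdd_mult nonneg_bdd_e nonneg_bdd_A fb)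
    qed
    have Tm: "(\<lambda>x. \<Sum>S\<in>Pow Basis. T S x) \<in> borel_measurable lebesgue"
      by (intro borel_measurable_sum nonneg_bdd_measurable[OF Tb])
    have "N (max_part n f) \<le> N (\<lambda>x. 2 * 6 ^ DIM('a) * (\<Sum>S\<in>Pow Basis. T S x))"
    proof (rule N_mono_AE)
      show "AE x in lebesgue. \<bar>max_part n f x\<bar> \<le> \<bar>2 * 6 ^ DIM('a) * (\<Sum>S\<in>Pow Basis. T S x)\<bar>"
        using dom
      proof eventually_elim
        case (elim x)
        then have "max_part n f x \<le> 2 * 6 ^ DIM('a) * (\<Sum>S\<in>Pow Basis. T S x)"
          unfolding max_part_le_iff T_def .
        then show ?case using max_part_nonneg[of n f x] by linarith
      qed
    qed (use Tm borel_measurable_max_part in auto)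
    also have "\<dots> = ennreal (2 * 6 ^ DIM('a)) * N (\<lambda>x. \<Sum>S\<in>Pow Basis. T S x)"
      by (subst N_cmult[OF Tm]) simp
    also have "\<dots> \<le> ennreal (2 * 6 ^ DIM('a)) * (\<Sum>S\<in>Pow Basis. N (T S))"
      by (intro mult_left_mono N_sum nonneg_bdd_measurable[OF Tb]) auto
    also have "\<dots> \<le> ennreal (2 * 6 ^ DIM('a)) * (\<Sum>S\<in>Pow (Basis :: 'a set). ennreal b * N f)"
    proof (intro mult_left_mono sum_mono)
      fix S
      have "N (T S) \<le> ennreal b * N ?f"
        unfolding T_def using b(2)[OF sl boxes fb] by blast
      also have "\<dots> \<le> ennreal b * N f" by (intro mult_left_mono N_trunc f) auto
      finally show "N (T S) \<le> ennreal b * N f" .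
    qed auto
    finally show ?thesis unfolding sum_c .
  qed

  show "maximal_bounded N"
    unfolding maximal_bounded_def meas_def
  proof (intro exI[of _ c] allI impI)
    fix f assume f: "f \<in> borel_measurable lebesgue \<and> N f < \<infinity>"
    have fin: "ennreal c * N f < \<infinity>" using f by (simp add: ennreal_mult_less_top)
    show "(AE x in lebesgue. maximal f x < \<infinity>) \<and> (\<lambda>x. enn2real (maximal f x)) \<in> borel_measurable lebesgue \<and>
      N (\<lambda>x. enn2real (maximal f x)) \<le> ennreal c * N f"
      using N_SUP_le[where fs = "\<lambda>n. max_part n f", OF borel_measurable_max_part max_part_nonneg _ _ fin]
        max_part_mono[of f] maxN[of f] f borel_measurable_maximal[of f]
      unfolding maximal_eq_SUP_max_part[OF conjunct1[OF f]] by auto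
  qed

  \<comment> \<open>The operators \<open>T S\<close> are built from \<open>g\<close> but moved onto
    \<open>f\<close> by duality, so the adjoint bound in \<open>X\<close> applies and Hoelder's
    inequality finishes; no boundedness on the dual side is presupposed.\<close>
  have pair: "(\<integral>\<^sup>+x. ennreal \<bar>f x\<bar> * maximal g x \<partial>lebesgue) \<le> ennreal c * N f * koethe_dual N g"
    if f: "f \<in> borel_measurable lebesgue" "N f < \<infinity>" and g: "g \<in> borel_measurable lebesgue" for f g
  proof -
    have part: "(\<integral>\<^sup>+x. ennreal (trunc n f x * max_part n g x) \<partial>lebesgue) \<le> ennreal c * N f * koethe_dual N g" for n
    proof -
      let ?f = "trunc n f" and ?g = "trunc n g"
      have fb: "nonneg_bdd ?f" and gb: "nonneg_bdd ?g" by (intro nonneg_bdd_trunc f g)+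
      obtain L :: "'a set \<Rightarrow> nat \<Rightarrow> 'a set set" and K where sl_all: "\<forall>S. sparse_layers (L S) (K S)" and boxes_all: "\<forall>S i. \<forall>R\<in>L S i. open_rat_box R"
        and dom: "AE x in lebesgue. \<forall>Q\<in>first_cubes n. cube_avg ?g Q * indicator Q x \<le> 2 * 6 ^ DIM('a) *
        (\<Sum>S\<in>Pow Basis. \<Sum>p<K S. sparse_layers.e (L S) p x * sparse_layers.A (L S) p ?g x)"
        by (rule ex_sparse_domination[OF gb, of n])
      have sl: "sparse_layers (L S) (K S)" for S using sl_all ..
      have boxes: "\<forall>i. \<forall>R\<in>L S i. open_rat_box R" for S using boxes_all by blast
      define T where "T S x = (\<Sum>p<K S. sparse_layers.e (L S) p x * sparse_layers.A (L S) p ?g x)" for S x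
      define T' where "T' S x = (\<Sum>i<K S. sparse_layers.A (L S) i (\<lambda>y. sparse_layers.e (L S) i y * ?f y) x)" for S x
      have Tb: "nonneg_bdd (T S)" and T'b: "nonneg_bdd (T' S)"
        and dual: "(\<integral>\<^sup>+x. ennreal (?f x * T S x) \<partial>lebesgue) = (\<integral>\<^sup>+x. ennreal (?g x * T' S x) \<partial>lebesgue)" for S
      proof -
        interpret sparse_layers "L S" "K S" by (rule sl)
        show "nonneg_bdd (T S)" unfolding T_def by (intro nonneg_bdd_sum nonneg_bdd_mult nonneg_bdd_e nonneg_bdd_A gb)
        show "nonneg_bdd (T' S)" unfolding T'_def by (intro nonneg_bdd_sum nonneg_bdd_mult nonneg_bdd_e nonneg_bdd_A fb)
        show "(\<integral>\<^sup>+x. ennreal (?f x * T S x) \<partial>lebesgue) = (\<integral>\<^sup>+x. ennreal (?g x * T' S x) \<partial>lebesgue)"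
          unfolding T_def T'_def by (rule principal_duality[OF gb fb])
      qed
      note [measurable] = nonneg_bdd_measurable[OF fb] nonneg_bdd_measurable[OF Tb]
      have "(\<integral>\<^sup>+x. ennreal (?f x * max_part n g x) \<partial>lebesgue)
          \<le> (\<integral>\<^sup>+x. ennreal (2 * 6 ^ DIM('a)) * (\<Sum>S\<in>Pow Basis. ennreal (?f x * T S x)) \<partial>lebesgue)"
      proof (rule nn_integral_mono_AE)
        show "AE x in lebesgue. ennreal (?f x * max_part n g x) \<le> ennreal (2 * 6 ^ DIM('a)) * (\<Sum>S\<in>Pow Basis. ennreal (?f x * T S x))"
          using dom
        proof eventually_elim
          case (elim x)
          then have "max_part n g x \<le> 2 * 6 ^ DIM('a) * (\<Sum>S\<in>Pow Basis. T S x)"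
            unfolding max_part_le_iff T_def .
          then have "?f x * max_part n g x \<le> ?f x * (2 * 6 ^ DIM('a) * (\<Sum>S\<in>Pow Basis. T S x))"
            by (intro mult_left_mono trunc_nonneg)
          also have "\<dots> = 2 * 6 ^ DIM('a) * (\<Sum>S\<in>Pow Basis. ?f x * T S x)"
            by (simp add: sum_distrib_left mult.left_commute)
          finally have "ennreal (?f x * max_part n g x) \<le> ennreal (2 * 6 ^ DIM('a) * (\<Sum>S\<in>Pow Basis. ?f x * T S x))"
            by (rule ennreal_leI)
          also have "\<dots> = ennreal (2 * 6 ^ DIM('a)) * (\<Sum>S\<in>Pow Basis. ennreal (?f x * T S x))"
            using nonneg_bdd_nonneg[OF Tb] trunc_nonneg[of n f] by (subst ennreal_mult) (auto intro!: sum_nonneg)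
          finally show ?case .
        qed
      qed
      also have "\<dots> = ennreal (2 * 6 ^ DIM('a)) * (\<Sum>S\<in>Pow Basis. \<integral>\<^sup>+x. ennreal (?f x * T S x) \<partial>lebesgue)"
        by (subst nn_integral_cmult) (auto simp: nn_integral_sum)
      also have "\<dots> \<le> ennreal (2 * 6 ^ DIM('a)) * (\<Sum>S\<in>Pow (Basis :: 'a set). ennreal b * (N f * koethe_dual N g))"
      proof (intro mult_left_mono sum_mono)
        fix S
        have NT: "N (T' S) \<le> ennreal b * N f"
        proof -
          have "N (T' S) \<le> ennreal b * N ?f"
            unfolding T'_def using b(2)[OF sl boxes fb] by blast
          also have "\<dots> \<le> ennreal b * N f" by (intro mult_left_mono N_trunc f) auto
          finally show ?thesis .
        qed
        have "ennreal b * N f < \<infinity>" using f by (simp add: ennreal_mult_less_top)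
        then have fin: "N (T' S) < \<infinity>" using NT by (rule le_less_trans[rotated])
        have "(\<integral>\<^sup>+x. ennreal (?f x * T S x) \<partial>lebesgue) \<le> (\<integral>\<^sup>+x. ennreal \<bar>T' S x * g x\<bar> \<partial>lebesgue)"
          unfolding dual
        proof (intro nn_integral_mono ennreal_leI)
          fix x
          have "?g x * T' S x \<le> \<bar>g x\<bar> * T' S x"
            using nonneg_bdd_nonneg[OF T'b] by (intro mult_right_mono trunc_le) auto
          then show "?g x * T' S x \<le> \<bar>T' S x * g x\<bar>"
            using nonneg_bdd_nonneg[OF T'b, of S x] by (simp add: abs_mult mult.commute)
        qed
        also have "\<dots> \<le> N (T' S) * koethe_dual N g"
          by (rule koethe_dual_Hoelder[OF nonneg_bdd_measurable[OF T'b] fin g])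
        also have "\<dots> \<le> ennreal b * (N f * koethe_dual N g)"
          using NT by (simp add: mult.assoc[symmetric] mult_right_mono)
        finally show "(\<integral>\<^sup>+x. ennreal (?f x * T S x) \<partial>lebesgue) \<le> ennreal b * (N f * koethe_dual N g)" .
      qed auto
      finally show ?thesis unfolding sum_c by (simp add: mult.assoc)
    qed
    have "(\<integral>\<^sup>+x. ennreal \<bar>f x\<bar> * maximal g x \<partial>lebesgue) \<le> (\<integral>\<^sup>+x. (SUP n. ennreal (trunc n f x * max_part n g x)) \<partial>lebesgue)"
    proof (rule nn_integral_mono)
      fix x
      have mm: "max_part i g x \<le> max_part j g x" if "i \<le> j" for i j
        using lift_Suc_mono_le[of "\<lambda>n. max_part n g x", OF max_part_mono[OF g] that] .
      \<comment> \<open>Two independent suprema; both sequences increase, so the diagonal already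
        attains the double supremum.\<close>
      have "ennreal \<bar>f x\<bar> * maximal g x = (SUP n. SUP m. ennreal (trunc m f x) * ennreal (max_part n g x))"
        unfolding maximal_eq_SUP_max_part[OF g] SUP_trunc[symmetric]
        by (simp add: SUP_mult_left_ennreal SUP_mult_right_ennreal)
      also have "\<dots> \<le> (SUP n. ennreal (trunc n f x * max_part n g x))"
      proof (intro SUP_least)
        fix n m
        have "ennreal (trunc m f x) * ennreal (max_part n g x) = ennreal (trunc m f x * max_part n g x)"
          using trunc_nonneg max_part_nonneg by (intro ennreal_mult[symmetric])
        also have "\<dots> \<le> ennreal (trunc (max m n) f x * max_part (max m n) g x)"
          using trunc_nonneg max_part_nonneg by (intro ennreal_leI mult_mono trunc_mono mm) auto
        also have "\<dots> \<le> (SUP n. ennreal (trunc n f x * max_part n g x))" by (intro SUP_upper) auto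
        finally show "ennreal (trunc m f x) * ennreal (max_part n g x) \<le> \<dots>" .
      qed
      finally show "ennreal \<bar>f x\<bar> * maximal g x \<le> (SUP n. ennreal (trunc n f x * max_part n g x))" .
    qed
    also have "\<dots> = (SUP n. \<integral>\<^sup>+x. ennreal (trunc n f x * max_part n g x) \<partial>lebesgue)"
    proof (rule nn_integral_monotone_convergence_SUP)
      show "incseq (\<lambda>n x. ennreal (trunc n f x * max_part n g x))"
        using trunc_nonneg max_part_nonneg max_part_mono[OF g]
        by (intro incseq_SucI le_funI ennreal_leI mult_mono trunc_mono) auto
      show "(\<lambda>x. ennreal (trunc n f x * max_part n g x)) \<in> borel_measurable lebesgue" for n
        using nonneg_bdd_measurable[OF nonneg_bdd_trunc[OF f(1)]] borel_measurable_max_part[of n g] by measurable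
    qed
    also have "\<dots> \<le> ennreal c * N f * koethe_dual N g" by (intro SUP_least part)
    finally show ?thesis .
  qed

  show "maximal_bounded (koethe_dual N)"
    unfolding maximal_bounded_def meas_def
  proof (intro exI[of _ c] allI impI conjI)
    fix g assume g: "g \<in> borel_measurable lebesgue \<and> koethe_dual N g < \<infinity>"
    then have gm: "g \<in> borel_measurable lebesgue" by simp
    have Mm: "maximal g \<in> borel_measurable lebesgue" by (rule borel_measurable_maximal[OF gm])
    then show "(\<lambda>x. enn2real (maximal g x)) \<in> borel_measurable lebesgue" by measurable
    let ?S = "{x. maximal g x = \<infinity>}"
    have S: "?S \<in> sets lebesgue" using measurable_sets[OF Mm, of "{\<infinity>}"] by (simp add: vimage_def)
    \<comment> \<open>If the maximal function were infinite on a set of positive measure, pairing it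
      with the indicator of a subset of finite norm would contradict \<open>pair\<close>.\<close>
    have "emeasure lebesgue ?S = 0"
    proof (rule ccontr)
      assume "emeasure lebesgue ?S \<noteq> 0"
      then have "0 < emeasure lebesgue ?S" by (simp add: zero_less_iff_neq_zero)
      then obtain F where F: "F \<in> sets lebesgue" "F \<subseteq> ?S" "0 < emeasure lebesgue F" "N (indicator F) < \<infinity>"
        using N_saturated[OF S] by blast
      have "(\<integral>\<^sup>+x. ennreal \<bar>indicator F x\<bar> * maximal g x \<partial>lebesgue) = (\<integral>\<^sup>+x. \<infinity> * indicator F x \<partial>lebesgue)"
        using F(2) by (intro nn_integral_cong) (auto simp: indicator_def)
      also have "\<dots> = \<infinity> * emeasure lebesgue F" by (rule nn_integral_cmult_indicator[OF F(1)])
      also have "\<dots> = \<infinity>"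
      proof -
        have "emeasure lebesgue F \<noteq> 0" using F(3) by (metis less_irrefl)
        then show ?thesis by (simp only: infinity_ennreal_def ennreal_top_mult if_False)
      qed
      finally have "\<infinity> \<le> ennreal c * N (indicator F) * koethe_dual N g"
        using pair[OF borel_measurable_indicator[OF F(1)] F(4) gm] by simp
      moreover have "ennreal c * N (indicator F) * koethe_dual N g < \<infinity>"
        using F(4) g by (simp add: ennreal_mult_less_top)
      ultimately show False by simp
    qed
    then have "?S \<in> null_sets lebesgue" using S by auto
    from AE_not_in[OF this] show "AE x in lebesgue. maximal g x < \<infinity>"
      by eventually_elim (simp add: less_top)
    show "koethe_dual N (\<lambda>x. enn2real (maximal g x)) \<le> ennreal c * koethe_dual N g"
      unfolding koethe_dual_def[of N "\<lambda>x. enn2real (maximal g x)"] meas_def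
    proof (rule SUP_least)
      fix f assume "f \<in> {f. f \<in> borel_measurable lebesgue \<and> N f = 1}"
      then have f: "f \<in> borel_measurable lebesgue" "N f = 1" by auto
      have "(\<integral>\<^sup>+x. ennreal \<bar>f x * enn2real (maximal g x)\<bar> \<partial>lebesgue) \<le> (\<integral>\<^sup>+x. ennreal \<bar>f x\<bar> * maximal g x \<partial>lebesgue)"
      proof (rule nn_integral_mono)
        fix x
        have "ennreal \<bar>f x * enn2real (maximal g x)\<bar> = ennreal \<bar>f x\<bar> * ennreal (enn2real (maximal g x))"
          by (simp add: abs_mult ennreal_mult)
        also have "\<dots> \<le> ennreal \<bar>f x\<bar> * maximal g x"
          by (cases "maximal g x") (auto intro!: mult_left_mono)
        finally show "ennreal \<bar>f x * enn2real (maximal g x)\<bar> \<le> ennreal \<bar>f x\<bar> * maximal g x" .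
      qed
      also have "\<dots> \<le> ennreal c * koethe_dual N g" using pair[OF f(1) _ gm] f(2) by simp
      finally show "(\<integral>\<^sup>+x. ennreal \<bar>f x * enn2real (maximal g x)\<bar> \<partial>lebesgue) \<le> ennreal c * koethe_dual N g" .
    qed
  qed
qed

end

section \<open>From the maximal operator to the averaging operator\<close>

text \<open>Young's inequality for \<open>v = u / (c * S)\<close> and 1 with exponents
  \<open>r\<close> and \<open>r / (r - 1)\<close>, with equality at \<open>u = c * S\<close>. The
  right side is linear in \<open>S\<close> and in the term \<open>u powr r * S powr (1 - r)\<close>,
  so it can be averaged over a cube.\<close>

lemma tangent_power_inequality:
  fixes G S c r u :: real
  assumes "1 < r" "0 < c" "0 \<le> u" "0 \<le> S" "u = 0 \<or> S \<noteq> 0"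
  shows "r * u \<le> c powr (1 - r) * (if S = 0 then 0 else u powr r * S powr (1 - r)) + (r - 1) * c * S"
proof (cases "S = 0")
  case True
  then show ?thesis using assms by simp
next
  case False
  then have S: "0 < S" using assms by simp
  define v where "v = u / (c * S)"
  have v: "0 \<le> v" "u = v * (c * S)" using assms S by (auto simp: v_def)
  have "v * 1 \<le> v powr r / r + 1 powr (r / (r - 1)) / (r / (r - 1))"
    using assms v by (intro Youngs_inequality) (auto simp: field_simps)
  then have "v \<le> v powr r / r + (r - 1) / r"
    by simp
  then have "r * v \<le> r * (v powr r / r + (r - 1) / r)"
    using assms by (intro mult_left_mono) auto
  also have "\<dots> = v powr r + (r - 1)"
    using assms by (simp add: distrib_left)
  finally have "r * v \<le> v powr r + (r - 1)" .
  then have "r * v * (c * S) \<le> (v powr r + (r - 1)) * (c * S)"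
    using assms S by (intro mult_right_mono) auto
  moreover have "c powr (1 - r) * (u powr r * S powr (1 - r)) = v powr r * (c * S)"
  proof -
    have "u powr r = v powr r * (c powr r * S powr r)"
      unfolding v(2) using assms S v by (simp add: powr_mult)
    then have "c powr (1 - r) * (u powr r * S powr (1 - r)) = v powr r * (c powr (1 - r) * c powr r) * (S powr (1 - r) * S powr r)"
      by simp
    also have "\<dots> = v powr r * (c * S)"
      using assms S by (simp flip: powr_add)
    finally show ?thesis .
  qed
  ultimately show ?thesis using False v(2) by (simp add: algebra_simps)
qed

text \<open>Optimizing \<open>c\<close> in the averaged tangent inequality gives the Jensen bound
  \<open>\<langle>F\<rangle>\<^sup>r \<le> \<langle>S\<rangle>\<^bsup>r - 1\<^esup> \<langle>G\<rangle>\<close>.\<close>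

lemma optimize_tangent:
  fixes a s g r :: real
  assumes r: "1 < r" and nonneg: "0 \<le> a" "a \<le> s" "0 \<le> g"
    and le: "\<And>c. 0 < c \<Longrightarrow> r * a \<le> c powr (1 - r) * g + (r - 1) * c * s"
  shows "a powr r \<le> s powr (r - 1) * g"
proof (cases "a = 0")
  case False
  then have a: "0 < a" and s: "0 < s" using nonneg by auto
  define c where "c = a / s"
  have c: "0 < c" "c * s = a" using a s by (auto simp: c_def)
  have "r * a \<le> c powr (1 - r) * g + (r - 1) * (c * s)" using le[OF c(1)] by (simp add: mult.assoc)
  then have "a \<le> c powr (1 - r) * g" unfolding c(2) by (simp add: algebra_simps)
  then have "a * c powr (r - 1) \<le> c powr (1 - r) * g * c powr (r - 1)"
    by (intro mult_right_mono) auto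
  also have "\<dots> = g * (c powr (1 - r) * c powr (r - 1))" by simp
  also have "\<dots> = g" using c by (simp flip: powr_add)
  finally have "a * c powr (r - 1) * s powr (r - 1) \<le> g * s powr (r - 1)"
    by (intro mult_right_mono) auto
  moreover have "a * c powr (r - 1) * s powr (r - 1) = a powr r"
  proof -
    have "c powr (r - 1) * s powr (r - 1) = a powr (r - 1)"
      using c s by (simp flip: powr_mult)
    then have "a * c powr (r - 1) * s powr (r - 1) = a powr 1 * a powr (r - 1)"
      using a by (simp add: mult.assoc)
    also have "\<dots> = a powr (1 + (r - 1))" by (rule powr_add[symmetric])
    finally show ?thesis by simp
  qed
  ultimately show ?thesis by (simp add: mult.commute)
qed (use r nonneg in auto)

context fatou_norm
begin

lemma Mfam_bounded_of_maximal_bounded: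
  assumes M: "maximal_bounded N" and M': "maximal_bounded (koethe_dual N)" and r: "1 < r"
  shows "Mfam_bounded N r"
proof -
  obtain C1 where C1: "\<And>f. f \<in> borel_measurable lebesgue \<Longrightarrow> N f < \<infinity> \<Longrightarrow> (AE x in lebesgue. maximal f x < \<infinity>) \<and>
      (\<lambda>x. enn2real (maximal f x)) \<in> borel_measurable lebesgue \<and> N (\<lambda>x. enn2real (maximal f x)) \<le> ennreal C1 * N f"
    using M unfolding maximal_bounded_def meas_def by blast
  obtain C2 where C2: "\<And>g. g \<in> borel_measurable lebesgue \<Longrightarrow> koethe_dual N g < \<infinity> \<Longrightarrow> (AE x in lebesgue. maximal g x < \<infinity>) \<and>
      (\<lambda>x. enn2real (maximal g x)) \<in> borel_measurable lebesgue \<and> koethe_dual N (\<lambda>x. enn2real (maximal g x)) \<le> ennreal C2 * koethe_dual N g"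
    using M' unfolding maximal_bounded_def meas_def by blast
  \<comment> \<open>\<open>C1\<close> and \<open>C2\<close> may be negative, and
    \<open>ennreal\<close> sends negative numbers to 0; with \<open>max 0\<close> the two constants
    can be added.\<close>
  define C where "C = max 0 C1 + max 0 C2"
  have r0: "0 < r" using r by simp
  have main: "(\<forall>Q\<in>rat_cubes. set_integrable lebesgue Q (F Q)) \<and> Xlr_norm N r (Mfam F) \<le> ennreal C * Xlr_norm N r F"
    if X: "Xlr_norm N r F < \<infinity>" for F
  proof -
    have Fm: "F Q \<in> borel_measurable lebesgue" if "Q \<in> rat_cubes" for Q
      using X that unfolding Xlr_norm_def meas_def by (auto split: if_splits)
    have lr_fin: "AE x in lebesgue. lr_norm r F x < \<infinity>"
      using X unfolding Xlr_norm_def by (auto split: if_splits)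
    define S where "S x = enn2real (lr_norm r F x)" for x
    have XS: "Xlr_norm N r F = N S"
      using Fm lr_fin unfolding Xlr_norm_def meas_def S_def by auto
    have NS: "N S < \<infinity>" using X XS by simp
    have Sm: "S \<in> borel_measurable lebesgue"
      unfolding S_def using borel_measurable_lr_norm[OF Fm r0] by measurable
    have S0: "0 \<le> S x" for x by (simp add: S_def)
    have part_le: "AE x in lebesgue. \<forall>n. (\<Sum>Q\<in>first_cubes n. \<bar>F Q x\<bar> powr r) \<le> S x powr r"
      using lr_fin
    proof eventually_elim
      case (elim x)
      show ?case
      proof
        fix n
        have "ennreal (lr_part r F n x) \<le> lr_norm r F x"
          unfolding lr_norm_eq_SUP[OF r0] by (intro SUP_upper) auto
        then have "lr_part r F n x \<le> S x"
          unfolding S_def using elim lr_part_nonneg[of r F n x]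
          by (metis enn2real_ennreal enn2real_mono infinity_ennreal_def)
        then have "lr_part r F n x powr r \<le> S x powr r" using r0 by (intro powr_mono2 lr_part_nonneg) auto
        then show "(\<Sum>Q\<in>first_cubes n. \<bar>F Q x\<bar> powr r) \<le> S x powr r"
          unfolding lr_part_def using r0 by (simp add: powr_powr sum_nonneg)
      qed
    qed
    have F_le: "AE x in lebesgue. \<bar>F Q x\<bar> \<le> S x" if Q: "Q \<in> rat_cubes" for Q
    proof -
      obtain n where n: "Q \<in> first_cubes n" using ex_first_cubes[OF Q] by blast
      show ?thesis using part_le
      proof eventually_elim
        case (elim x)
        have "\<bar>F Q x\<bar> powr r \<le> (\<Sum>Q\<in>first_cubes n. \<bar>F Q x\<bar> powr r)"
          using n finite_first_cubes by (intro member_le_sum[where f = "\<lambda>Q. \<bar>F Q x\<bar> powr r"]) auto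
        also have "\<dots> \<le> S x powr r" using elim by blast
        finally have "(\<bar>F Q x\<bar> powr r) powr (1 / r) \<le> (S x powr r) powr (1 / r)"
          using r0 by (intro powr_mono2[of "1 / r"]) auto
        then show ?case
          using powr_inverse_self[OF abs_ge_zero r0, of "F Q x"] powr_inverse_self[OF S0 r0, of x] by linarith
      qed
    qed
    note MS = C1[OF Sm NS]
    define Q\<^sub>S where "Q\<^sub>S = (\<lambda>x. enn2real (maximal S x))"
    have QSm: "Q\<^sub>S \<in> borel_measurable lebesgue" using MS by (simp add: Q\<^sub>S_def)
    \<comment> \<open>A cube has positive measure, so it contains a point where the maximal function
      of \<open>S\<close> is finite, and that value bounds the average over the cube. The other
      integrability claims follow by domination by \<open>S\<close>.\<close>
    have S_int: "set_integrable lebesgue Q S" if Q: "Q \<in> rat_cubes" for Q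
    proof -
      have "\<exists>x\<in>Q. maximal S x < \<infinity>"
      proof (rule ccontr)
        assume "\<not> ?thesis"
        then have "AE x in lebesgue. x \<notin> Q" using MS by (auto elim!: eventually_mono)
        then have "Q \<in> null_sets lebesgue" using AE_iff_null_sets[OF rat_cube_measure(2)[OF Q]] by simp
        then have "measure lebesgue Q = 0" by (simp add: measure_eq_0_null_sets)
        then show False using rat_cube_measure(3)[OF Q] by simp
      qed
      then obtain x where x: "x \<in> Q" "maximal S x < \<infinity>" by blast
      have "eavg S Q = eavg S Q * indicator Q x" using x by simp
      also have "\<dots> \<le> maximal S x" unfolding maximal_eq_SUP_rat_cubes by (intro SUP_upper Q)
      finally have "eavg S Q < \<infinity>" using x(2) by simp
      then have "(\<integral>\<^sup>+ y\<in>Q. ennreal \<bar>S y\<bar> \<partial>lebesgue) < \<infinity>"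
        unfolding eavg_def rat_cube_measure(4)[OF Q] using rat_cube_measure(3)[OF Q]
        by (simp add: ennreal_divide_eq_top_iff less_top[symmetric])
      moreover have "(\<integral>\<^sup>+ y\<in>Q. ennreal \<bar>S y\<bar> \<partial>lebesgue) = (\<integral>\<^sup>+ y. ennreal (norm (indicator Q y *\<^sub>R S y)) \<partial>lebesgue)"
        by (intro nn_integral_cong) (auto simp: indicator_def)
      ultimately show ?thesis
        unfolding set_integrable_def using Sm rat_cube_measure(2)[OF Q]
        by (intro integrableI_bounded) auto
    qed
    have dom_int: "set_integrable lebesgue Q v"
      if Q: "Q \<in> rat_cubes" and v: "v \<in> borel_measurable lebesgue" "AE x in lebesgue. \<bar>v x\<bar> \<le> S x" for Q v
      unfolding set_integrable_def
    proof (rule Bochner_Integration.integrable_bound)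
      show "integrable lebesgue (\<lambda>x. indicator Q x *\<^sub>R S x)" using S_int[OF Q] by (simp add: set_integrable_def)
      show "(\<lambda>x. indicat_real Q x *\<^sub>R v x) \<in> borel_measurable lebesgue"
        using v(1) rat_cube_measure(2)[OF Q] by auto
      show "AE x in lebesgue. norm (indicat_real Q x *\<^sub>R v x) \<le> norm (indicator Q x *\<^sub>R S x)"
        using v(2) by eventually_elim (auto simp: indicator_def)
    qed
    \<comment> \<open>\<open>G\<close> distributes \<open>S\<close> over the cubes in proportion to
      \<open>\<bar>F Q x\<bar> powr r\<close>, which turns an \<open>\<ell>\<^sup>r\<close> family
      into an \<open>\<ell>\<^sup>1\<close> family with sum at most \<open>S\<close>. Where
      \<open>S\<close> vanishes, each \<open>F Q\<close> vanishes almost everywhere.\<close>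
    define G where "G Q x = (if S x = 0 then 0 else \<bar>F Q x\<bar> powr r * S x powr (1 - r))" for Q x
    have G0: "0 \<le> G Q x" for Q x by (simp add: G_def)
    have Gm: "G Q \<in> borel_measurable lebesgue" if "Q \<in> rat_cubes" for Q
      unfolding G_def using Fm[OF that] Sm by measurable
    have G_sum: "AE x in lebesgue. \<forall>n. (\<Sum>Q\<in>first_cubes n. G Q x) \<le> S x"
      using part_le
    proof eventually_elim
      case (elim x)
      show ?case
      proof
        fix n
        show "(\<Sum>Q\<in>first_cubes n. G Q x) \<le> S x"
        proof (cases "S x = 0")
          case False
          then have Sx: "0 < S x" using S0[of x] by simp
          have "(\<Sum>Q\<in>first_cubes n. G Q x) = (\<Sum>Q\<in>first_cubes n. \<bar>F Q x\<bar> powr r) * S x powr (1 - r)"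
            using False by (simp add: G_def sum_distrib_right)
          also have "\<dots> \<le> S x powr r * S x powr (1 - r)"
            using elim by (intro mult_right_mono) auto
          also have "\<dots> = S x" using Sx by (simp flip: powr_add)
          finally show ?thesis .
        qed (simp add: G_def)
      qed
    qed
    have G_le: "AE x in lebesgue. \<bar>G Q x\<bar> \<le> S x" if Q: "Q \<in> rat_cubes" for Q
    proof -
      obtain n where n: "Q \<in> first_cubes n" using ex_first_cubes[OF Q] by blast
      show ?thesis using G_sum
      proof eventually_elim
        case (elim x)
        have "G Q x \<le> (\<Sum>Q\<in>first_cubes n. G Q x)"
          using n finite_first_cubes G0 by (intro member_le_sum[where f = "\<lambda>Q. G Q x"]) auto
        also have "\<dots> \<le> S x" using elim by blast
        finally show ?case using G0 by simp
      qed
    qed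
    have avg_le: "cube_avg u Q \<le> cube_avg v Q"
      if "Q \<in> rat_cubes" "set_integrable lebesgue Q u" "set_integrable lebesgue Q v" "AE x in lebesgue. u x \<le> v x" for Q u v
      unfolding cube_avg_def set_lebesgue_integral_def
    proof (intro divide_right_mono integral_mono_AE)
      show "AE x in lebesgue. indicat_real Q x *\<^sub>R u x \<le> indicat_real Q x *\<^sub>R v x"
        using that(4) by eventually_elim (auto simp: indicator_def)
    qed (use that in \<open>auto simp: set_integrable_def\<close>)
    have jensen: "\<bar>cube_avg (F Q) Q\<bar> powr r \<le> cube_avg S Q powr (r - 1) * cube_avg (G Q) Q" if Q: "Q \<in> rat_cubes" for Q
    proof -
      let ?a = "cube_avg (\<lambda>x. \<bar>F Q x\<bar>) Q"
      have Fi: "set_integrable lebesgue Q (\<lambda>x. \<bar>F Q x\<bar>)" using Fm[OF Q] F_le[OF Q] by (intro dom_int Q) auto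
      have Gi: "set_integrable lebesgue Q (G Q)" by (intro dom_int Q Gm G_le)
      have a0: "0 \<le> ?a" by (rule cube_avg_nonneg) simp
      have "?a powr r \<le> cube_avg S Q powr (r - 1) * cube_avg (G Q) Q"
      proof (rule optimize_tangent[OF r a0])
        show "?a \<le> cube_avg S Q" by (intro avg_le Q Fi S_int F_le)
        show "0 \<le> cube_avg (G Q) Q" by (intro cube_avg_nonneg G0)
        fix c :: real assume c: "0 < c"
        have "r * ?a = cube_avg (\<lambda>x. r * \<bar>F Q x\<bar>) Q" by (simp add: cube_avg_cmult)
        also have "\<dots> \<le> cube_avg (\<lambda>x. c powr (1 - r) * G Q x + (r - 1) * c * S x) Q"
        proof (intro avg_le Q set_integral_add(1) set_integrable_mult_right)
          show "AE x in lebesgue. r * \<bar>F Q x\<bar> \<le> c powr (1 - r) * G Q x + (r - 1) * c * S x"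
            using F_le[OF Q]
          proof eventually_elim
            case (elim x)
            show ?case unfolding G_def
              by (intro tangent_power_inequality r c) (use elim S0[of x] in auto)
          qed
        qed (use Fi Gi S_int[OF Q] in auto)
        also have "\<dots> = c powr (1 - r) * cube_avg (G Q) Q + (r - 1) * c * cube_avg S Q"
          using Gi S_int[OF Q] unfolding cube_avg_def
          by (subst set_integral_add) (auto simp: add_divide_distrib)
        finally show "r * ?a \<le> c powr (1 - r) * cube_avg (G Q) Q + (r - 1) * c * cube_avg S Q" .
      qed
      moreover have "\<bar>cube_avg (F Q) Q\<bar> \<le> ?a"
      proof -
        have "\<bar>set_lebesgue_integral lebesgue Q (F Q)\<bar> \<le> set_lebesgue_integral lebesgue Q (\<lambda>x. \<bar>F Q x\<bar>)"
          unfolding set_lebesgue_integral_def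
          using integral_abs_bound[of lebesgue "\<lambda>x. indicator Q x *\<^sub>R F Q x"] by (simp add: abs_mult)
        then show ?thesis unfolding cube_avg_def by (simp add: divide_right_mono)
      qed
      ultimately show ?thesis using r0 powr_mono2[of r "\<bar>cube_avg (F Q) Q\<bar>" ?a] by (auto intro: order_trans)
    qed
    define H where "H n x = (\<Sum>Q\<in>first_cubes n. cube_avg (G Q) Q * indicator Q x)" for n x
    have avgG0: "0 \<le> cube_avg (G Q) Q" for Q by (intro cube_avg_nonneg G0)
    have H0: "0 \<le> H n x" for n x unfolding H_def using avgG0 by (intro sum_nonneg) auto
    have first: "Q \<in> rat_cubes" if "Q \<in> first_cubes n" for Q n using that first_cubes_subset[of n] by auto
    have Hm: "H n \<in> borel_measurable lebesgue" for n
      unfolding H_def using rat_cube_measure(2)[OF first]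
      by (intro borel_measurable_sum borel_measurable_times borel_measurable_indicator) auto
    have NH: "N (H n) \<le> ennreal (max 0 C2) * N S" for n
    proof -
      obtain s where s: "N S = ennreal s" "0 \<le> s" using NS by (cases "N S") auto
      have "N (H n) \<le> ennreal (max 0 C2 * s)"
      proof (rule N_le_by_duality[OF Hm H0])
        show "0 \<le> max 0 C2 * s" using s by simp
        fix g assume g: "g \<in> borel_measurable lebesgue" "\<And>x. 0 \<le> g x" "koethe_dual N g \<le> 1"
        have gfin: "koethe_dual N g < \<infinity>" using g(3) by (rule le_less_trans) simp
        note Mg = C2[OF g(1) gfin]
        have Mgm: "maximal g \<in> borel_measurable lebesgue" by (rule borel_measurable_maximal[OF g(1)])
        \<comment> \<open>The average passes from \<open>G Q\<close> to \<open>g\<close> by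
          symmetry, and the average of \<open>g\<close> over \<open>Q\<close> is at most the maximal
          function of \<open>g\<close> on \<open>Q\<close>; after that the sum over cubes only sees
          the sum of the \<open>G Q\<close>, which is at most \<open>S\<close>.\<close>
        have one_cube: "(\<integral>\<^sup>+x. ennreal (cube_avg (G Q) Q * indicator Q x * g x) \<partial>lebesgue)
            \<le> (\<integral>\<^sup>+x. ennreal (G Q x) * maximal g x \<partial>lebesgue)" if Q: "Q \<in> rat_cubes" for Q
        proof -
          let ?m = "emeasure lebesgue Q"
          have GQ: "ennreal (cube_avg (G Q) Q) = eavg (G Q) Q"
            by (rule eavg_eq_cube_avg[OF dom_int[OF Q Gm[OF Q] G_le[OF Q]] G0 Q, symmetric])
          have "(\<integral>\<^sup>+x. ennreal (cube_avg (G Q) Q * indicator Q x * g x) \<partial>lebesgue)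
              = (\<integral>\<^sup>+x. eavg (G Q) Q * (ennreal \<bar>g x\<bar> * indicator Q x) \<partial>lebesgue)"
            unfolding GQ[symmetric] using g(2) avgG0[of Q]
            by (intro nn_integral_cong) (auto simp: indicator_def ennreal_mult)
          also have "\<dots> = eavg (G Q) Q * (\<integral>\<^sup>+x\<in>Q. ennreal \<bar>g x\<bar> \<partial>lebesgue)"
            using g(1) rat_cube_measure(2)[OF Q] by (intro nn_integral_cmult) auto
          also have "\<dots> = (\<integral>\<^sup>+y\<in>Q. ennreal \<bar>G Q y\<bar> \<partial>lebesgue) * eavg g Q"
            unfolding eavg_def by (simp add: ennreal_times_divide mult.commute)
          also have "\<dots> = (\<integral>\<^sup>+y. ennreal \<bar>G Q y\<bar> * indicator Q y * eavg g Q \<partial>lebesgue)"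
            using Gm[OF Q] rat_cube_measure(2)[OF Q] by (intro nn_integral_multc[symmetric]) auto
          also have "\<dots> \<le> (\<integral>\<^sup>+x. ennreal (G Q x) * maximal g x \<partial>lebesgue)"
          proof (rule nn_integral_mono)
            fix x
            have "indicator Q x * eavg g Q \<le> maximal g x"
              unfolding maximal_eq_SUP_rat_cubes using SUP_upper[OF Q, of "\<lambda>Q. eavg g Q * indicator Q x"]
              by (simp add: mult.commute)
            then show "ennreal \<bar>G Q x\<bar> * indicator Q x * eavg g Q \<le> ennreal (G Q x) * maximal g x"
              using G0[of Q x] by (simp add: mult.assoc mult_left_mono)
          qed
          finally show ?thesis .
        qed
        have "(\<integral>\<^sup>+x. ennreal (H n x * g x) \<partial>lebesgue)
            = (\<integral>\<^sup>+x. (\<Sum>Q\<in>first_cubes n. ennreal (cube_avg (G Q) Q * indicator Q x * g x)) \<partial>lebesgue)"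
          unfolding H_def sum_distrib_right using avgG0 g(2) by (intro nn_integral_cong) (auto simp: sum_ennreal)
        also have "\<dots> = (\<Sum>Q\<in>first_cubes n. \<integral>\<^sup>+x. ennreal (cube_avg (G Q) Q * indicator Q x * g x) \<partial>lebesgue)"
        proof (rule nn_integral_sum)
          fix Q :: "'a set" assume "Q \<in> first_cubes n"
          then show "(\<lambda>x. ennreal (cube_avg (G Q) Q * indicator Q x * g x)) \<in> borel_measurable lebesgue"
            using g(1) rat_cube_measure(2)[OF first] by measurable
        qed
        also have "\<dots> \<le> (\<Sum>Q\<in>first_cubes n. \<integral>\<^sup>+x. ennreal (G Q x) * maximal g x \<partial>lebesgue)"
          by (intro sum_mono one_cube first)
        also have "\<dots> = (\<integral>\<^sup>+x. (\<Sum>Q\<in>first_cubes n. ennreal (G Q x) * maximal g x) \<partial>lebesgue)"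
          using Gm[OF first] Mgm by (intro nn_integral_sum[symmetric]) auto
        also have "\<dots> \<le> (\<integral>\<^sup>+x. ennreal \<bar>S x * enn2real (maximal g x)\<bar> \<partial>lebesgue)"
        proof (rule nn_integral_mono_AE)
          have fin: "AE x in lebesgue. maximal g x < \<infinity>" using Mg by simp
          show "AE x in lebesgue. (\<Sum>Q\<in>first_cubes n. ennreal (G Q x) * maximal g x) \<le> ennreal \<bar>S x * enn2real (maximal g x)\<bar>"
            using G_sum fin
          proof eventually_elim
            case (elim x)
            have "(\<Sum>Q\<in>first_cubes n. ennreal (G Q x) * maximal g x) = ennreal (\<Sum>Q\<in>first_cubes n. G Q x) * maximal g x"
              using G0 by (simp add: sum_distrib_right[symmetric] sum_ennreal)
            also have "\<dots> \<le> ennreal (S x) * maximal g x"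
              using elim by (intro mult_right_mono ennreal_leI) auto
            also have "\<dots> = ennreal \<bar>S x * enn2real (maximal g x)\<bar>"
              using elim S0[of x] by (cases "maximal g x") (auto simp: ennreal_mult)
            finally show ?case .
          qed
        qed
        also have "\<dots> \<le> N S * koethe_dual N (\<lambda>x. enn2real (maximal g x))"
          using Mg by (intro koethe_dual_Hoelder Sm NS) auto
        also have "\<dots> \<le> N S * (ennreal C2 * koethe_dual N g)"
          using Mg by (intro mult_left_mono) auto
        also have "\<dots> \<le> N S * (ennreal (max 0 C2) * 1)"
          using g(3) by (intro mult_left_mono mult_mono ennreal_leI) auto
        also have "\<dots> = ennreal (max 0 C2 * s)" using s by (simp add: ennreal_mult' mult.commute)
        finally show "(\<integral>\<^sup>+x. ennreal (H n x * g x) \<partial>lebesgue) \<le> ennreal (max 0 C2 * s)" .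
      qed
      then show ?thesis using s by (simp add: ennreal_mult')
    qed
    have Mm: "Mfam F Q \<in> borel_measurable lebesgue" if "Q \<in> rat_cubes" for Q
      unfolding Mfam_def using rat_cube_measure(2)[OF that] by measurable
    have part_pt: "AE x in lebesgue. lr_part r (Mfam F) n x \<le> Q\<^sub>S x + H n x" for n
    proof -
      have "AE x in lebesgue. maximal S x < \<infinity>" using MS by simp
      then show ?thesis
      proof eventually_elim
        case (elim x)
        have QS0: "0 \<le> Q\<^sub>S x" by (simp add: Q\<^sub>S_def)
        have avgS: "cube_avg S Q \<le> Q\<^sub>S x" if Q: "Q \<in> rat_cubes" "x \<in> Q" for Q
        proof -
          have "ennreal (cube_avg S Q) = eavg S Q"
            by (rule eavg_eq_cube_avg[OF S_int[OF Q(1)] S0 Q(1), symmetric])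
          also have "\<dots> \<le> maximal S x"
            unfolding maximal_eq_SUP_rat_cubes using SUP_upper[OF Q(1), of "\<lambda>Q. eavg S Q * indicator Q x"] Q(2) by simp
          finally have "enn2real (ennreal (cube_avg S Q)) \<le> Q\<^sub>S x"
            unfolding Q\<^sub>S_def using elim by (intro enn2real_mono) auto
          then show ?thesis using cube_avg_nonneg[of S Q, OF S0] by simp
        qed
        have "(\<Sum>Q\<in>first_cubes n. \<bar>Mfam F Q x\<bar> powr r) \<le> (\<Sum>Q\<in>first_cubes n. Q\<^sub>S x powr (r - 1) * (cube_avg (G Q) Q * indicator Q x))"
        proof (rule sum_mono)
          fix Q :: "'a set" assume "Q \<in> first_cubes n"
          then have Q: "Q \<in> rat_cubes" by (rule first)
          show "\<bar>Mfam F Q x\<bar> powr r \<le> Q\<^sub>S x powr (r - 1) * (cube_avg (G Q) Q * indicator Q x)"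
          proof (cases "x \<in> Q")
            case True
            have "\<bar>Mfam F Q x\<bar> powr r = \<bar>cube_avg (F Q) Q\<bar> powr r" using True by (simp add: Mfam_def)
            also have "\<dots> \<le> cube_avg S Q powr (r - 1) * cube_avg (G Q) Q" by (rule jensen[OF Q])
            also have "\<dots> \<le> Q\<^sub>S x powr (r - 1) * cube_avg (G Q) Q"
              using r avgS[OF Q True] cube_avg_nonneg[of S Q, OF S0] by (intro mult_right_mono powr_mono2 avgG0) auto
            finally show ?thesis using True by simp
          qed (use r0 in \<open>simp add: Mfam_def\<close>)
        qed
        also have "\<dots> = Q\<^sub>S x powr (r - 1) * H n x" by (simp add: H_def sum_distrib_left)
        \<comment> \<open>Dominating both factors by the same sum makes the r-th root linear, so the
          triangle inequality for \<open>N\<close> is enough.\<close>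
        also have "\<dots> \<le> (Q\<^sub>S x + H n x) powr (r - 1) * (Q\<^sub>S x + H n x) powr 1"
          using r QS0 H0[of n x] by (intro mult_mono powr_mono2) auto
        also have "\<dots> = (Q\<^sub>S x + H n x) powr (r - 1 + 1)" by (rule powr_add[symmetric])
        also have "\<dots> = (Q\<^sub>S x + H n x) powr r" by simp
        finally have "lr_part r (Mfam F) n x \<le> ((Q\<^sub>S x + H n x) powr r) powr (1 / r)"
          unfolding lr_part_def using r0 by (intro powr_mono2 sum_nonneg) auto
        then show ?case using r0 QS0 H0[of n x] by (simp add: powr_inverse_self)
      qed
    qed
    have part_N: "N (lr_part r (Mfam F) n) \<le> ennreal C * N S" for n
    proof -
      have "N (lr_part r (Mfam F) n) \<le> N (\<lambda>x. Q\<^sub>S x + H n x)"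
      proof (rule N_mono_AE)
        show "AE x in lebesgue. \<bar>lr_part r (Mfam F) n x\<bar> \<le> \<bar>Q\<^sub>S x + H n x\<bar>"
          using part_pt[of n] by eventually_elim (use lr_part_nonneg[of r "Mfam F" n] in \<open>auto intro: order_trans[OF _ abs_ge_self]\<close>)
      qed (use QSm Hm borel_measurable_lr_part[OF Mm] in auto)
      also have "\<dots> \<le> N Q\<^sub>S + N (H n)" by (intro N_add QSm Hm)
      also have "\<dots> \<le> ennreal (max 0 C1) * N S + ennreal (max 0 C2) * N S"
      proof (intro add_mono NH)
        have "N Q\<^sub>S \<le> ennreal C1 * N S" using MS by (simp add: Q\<^sub>S_def)
        also have "\<dots> \<le> ennreal (max 0 C1) * N S" by (intro mult_right_mono ennreal_leI) auto
        finally show "N Q\<^sub>S \<le> ennreal (max 0 C1) * N S" .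
      qed
      also have "\<dots> = ennreal C * N S" unfolding C_def by (subst ennreal_plus) (auto simp: distrib_right)
      finally show ?thesis .
    qed
    have fin: "ennreal C * N S < \<infinity>" using NS by (simp add: ennreal_mult_less_top)
    \<comment> \<open>Passage from finite stages to all rational cubes; the first conclusion is the
      almost everywhere finiteness that the definition of \<open>Xlr_norm\<close> tests.\<close>
    note sup = N_SUP_le[where fs = "\<lambda>n. lr_part r (Mfam F) n", OF borel_measurable_lr_part[OF Mm] lr_part_nonneg lr_part_mono[OF r0] part_N fin]
    have "Xlr_norm N r (Mfam F) = N (\<lambda>x. enn2real (lr_norm r (Mfam F) x))"
      unfolding Xlr_norm_def meas_def lr_norm_eq_SUP[OF r0] using Mm sup(1) by (intro if_P) blast
    also have "\<dots> \<le> ennreal C * Xlr_norm N r F"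
      unfolding lr_norm_eq_SUP[OF r0] XS by (rule sup(2))
    finally show ?thesis using dom_int[OF _ Fm F_le] by blast
  qed
  then show ?thesis unfolding Mfam_bounded_def by blast
qed

end

theorem theorem3p21:
  fixes N :: "('a::euclidean_space \<Rightarrow> real) \<Rightarrow> ennreal" and r0 :: real
  assumes "r0 > 1"
    and "banach_function_norm N"
    and "r_convex N r0"
    and "fatou_property N"
  shows "(maximal_bounded N \<and> maximal_bounded (koethe_dual N)) \<longleftrightarrow>
         (\<exists>r. 1 < r \<and> r \<le> r0 \<and> Mfam_bounded N r)"
proof -
  interpret fatou_norm N
    using assms(2,4) by unfold_locales
  \<comment> \<open>From (i) the averaging bound follows for every exponent above 1, so
    \<open>r0\<close> itself is the witness.\<close>
  show ?thesis
    using assms(1) Mfam_bounded_of_maximal_bounded maximal_bounded_of_Mfam_bounded by blast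
qed

end
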